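(* Let $n\ge 2$ be an integer, let $F\in\mathfrak{G}_n$, and let $c=\lceil\log_2 n\rceil$. Then the following are equivalent: (1) $F$ is a product of (finitely many) reversible elements of $\mathfrak{G}_n$. (2) The linear part of $F$ has determinant $\pm1$. (3) $F$ is the product of $2+3c$ reversible elements of $\mathfrak{G}_n$. (4) $F$ is the product of $9+6c$ involutions of $\mathfrak{G}_n$. (5) $F$ is the product of $3+6c$ involutions of $\mathfrak{G}_n$ and two reversible elements of $\mathfrak{G}_n$ of order dividing $4$.
   Context: For $n\in\mathbb{N}$, let $\mathfrak{G}_n$ denote the group, under formal composition, of formally invertible formal maps of $(\mathbb{C}^n,0)$: its elements are $n$-tuples $F=(F_{,1},\dots,F_{,n})$ of formal power series in $n$ commuting variables with complex coefficients and zero constant terms, whose linear part $L(F)$ (the homogeneous degree-one part of $F$, viewed as an $n\times n$ complex matrix) lies in $\mathrm{GL}(n,\mathbb{C})$. The series need not converge. An element $g$ of a group $G$ is reversible if there is $h\in G$ with $h^{-1}gh=g^{-1}$. An element is an involution if it equals its own inverse (so the identity counts as an involution and as a reversible element). *)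

theory Defs
  imports
    Complex_Main
    "HOL-Library.Poly_Mapping"
    "HOL-Algebra.Multiplicative_Group"
    "Jordan_Normal_Form.Determinant"
begin

section \<open>Formal power series in several commuting variables\<close>

text \<open>
  The variables are indexed by the natural numbers, and a monomial is a finitely supported
  exponent vector. Series in \<open>n\<close> variables are those that involve only the variables with
  index below \<open>n\<close> (predicate \<open>in_vars\<close>).
\<close>

typedef 'a mfps = "UNIV :: ((nat \<Rightarrow>\<^sub>0 nat) \<Rightarrow> 'a) set"
  morphisms mcoeff Abs_mfps
  by simp

lemma mcoeff_Abs_mfps [simp]: "mcoeff (Abs_mfps f) = f"
  by (simp add: Abs_mfps_inverse)

lemma mfps_eqI: "(\<And>\<alpha>. mcoeff f \<alpha> = mcoeff g \<alpha>) \<Longrightarrow> f = g"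
  by (metis ext mcoeff_inject)

lemma finite_add_decompositions:
  "finite {(\<gamma>, \<delta>). \<gamma> + \<delta> = (\<beta> :: nat \<Rightarrow>\<^sub>0 nat)}"
proof -
  let ?D = "{\<gamma>. \<exists>\<delta>. \<gamma> + \<delta> = \<beta>}"
  let ?S = "{f. \<forall>i. (i \<in> Poly_Mapping.keys \<beta> \<longrightarrow> f i \<in> {..Max (insert 0 (Poly_Mapping.lookup \<beta> ` Poly_Mapping.keys \<beta>))})
                    \<and> (i \<notin> Poly_Mapping.keys \<beta> \<longrightarrow> f i = (0::nat))}"
  have "finite ?S"
    by (rule finite_set_of_finite_funs) auto
  moreover have "Poly_Mapping.lookup ` ?D \<subseteq> ?S"
  proof clarify
    fix \<gamma> \<delta> :: "nat \<Rightarrow>\<^sub>0 nat" and i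
    have l: "Poly_Mapping.lookup \<gamma> i \<le> Poly_Mapping.lookup (\<gamma> + \<delta>) i"
      by (simp add: lookup_add)
    have "Poly_Mapping.lookup (\<gamma> + \<delta>) i \<le> Max (insert 0 (Poly_Mapping.lookup (\<gamma> + \<delta>) ` Poly_Mapping.keys (\<gamma> + \<delta>)))"
      if "i \<in> Poly_Mapping.keys (\<gamma> + \<delta>)"
      using that by (intro Max_ge) auto
    moreover have "Poly_Mapping.lookup (\<gamma> + \<delta>) i = 0" if "i \<notin> Poly_Mapping.keys (\<gamma> + \<delta>)"
      using that by (simp add: in_keys_iff)
    ultimately show "(i \<in> Poly_Mapping.keys (\<gamma> + \<delta>) \<longrightarrow>
        Poly_Mapping.lookup \<gamma> i \<in> {..Max (insert 0 (Poly_Mapping.lookup (\<gamma> + \<delta>) ` Poly_Mapping.keys (\<gamma> + \<delta>)))})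
        \<and> (i \<notin> Poly_Mapping.keys (\<gamma> + \<delta>) \<longrightarrow> Poly_Mapping.lookup \<gamma> i = 0)"
      using l by (metis atMost_iff le_trans le_zero_eq)
  qed
  ultimately have "finite (Poly_Mapping.lookup ` ?D)"
    by (rule rev_finite_subset)
  then have "finite ?D"
    by (rule finite_imageD) (auto intro: inj_onI)
  then have "finite (?D \<times> ?D)" by simp
  moreover have "{(\<gamma>, \<delta>). \<gamma> + \<delta> = \<beta>} \<subseteq> ?D \<times> ?D"
    by (auto; metis add.commute)
  ultimately show ?thesis by (rule rev_finite_subset)
qed

instantiation mfps :: (comm_ring_1) comm_ring_1
begin

definition zero_mfps :: "'a mfps" where
  "0 = Abs_mfps (\<lambda>_. 0)"

definition one_mfps :: "'a mfps" where
  "1 = Abs_mfps (\<lambda>\<alpha>. if \<alpha> = 0 then 1 else 0)"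

definition plus_mfps :: "'a mfps \<Rightarrow> 'a mfps \<Rightarrow> 'a mfps" where
  "f + g = Abs_mfps (\<lambda>\<alpha>. mcoeff f \<alpha> + mcoeff g \<alpha>)"

definition minus_mfps :: "'a mfps \<Rightarrow> 'a mfps \<Rightarrow> 'a mfps" where
  "f - g = Abs_mfps (\<lambda>\<alpha>. mcoeff f \<alpha> - mcoeff g \<alpha>)"

definition uminus_mfps :: "'a mfps \<Rightarrow> 'a mfps" where
  "- f = Abs_mfps (\<lambda>\<alpha>. - mcoeff f \<alpha>)"

definition times_mfps :: "'a mfps \<Rightarrow> 'a mfps \<Rightarrow> 'a mfps" where
  "f * g = Abs_mfps (\<lambda>\<beta>. \<Sum>(\<gamma>, \<delta>) | \<gamma> + \<delta> = \<beta>. mcoeff f \<gamma> * mcoeff g \<delta>)"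

instance
proof
  fix f g h :: "'a mfps"
  show "f * g * h = f * (g * h)"
  proof (rule mfps_eqI)
    fix \<beta> :: "nat \<Rightarrow>\<^sub>0 nat"
    have "mcoeff (f * g * h) \<beta> =
        (\<Sum>((\<gamma>, \<delta>), (\<mu>, \<nu>)) \<in> (SIGMA p : {(\<gamma>, \<delta>). \<gamma> + \<delta> = \<beta>}. {(\<mu>, \<nu>). \<mu> + \<nu> = fst p}).
           mcoeff f \<mu> * mcoeff g \<nu> * mcoeff h \<delta>)"
      by (simp add: times_mfps_def sum_distrib_right split_def
          sum.Sigma[OF finite_add_decompositions ballI[OF finite_add_decompositions], unfolded split_def])
    also have "\<dots> =
        (\<Sum>((\<gamma>, \<delta>), (\<mu>, \<nu>)) \<in> (SIGMA p : {(\<gamma>, \<delta>). \<gamma> + \<delta> = \<beta>}. {(\<mu>, \<nu>). \<mu> + \<nu> = snd p}).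
           mcoeff f \<gamma> * (mcoeff g \<mu> * mcoeff h \<nu>))"
      by (rule sum.reindex_bij_witness
          [where i = "\<lambda>((\<gamma>, \<delta>), (\<mu>, \<nu>)). ((\<gamma> + \<mu>, \<nu>), (\<gamma>, \<mu>))"
             and j = "\<lambda>((\<gamma>, \<delta>), (\<mu>, \<nu>)). ((\<mu>, \<nu> + \<delta>), (\<nu>, \<delta>))"])
        (auto simp: ac_simps)
    also have "\<dots> = mcoeff (f * (g * h)) \<beta>"
      by (simp add: times_mfps_def sum_distrib_left split_def
          sum.Sigma[OF finite_add_decompositions ballI[OF finite_add_decompositions], unfolded split_def])
    finally show "mcoeff (f * g * h) \<beta> = mcoeff (f * (g * h)) \<beta>" .
  qed
  show "f * g = g * f"
  proof (rule mfps_eqI)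
    fix \<beta> :: "nat \<Rightarrow>\<^sub>0 nat"
    show "mcoeff (f * g) \<beta> = mcoeff (g * f) \<beta>"
      unfolding times_mfps_def mcoeff_Abs_mfps
      by (rule sum.reindex_bij_witness[where i = prod.swap and j = prod.swap])
        (auto simp: ac_simps)
  qed
  show "1 * f = f"
  proof (rule mfps_eqI)
    fix \<beta> :: "nat \<Rightarrow>\<^sub>0 nat"
    have z: "mcoeff 1 \<gamma> = (0 :: 'a)" if "\<gamma> \<noteq> 0" for \<gamma>
      using that by (simp add: one_mfps_def)
    have "mcoeff (1 * f) \<beta> = (\<Sum>(\<gamma>, \<delta>) \<in> {(0, \<beta>)}. mcoeff 1 \<gamma> * mcoeff f \<delta>)"
      unfolding times_mfps_def mcoeff_Abs_mfps
    proof (rule sum.mono_neutral_right[OF finite_add_decompositions])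
      show "\<forall>p \<in> {(\<gamma>, \<delta>). \<gamma> + \<delta> = \<beta>} - {(0, \<beta>)}. (case p of (\<gamma>, \<delta>) \<Rightarrow> mcoeff 1 \<gamma> * mcoeff f \<delta>) = 0"
      proof
        fix p
        assume p: "p \<in> {(\<gamma>, \<delta>). \<gamma> + \<delta> = \<beta>} - {(0, \<beta>)}"
        then have "fst p \<noteq> 0" by (cases p) auto
        then show "(case p of (\<gamma>, \<delta>) \<Rightarrow> mcoeff 1 \<gamma> * mcoeff f \<delta>) = 0"
          by (simp add: z split_def)
      qed
    qed simp
    then show "mcoeff (1 * f) \<beta> = mcoeff f \<beta>"
      by (simp add: one_mfps_def)
  qed
  show "(f + g) * h = f * h + g * h"
    by (rule mfps_eqI)
      (simp add: times_mfps_def plus_mfps_def split_def distrib_right sum.distrib)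
  show "(0 :: 'a mfps) \<noteq> 1"
  proof
    assume "(0 :: 'a mfps) = 1"
    then have "mcoeff (0 :: 'a mfps) 0 = mcoeff 1 0" by simp
    then show False by (simp add: zero_mfps_def one_mfps_def)
  qed
qed (auto intro!: mfps_eqI simp: plus_mfps_def zero_mfps_def minus_mfps_def uminus_mfps_def)

end

definition mfps_X :: "nat \<Rightarrow> 'a::comm_ring_1 mfps" where
  "mfps_X i = Abs_mfps (\<lambda>\<alpha>. if \<alpha> = Poly_Mapping.single i 1 then 1 else 0)"

definition in_vars :: "nat \<Rightarrow> 'a::zero mfps \<Rightarrow> bool" where
  "in_vars n f \<longleftrightarrow> (\<forall>\<alpha>. mcoeff f \<alpha> \<noteq> 0 \<longrightarrow> Poly_Mapping.keys \<alpha> \<subseteq> {..<n})"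

definition total_degree :: "(nat \<Rightarrow>\<^sub>0 nat) \<Rightarrow> nat" where
  "total_degree \<alpha> = (\<Sum>i\<in>Poly_Mapping.keys \<alpha>. Poly_Mapping.lookup \<alpha> i)"


section \<open>Formal maps\<close>

text \<open>
  Substitution of the tuple \<open>G\<close> for the variables of \<open>f\<close>: formally it is the sum over all
  exponents \<open>\<alpha>\<close> of \<open>f\<^sub>\<alpha> G\<^sup>\<alpha>\<close>. It is used only if the components of \<open>G\<close> have zero constant
  term; then \<open>G\<^sup>\<alpha>\<close> has no terms of degree below \<open>|\<alpha>|\<close>, so that the finite sum over
  \<open>|\<alpha>| \<le> |\<beta>|\<close> is the full coefficient of the monomial \<open>\<beta>\<close>.
\<close>

definition mfps_subst :: "'a::comm_ring_1 mfps \<Rightarrow> 'a mfps vec \<Rightarrow> 'a mfps" where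
  "mfps_subst f G = Abs_mfps (\<lambda>\<beta>.
     \<Sum>\<alpha> | Poly_Mapping.keys \<alpha> \<subseteq> {..<dim_vec G} \<and> total_degree \<alpha> \<le> total_degree \<beta>.
       mcoeff f \<alpha> * mcoeff (\<Prod>i<dim_vec G. (G $ i) ^ Poly_Mapping.lookup \<alpha> i) \<beta>)"

definition formal_comp :: "'a::comm_ring_1 mfps vec \<Rightarrow> 'a mfps vec \<Rightarrow> 'a mfps vec" where
  "formal_comp F G = map_vec (\<lambda>f. mfps_subst f G) F"

definition linear_part :: "nat \<Rightarrow> 'a mfps vec \<Rightarrow> 'a mat" where
  "linear_part n F = mat n n (\<lambda>(i, j). mcoeff (F $ i) (Poly_Mapping.single j 1))"

definition formal_maps :: "nat \<Rightarrow> complex mfps vec monoid" where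
  "formal_maps n =
     \<lparr> carrier = {F \<in> carrier_vec n.
         (\<forall>i<n. in_vars n (F $ i) \<and> mcoeff (F $ i) 0 = 0) \<and> invertible_mat (linear_part n F)},
       monoid.mult = formal_comp,
       one = vec n mfps_X \<rparr>"


section \<open>Reversible elements and involutions of a group\<close>

definition reversible_elements :: "('a, 'b) monoid_scheme \<Rightarrow> 'a set" where
  "reversible_elements G =
     {g \<in> carrier G. \<exists>h\<in>carrier G. inv\<^bsub>G\<^esub> h \<otimes>\<^bsub>G\<^esub> g \<otimes>\<^bsub>G\<^esub> h = inv\<^bsub>G\<^esub> g}"

text \<open>The identity element counts as an involution.\<close>

definition involutions :: "('a, 'b) monoid_scheme \<Rightarrow> 'a set" where
  "involutions G = {g \<in> carrier G. inv\<^bsub>G\<^esub> g = g}"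

definition list_product :: "('a, 'b) monoid_scheme \<Rightarrow> 'a list \<Rightarrow> 'a" where
  "list_product G gs = foldr (\<otimes>\<^bsub>G\<^esub>) gs \<one>\<^bsub>G\<^esub>"

end

(*
Every F whose linear part L has determinant 1 or -1 is a product of ten involutions, for every
n >= 2; grouping them in pairs gives five reversible elements, and padding with the identity gives
all the numbers of factors in the statement, because c >= 1.

If L = D_1 ... D_m with linear involutions D_i, then F is sought as a product of conjugates of the
D_i by maps tangent to the identity, one degree at a time. Conjugating the i-th factor by id + h, h
homogeneous of degree K, changes the product in degree K by a twist of D_i h - h D_i. So all of degree
K can be reached as soon as the coinvariants of the group generated by the D_i on homogeneous vector
fields of degree K vanish. The D_i are chosen such that this holds for all K >= 2:

  L = P P' Q Q' (X X' Y Y') A A.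

Here P P' Q Q' = diag(d) with entries d_i whose multiplicative relations all come from that of their
product, so only the fields x_i (x_1 ... x_n)^m d/dx_i survive. P and Q are permutation matrices that
identify these fields for all i, and A is a shear-like involution that kills the one that is left.
The product X X' Y Y' comes from Sourour's factorization of nonscalar matrices.
*)

theory Submission
  imports Defs "HOL-Computational_Algebra.Primes"
begin

\<comment> \<open>A diagonal matrix that is a product of involutions has determinant 1 or -1, so
  (x_1 ... x_n)^2 is invariant under it and resonant fields occur in infinitely many degrees,
  whatever its entries are. Diagonal twists alone can therefore never suffice. The way out is that
  the twist by each single D_i is reachable wherever D_i stands in the product, and hence, by
  telescoping, the twist by any product of the D_i. So P and Q contribute their own twists besides
  being factors of diag(d), and the pair A A, whose product is the identity, adds one more twist
  without changing L. The factors X, X', Y, Y' have no such duty, they only adjust the linear part;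
  for them it must be arranged that the matrix to be factored is not scalar. If diag(d)^-1 L is
  scalar, diag(d) and its inverse exchange their roles. Conjugation keeps every factor an exact
  involution, and a correction in degree K leaves all lower degrees alone, so the factors converge
  coefficientwise, and their limits are involutions again.\<close>
alias lookup = Poly_Mapping.lookup
alias keys = Poly_Mapping.keys
alias single = Poly_Mapping.single

section \<open>Order of vanishing and substitution\<close>

lemma mcoeff_zero [simp]: "mcoeff 0 \<alpha> = 0"
  and mcoeff_plus [simp]: "mcoeff (f + g) \<alpha> = mcoeff f \<alpha> + mcoeff g \<alpha>"
  and mcoeff_minus [simp]: "mcoeff (f - g) \<alpha> = mcoeff f \<alpha> - mcoeff g \<alpha>"
  and mcoeff_uminus [simp]: "mcoeff (- f) \<alpha> = - mcoeff f \<alpha>"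
  and mcoeff_one: "mcoeff 1 \<alpha> = (if \<alpha> = 0 then 1 else 0)"
  for f g :: "'a::comm_ring_1 mfps"
  by (simp_all add: zero_mfps_def plus_mfps_def minus_mfps_def uminus_mfps_def one_mfps_def)

lemma mcoeff_times:
  "mcoeff (f * g) \<beta> = (\<Sum>p | fst p + snd p = \<beta>. mcoeff f (fst p) * mcoeff g (snd p))"
  for f g :: "'a::comm_ring_1 mfps"
  by (simp add: times_mfps_def split_def)

lemma mcoeff_sum [simp]: "mcoeff (sum f A) \<alpha> = (\<Sum>a\<in>A. mcoeff (f a) \<alpha>)"
  for f :: "'b \<Rightarrow> 'a::comm_ring_1 mfps"
  by (induction A rule: infinite_finite_induct) auto

lemma finite_decomp: "finite {p. fst p + snd p = (\<beta> :: nat \<Rightarrow>\<^sub>0 nat)}"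
  using finite_add_decompositions[of \<beta>] by (simp add: split_def)

definition mfps_monom :: "(nat \<Rightarrow>\<^sub>0 nat) \<Rightarrow> 'a::comm_ring_1 mfps" where
  "mfps_monom \<alpha> = Abs_mfps (\<lambda>\<beta>. if \<beta> = \<alpha> then 1 else 0)"

text \<open>Scalars enter as constant series, so that scaling a series or a tuple is multiplication
  in the ring of series.\<close>

definition mfps_const :: "'a::comm_ring_1 \<Rightarrow> 'a mfps" where
  "mfps_const c = Abs_mfps (\<lambda>\<alpha>. if \<alpha> = 0 then c else 0)"

lemma mcoeff_monom: "mcoeff (mfps_monom \<alpha>) \<beta> = (if \<beta> = \<alpha> then 1 else 0)"
  by (simp add: mfps_monom_def)

lemma mcoeff_const: "mcoeff (mfps_const c) \<alpha> = (if \<alpha> = 0 then c else 0)"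
  by (simp add: mfps_const_def)

lemma mcoeff_const_times [simp]: "mcoeff (mfps_const c * f) \<alpha> = c * mcoeff f \<alpha>"
proof -
  have "mcoeff (mfps_const c * f) \<alpha> = (\<Sum>p\<in>{(0, \<alpha>)}. mcoeff (mfps_const c) (fst p) * mcoeff f (snd p))"
    unfolding mcoeff_times
    by (rule sum.mono_neutral_right[OF finite_decomp]) (auto simp: mcoeff_const)
  then show ?thesis by (simp add: mcoeff_const)
qed

lemma mfps_monom_mult: "mfps_monom \<alpha> * mfps_monom \<beta> = mfps_monom (\<alpha> + \<beta>)"
proof (rule mfps_eqI)
  fix \<gamma>
  have "mcoeff (mfps_monom \<alpha> * mfps_monom \<beta> :: 'a mfps) \<gamma>
      = (\<Sum>p | fst p + snd p = \<gamma>. if p = (\<alpha>, \<beta>) then 1 else 0)"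
    unfolding mcoeff_times by (intro sum.cong) (auto simp: mcoeff_monom prod_eq_iff)
  also have "\<dots> = mcoeff (mfps_monom (\<alpha> + \<beta>)) \<gamma>"
    by (auto simp: sum.delta[OF finite_decomp] mcoeff_monom)
  finally show "mcoeff (mfps_monom \<alpha> * mfps_monom \<beta> :: 'a mfps) \<gamma> = mcoeff (mfps_monom (\<alpha> + \<beta>)) \<gamma>" .
qed

lemma mfps_monom_zero: "mfps_monom 0 = 1"
  by (rule mfps_eqI) (simp add: mcoeff_monom mcoeff_one)

lemma mfps_X_monom: "mfps_X i = mfps_monom (single i 1)"
  by (simp add: mfps_X_def mfps_monom_def)

lemma mfps_X_power: "mfps_X i ^ k = mfps_monom (single i k)"
proof (induction k)
  case (Suc k)
  have "single i 1 + single i k = single i (Suc k)"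
    by (simp flip: single_add)
  with Suc show ?case by (simp add: mfps_X_monom mfps_monom_mult)
qed (simp add: mfps_monom_zero)

lemma mfps_const_simps:
  "mfps_const 0 = 0" "mfps_const 1 = 1"
  "mfps_const (a + b) = mfps_const a + mfps_const b"
  "mfps_const (a * b) = mfps_const a * mfps_const b"
  "mfps_const (- a) = - mfps_const a"
  "mfps_const (a - b) = mfps_const a - mfps_const b"
  by (rule mfps_eqI; simp add: mcoeff_const mcoeff_one)+

lemma mfps_const_sum: "mfps_const (sum f A) = (\<Sum>a\<in>A. mfps_const (f a))"
  by (induction A rule: infinite_finite_induct) (auto simp: mfps_const_simps)

lemma mfps_const_power: "mfps_const (a ^ k) = mfps_const a ^ k"
  by (induction k) (auto simp: mfps_const_simps)

section \<open>Total degree of exponent vectors\<close>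

lemma total_degree_eq_sum:
  assumes "finite A" "keys \<alpha> \<subseteq> A"
  shows "total_degree \<alpha> = (\<Sum>i\<in>A. lookup \<alpha> i)"
  unfolding total_degree_def
  using assms by (intro sum.mono_neutral_left) (auto simp: in_keys_iff)

lemma keys_add_nat: "keys (\<alpha> + \<beta>) = keys \<alpha> \<union> keys \<beta>"
  for \<alpha> \<beta> :: "nat \<Rightarrow>\<^sub>0 nat"
  by (auto simp: in_keys_iff lookup_add)

lemma total_degree_add [simp]: "total_degree (\<alpha> + \<beta>) = total_degree \<alpha> + total_degree \<beta>"
proof -
  let ?A = "keys \<alpha> \<union> keys \<beta>"
  have "total_degree (\<alpha> + \<beta>) = (\<Sum>i\<in>?A. lookup (\<alpha> + \<beta>) i)"
    by (intro total_degree_eq_sum) (auto simp: keys_add_nat)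
  moreover have "total_degree \<alpha> = (\<Sum>i\<in>?A. lookup \<alpha> i)"
    "total_degree \<beta> = (\<Sum>i\<in>?A. lookup \<beta> i)"
    by (intro total_degree_eq_sum; auto)+
  ultimately show ?thesis by (simp add: lookup_add sum.distrib)
qed

lemma total_degree_zero [simp]: "total_degree 0 = 0"
  by (simp add: total_degree_def)

lemma total_degree_single [simp]: "total_degree (single i k) = k"
  by (subst total_degree_eq_sum[of "{i}"]) auto

lemma lookup_le_total_degree: "lookup \<alpha> i \<le> total_degree \<alpha>"
proof -
  have "total_degree \<alpha> = (\<Sum>j\<in>insert i (keys \<alpha>). lookup \<alpha> j)"
    by (intro total_degree_eq_sum) auto
  also have "\<dots> \<ge> lookup \<alpha> i"
    by (rule member_le_sum) auto
  finally show ?thesis .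
qed

lemma total_degree_eq_0_iff [simp]: "total_degree \<alpha> = 0 \<longleftrightarrow> \<alpha> = 0"
proof
  assume "total_degree \<alpha> = 0"
  then show "\<alpha> = 0"
    using lookup_le_total_degree[of \<alpha>] by (intro poly_mapping_eqI) simp
qed simp

lemma total_degree_1E:
  assumes "total_degree \<alpha> = 1"
  obtains i where "\<alpha> = single i 1"
proof -
  obtain i where i: "i \<in> keys \<alpha>"
    using assms by (metis total_degree_zero keys_eq_empty all_not_in_conv zero_neq_one)
  have "total_degree \<alpha> = lookup \<alpha> i + (\<Sum>j\<in>keys \<alpha> - {i}. lookup \<alpha> j)"
    using i by (simp add: total_degree_def sum.remove)
  moreover have "lookup \<alpha> i \<noteq> 0" using i by (simp add: in_keys_iff)
  ultimately have 1: "lookup \<alpha> i = 1" "(\<Sum>j\<in>keys \<alpha> - {i}. lookup \<alpha> j) = 0"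
    using assms by linarith+
  have "lookup \<alpha> j = 0" if "j \<noteq> i" for j
  proof (cases "j \<in> keys \<alpha>")
    case True
    then have "j \<in> keys \<alpha> - {i}" using that by simp
    with 1(2) show ?thesis by (meson finite_Diff finite_keys sum_eq_0_iff)
  qed (simp add: in_keys_iff)
  then have "\<alpha> = single i 1"
    using 1 by (intro poly_mapping_eqI) (auto simp: lookup_single when_def)
  then show thesis by (rule that)
qed

text \<open>The finite index set of the sums in \<open>mfps_subst\<close>, with the degree bound
  detached from the monomial whose coefficient is computed.\<close>

definition exps :: "nat \<Rightarrow> nat \<Rightarrow> (nat \<Rightarrow>\<^sub>0 nat) set" where
  "exps n N = {\<alpha>. keys \<alpha> \<subseteq> {..<n} \<and> total_degree \<alpha> \<le> N}"

lemma exps_iff: "\<alpha> \<in> exps n N \<longleftrightarrow> keys \<alpha> \<subseteq> {..<n} \<and> total_degree \<alpha> \<le> N"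
  by (simp add: exps_def)

lemma finite_exps [simp]: "finite (exps n N)"
proof -
  have "lookup ` exps n N \<subseteq>
      {f. \<forall>i. (i \<in> {..<n} \<longrightarrow> f i \<in> {..N}) \<and> (i \<notin> {..<n} \<longrightarrow> f i = 0)}"
    using order_trans[OF lookup_le_total_degree]
    by (auto simp: exps_iff in_keys_iff subset_iff)
  moreover have "finite {f. \<forall>i. (i \<in> {..<n} \<longrightarrow> f i \<in> {..N}) \<and> (i \<notin> {..<n} \<longrightarrow> f i = (0::nat))}"
    by (rule finite_set_of_finite_funs) auto
  ultimately have "finite (lookup ` exps n N)"
    by (rule finite_subset)
  then show ?thesis
    by (rule finite_imageD) (auto intro: inj_onI)
qed

section \<open>The filtration of the series ring by order of vanishing\<close>

definition ord_ge :: "nat \<Rightarrow> 'a::comm_ring_1 mfps set" where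
  "ord_ge K = {f. \<forall>\<alpha>. total_degree \<alpha> < K \<longrightarrow> mcoeff f \<alpha> = 0}"

lemma ord_geD: "f \<in> ord_ge K \<Longrightarrow> total_degree \<alpha> < K \<Longrightarrow> mcoeff f \<alpha> = 0"
  by (simp add: ord_ge_def)

lemma ord_ge_zero [simp]: "0 \<in> ord_ge K"
  and ord_ge_add [intro]: "f \<in> ord_ge K \<Longrightarrow> g \<in> ord_ge K \<Longrightarrow> f + g \<in> ord_ge K"
  and ord_ge_diff [intro]: "f \<in> ord_ge K \<Longrightarrow> g \<in> ord_ge K \<Longrightarrow> f - g \<in> ord_ge K"
  and ord_ge_uminus [intro]: "f \<in> ord_ge K \<Longrightarrow> - f \<in> ord_ge K"
  by (auto simp: ord_ge_def)

lemma ord_ge_diff_trans: "f - g \<in> ord_ge K \<Longrightarrow> g - h \<in> ord_ge K \<Longrightarrow> f - h \<in> ord_ge K"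
  using ord_ge_add[of "f - g" K "g - h"] by simp

lemma ord_ge_diff_sym: "f - g \<in> ord_ge K \<Longrightarrow> g - f \<in> ord_ge K"
  using ord_ge_uminus[of "f - g" K] by simp

lemma ord_ge_mono: "f \<in> ord_ge K \<Longrightarrow> J \<le> K \<Longrightarrow> f \<in> ord_ge J"
  by (auto simp: ord_ge_def)

lemma ord_ge_0 [simp]: "ord_ge 0 = UNIV"
  by (auto simp: ord_ge_def)

lemma ord_ge_1_iff: "f \<in> ord_ge 1 \<longleftrightarrow> mcoeff f 0 = 0"
  by (auto simp: ord_ge_def)

lemma ord_ge_mult:
  assumes "f \<in> ord_ge J" "g \<in> ord_ge K" shows "f * g \<in> ord_ge (J + K)"
proof -
  have "mcoeff f (fst p) * mcoeff g (snd p) = 0" if "total_degree (fst p + snd p) < J + K" for p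
  proof -
    from that have "total_degree (fst p) < J \<or> total_degree (snd p) < K" by simp linarith
    then show ?thesis using assms by (auto simp: ord_ge_def)
  qed
  then show ?thesis unfolding ord_ge_def mem_Collect_eq mcoeff_times by (intro allI impI sum.neutral) auto
qed

lemma ord_ge_mult_left: "f \<in> ord_ge K \<Longrightarrow> g * f \<in> ord_ge K"
  using ord_ge_mult[of g 0 f K] by simp

lemma ord_ge_sum: "(\<And>a. a \<in> A \<Longrightarrow> f a \<in> ord_ge K) \<Longrightarrow> sum f A \<in> ord_ge K"
  by (induction A rule: infinite_finite_induct) auto

lemma ord_ge_power: "f \<in> ord_ge J \<Longrightarrow> f ^ k \<in> ord_ge (k * J)"
  by (induction k) (auto intro: ord_ge_mult)

lemma ord_ge_prod:
  assumes "\<And>a. a \<in> A \<Longrightarrow> f a \<in> ord_ge (d a)"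
  shows "prod f A \<in> ord_ge (sum d A)"
  using assms by (induction A rule: infinite_finite_induct) (auto intro: ord_ge_mult)

text \<open>The filtration is separated; infinite identities are proved below by verifying them
  modulo every order.\<close>

lemma ord_ge_all_zero: "(\<And>K. f \<in> ord_ge K) \<Longrightarrow> f = 0"
  by (rule mfps_eqI) (metis lessI mcoeff_zero ord_geD)

lemma ord_ge_all_eq: "(\<And>K. f - g \<in> ord_ge K) \<Longrightarrow> f = g"
  using ord_ge_all_zero[of "f - g"] by simp

lemma mfps_monom_ord_ge: "mfps_monom \<alpha> \<in> ord_ge (total_degree \<alpha>)"
  by (auto simp: ord_ge_def mcoeff_monom)

lemma in_vars_zero [simp]: "in_vars n 0"
  and in_vars_one [simp]: "in_vars n 1"
  and in_vars_const [simp]: "in_vars n (mfps_const c)"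
  and in_vars_uminus [intro]: "in_vars n f \<Longrightarrow> in_vars n (- f)"
  and in_vars_add [intro]: "in_vars n f \<Longrightarrow> in_vars n g \<Longrightarrow> in_vars n (f + g)"
  and in_vars_diff [intro]: "in_vars n f \<Longrightarrow> in_vars n g \<Longrightarrow> in_vars n (f - g)"
  and in_vars_X: "i < n \<Longrightarrow> in_vars n (mfps_X i)"
  and in_vars_monom: "keys \<alpha> \<subseteq> {..<n} \<Longrightarrow> in_vars n (mfps_monom \<alpha>)"
  for f g :: "'a::comm_ring_1 mfps"
  by (force simp: in_vars_def mcoeff_one mcoeff_const mcoeff_monom mfps_X_monom)+

lemma in_vars_mult [intro]:
  assumes "in_vars n f" "in_vars n g"
  shows "in_vars n (f * g :: 'a::comm_ring_1 mfps)"
  unfolding in_vars_def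
proof (intro allI impI)
  fix \<alpha>
  assume "mcoeff (f * g) \<alpha> \<noteq> 0"
  then obtain p where "p \<in> {p. fst p + snd p = \<alpha>}" "mcoeff f (fst p) * mcoeff g (snd p) \<noteq> 0"
    unfolding mcoeff_times by (rule sum.not_neutral_contains_not_neutral)
  then have "fst p + snd p = \<alpha>" "mcoeff f (fst p) \<noteq> 0" "mcoeff g (snd p) \<noteq> 0" by auto
  with assms show "keys \<alpha> \<subseteq> {..<n}"
    unfolding in_vars_def by (metis keys_add_nat Un_least)
qed

lemma in_vars_power [intro]: "in_vars n f \<Longrightarrow> in_vars n (f ^ k :: 'a::comm_ring_1 mfps)"
  by (induction k) auto

lemma in_vars_prod: "(\<And>a. a \<in> A \<Longrightarrow> in_vars n (f a)) \<Longrightarrow> in_vars n (prod f A :: 'a::comm_ring_1 mfps)"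
  by (induction A rule: infinite_finite_induct) auto

lemma in_vars_sum: "(\<And>a. a \<in> A \<Longrightarrow> in_vars n (f a)) \<Longrightarrow> in_vars n (sum f A :: 'a::comm_ring_1 mfps)"
  by (induction A rule: infinite_finite_induct) auto

section \<open>Substitution and its algebraic laws\<close>

definition mpow :: "'a::comm_ring_1 mfps vec \<Rightarrow> (nat \<Rightarrow>\<^sub>0 nat) \<Rightarrow> 'a mfps" where
  "mpow G \<alpha> = (\<Prod>i<dim_vec G. (G $ i) ^ lookup \<alpha> i)"

definition zero_const :: "'a::comm_ring_1 mfps vec \<Rightarrow> bool" where
  "zero_const G \<longleftrightarrow> (\<forall>i<dim_vec G. G $ i \<in> ord_ge 1)"

lemma mpow_zero [simp]: "mpow G 0 = 1"
  by (simp add: mpow_def)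

lemma mpow_add: "mpow G (\<alpha> + \<beta>) = mpow G \<alpha> * mpow G \<beta>"
  by (simp add: mpow_def lookup_add power_add prod.distrib)

lemma mpow_single: "i < dim_vec G \<Longrightarrow> mpow G (single i k) = (G $ i) ^ k"
proof -
  assume i: "i < dim_vec G"
  have "mpow G (single i k) = (\<Prod>j<dim_vec G. if j = i then (G $ j) ^ k else 1)"
    unfolding mpow_def by (intro prod.cong) (auto simp: lookup_single when_def)
  then show ?thesis using i by simp
qed

lemma mpow_ord_ge:
  assumes "zero_const G" "keys \<alpha> \<subseteq> {..<dim_vec G}"
  shows "mpow G \<alpha> \<in> ord_ge (total_degree \<alpha>)"
proof -
  have "mpow G \<alpha> \<in> ord_ge (\<Sum>i<dim_vec G. lookup \<alpha> i * 1)"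
    unfolding mpow_def
    by (intro ord_ge_prod ord_ge_power) (use assms in \<open>auto simp: zero_const_def\<close>)
  then show ?thesis using assms by (simp add: total_degree_eq_sum[of "{..<dim_vec G}"])
qed

lemma mpow_X: "keys \<alpha> \<subseteq> {..<n} \<Longrightarrow> mpow (vec n mfps_X) \<alpha> = mfps_monom \<alpha>"
proof -
  have "(\<Prod>i\<in>A. mfps_monom (single i (lookup \<alpha> i))) 
       = (mfps_monom (\<Sum>i\<in>A. single i (lookup \<alpha> i)) :: 'a mfps)" if "finite A" for A
    using that by induction (auto simp: mfps_monom_zero mfps_monom_mult)
  moreover assume "keys \<alpha> \<subseteq> {..<n}"
  then have "(\<Sum>i\<in>{..<n}. single i (lookup \<alpha> i)) = \<alpha>"
    by (intro poly_mapping_eqI)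
      (auto simp: lookup_sum lookup_single when_def in_keys_iff subset_iff)
  ultimately show ?thesis
    by (simp add: mpow_def mfps_X_power)
qed

lemma in_vars_mpow:
  "(\<And>i. i < dim_vec G \<Longrightarrow> in_vars n (G $ i)) \<Longrightarrow> in_vars n (mpow G \<alpha>)"
  unfolding mpow_def by (auto intro: in_vars_prod)

text \<open>Since G^\<alpha> vanishes to order |\<alpha>|, enlarging the degree bound adds only zero
  terms. A common bound N lets sums for different monomials \<beta> be compared term by
  term.\<close>

lemma mcoeff_subst:
  assumes "zero_const G" "total_degree \<beta> \<le> N"
  shows "mcoeff (mfps_subst f G) \<beta> = (\<Sum>\<alpha>\<in>exps (dim_vec G) N. mcoeff f \<alpha> * mcoeff (mpow G \<alpha>) \<beta>)"
proof -
  have "mcoeff (mfps_subst f G) \<beta> = (\<Sum>\<alpha>\<in>exps (dim_vec G) (total_degree \<beta>). mcoeff f \<alpha> * mcoeff (mpow G \<alpha>) \<beta>)"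
    by (simp add: mfps_subst_def exps_def mpow_def)
  also have "\<dots> = (\<Sum>\<alpha>\<in>exps (dim_vec G) N. mcoeff f \<alpha> * mcoeff (mpow G \<alpha>) \<beta>)"
  proof (rule sum.mono_neutral_left)
    have "mcoeff (mpow G \<alpha>) \<beta> = 0" if "\<alpha> \<in> exps (dim_vec G) N - exps (dim_vec G) (total_degree \<beta>)" for \<alpha>
      using that by (intro ord_geD[OF mpow_ord_ge[OF assms(1)]]) (auto simp: exps_iff)
    then show "\<forall>\<alpha>\<in>exps (dim_vec G) N - exps (dim_vec G) (total_degree \<beta>). mcoeff f \<alpha> * mcoeff (mpow G \<alpha>) \<beta> = 0"
      by simp
  qed (use assms in \<open>auto simp: exps_iff\<close>)
  finally show ?thesis .
qed

lemma subst_add: "mfps_subst (f + g) G = mfps_subst f G + mfps_subst g G"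
  by (rule mfps_eqI) (simp add: mfps_subst_def distrib_right sum.distrib)

lemma subst_diff: "mfps_subst (f - g) G = mfps_subst f G - mfps_subst g G"
  by (rule mfps_eqI) (simp add: mfps_subst_def left_diff_distrib sum_subtractf)

lemma subst_zero [simp]: "mfps_subst 0 G = 0"
  by (rule mfps_eqI) (simp add: mfps_subst_def)

lemma subst_sum: "mfps_subst (sum f A) G = (\<Sum>a\<in>A. mfps_subst (f a) G)"
  by (induction A rule: infinite_finite_induct) (auto simp: subst_add)

lemma subst_monom:
  assumes "zero_const G" "keys \<alpha> \<subseteq> {..<dim_vec G}"
  shows "mfps_subst (mfps_monom \<alpha>) G = mpow G \<alpha>"
proof (rule mfps_eqI)
  fix \<beta>
  have "mcoeff (mfps_subst (mfps_monom \<alpha>) G) \<beta>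
      = (\<Sum>\<gamma>\<in>exps (dim_vec G) (max (total_degree \<alpha>) (total_degree \<beta>)). if \<gamma> = \<alpha> then mcoeff (mpow G \<gamma>) \<beta> else 0)"
    unfolding mcoeff_subst[OF assms(1) max.cobounded2[of _ "total_degree \<alpha>"]]
    by (intro sum.cong) (auto simp: mcoeff_monom)
  also have "\<dots> = mcoeff (mpow G \<alpha>) \<beta>"
    by (subst sum.delta) (use assms in \<open>auto simp: exps_iff\<close>)
  finally show "mcoeff (mfps_subst (mfps_monom \<alpha>) G) \<beta> = mcoeff (mpow G \<alpha>) \<beta>" .
qed

lemma subst_X: "zero_const G \<Longrightarrow> i < dim_vec G \<Longrightarrow> mfps_subst (mfps_X i) G = G $ i"
  by (simp add: mfps_X_monom subst_monom mpow_single)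

lemma subst_ord_ge:
  assumes "zero_const G" "f \<in> ord_ge K" shows "mfps_subst f G \<in> ord_ge K"
  unfolding ord_ge_def
proof (clarify)
  fix \<beta> assume \<beta>: "total_degree \<beta> < K"
  show "mcoeff (mfps_subst f G) \<beta> = 0"
    unfolding mcoeff_subst[OF assms(1) order_refl]
    using \<beta> assms(2) by (intro sum.neutral) (auto simp: exps_iff ord_ge_def)
qed

lemma subst_times:
  assumes G: "zero_const G"
  shows "mfps_subst (f * g) G = mfps_subst f G * mfps_subst g G"
proof (rule mfps_eqI)
  fix \<beta>
  let ?n = "dim_vec G" and ?N = "total_degree \<beta>"
  let ?E = "exps ?n ?N"
  let ?t = "\<lambda>\<gamma> \<delta>. mcoeff f \<gamma> * mcoeff g \<delta> * mcoeff (mpow G \<gamma> * mpow G \<delta>) \<beta>"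
  have "mcoeff (mfps_subst (f * g) G) \<beta>
      = (\<Sum>\<alpha>\<in>?E. \<Sum>p | fst p + snd p = \<alpha>. ?t (fst p) (snd p))"
    unfolding mcoeff_subst[OF G order_refl] mcoeff_times[of f g] sum_distrib_right
    by (intro sum.cong refl) (auto simp: mpow_add)
  also have "\<dots> = (\<Sum>q\<in>(SIGMA \<alpha>:?E. {p. fst p + snd p = \<alpha>}). ?t (fst (snd q)) (snd (snd q)))"
    by (subst sum.Sigma) (auto simp: finite_decomp split_def)
  also have "\<dots> = (\<Sum>p\<in>{p \<in> ?E \<times> ?E. fst p + snd p \<in> ?E}. ?t (fst p) (snd p))"
    by (rule sum.reindex_bij_witness[where i = "\<lambda>p. (fst p + snd p, p)" and j = snd])
      (auto simp: exps_iff keys_add_nat)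
  \<comment> \<open>The triangular range of pairs can be completed to the full square: a pair of
    total degree above that of \<beta> contributes nothing, because the product of its two powers of
    G vanishes to that degree. Only over the square does the sum factor.\<close>
  also have "\<dots> = (\<Sum>p\<in>?E \<times> ?E. ?t (fst p) (snd p))"
  proof (rule sum.mono_neutral_left)
    show "\<forall>p\<in>?E \<times> ?E - {p \<in> ?E \<times> ?E. fst p + snd p \<in> ?E}. ?t (fst p) (snd p) = 0"
    proof
      fix p assume p: "p \<in> ?E \<times> ?E - {p \<in> ?E \<times> ?E. fst p + snd p \<in> ?E}"
      then have "?N < total_degree (fst p) + total_degree (snd p)"
        by (auto simp: exps_iff keys_add_nat)
      moreover have "mpow G (fst p) * mpow G (snd p) \<in> ord_ge (total_degree (fst p) + total_degree (snd p))"
        by (intro ord_ge_mult mpow_ord_ge G) (use p in \<open>auto simp: exps_iff\<close>)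
      ultimately show "?t (fst p) (snd p) = 0" by (simp add: ord_geD)
    qed
  qed auto
  also have "\<dots> = (\<Sum>p\<in>?E \<times> ?E. \<Sum>q | fst q + snd q = \<beta>.
      mcoeff f (fst p) * mcoeff (mpow G (fst p)) (fst q) * (mcoeff g (snd p) * mcoeff (mpow G (snd p)) (snd q)))"
    by (simp add: mcoeff_times sum_distrib_left mult_ac)
  also have "\<dots> = (\<Sum>q | fst q + snd q = \<beta>. \<Sum>p\<in>?E \<times> ?E. 
      mcoeff f (fst p) * mcoeff (mpow G (fst p)) (fst q) * (mcoeff g (snd p) * mcoeff (mpow G (snd p)) (snd q)))"
    by (rule sum.swap)
  also have "\<dots> = (\<Sum>q | fst q + snd q = \<beta>. mcoeff (mfps_subst f G) (fst q) * mcoeff (mfps_subst g G) (snd q))"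
  proof (rule sum.cong[OF refl])
    fix q assume "q \<in> {q. fst q + snd q = \<beta>}"
    then have q: "total_degree (fst q) \<le> ?N" "total_degree (snd q) \<le> ?N" by auto
    show "(\<Sum>p\<in>?E \<times> ?E. mcoeff f (fst p) * mcoeff (mpow G (fst p)) (fst q) * (mcoeff g (snd p) * mcoeff (mpow G (snd p)) (snd q)))
      = mcoeff (mfps_subst f G) (fst q) * mcoeff (mfps_subst g G) (snd q)"
      unfolding mcoeff_subst[OF G q(1)] mcoeff_subst[OF G q(2)] sum_product
      by (simp add: sum.cartesian_product split_def)
  qed
  also have "\<dots> = mcoeff (mfps_subst f G * mfps_subst g G) \<beta>"
    by (simp add: mcoeff_times)
  finally show "mcoeff (mfps_subst (f * g) G) \<beta> = mcoeff (mfps_subst f G * mfps_subst g G) \<beta>" .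
qed

lemma subst_one: "zero_const G \<Longrightarrow> mfps_subst 1 G = 1"
  using subst_monom[of G 0] by (simp add: mfps_monom_zero)

lemma subst_const: "zero_const G \<Longrightarrow> mfps_subst (mfps_const c) G = mfps_const c"
proof (rule mfps_eqI)
  fix \<beta> assume G: "zero_const G"
  have "mcoeff (mfps_subst (mfps_const c) G) \<beta>
    = (\<Sum>\<alpha>\<in>exps (dim_vec G) (total_degree \<beta>). if \<alpha> = 0 then c * mcoeff 1 \<beta> else 0)"
    unfolding mcoeff_subst[OF G order_refl] by (intro sum.cong) (auto simp: mcoeff_const)
  also have "\<dots> = mcoeff (mfps_const c) \<beta>"
    by (subst sum.delta) (simp, simp add: mcoeff_one mcoeff_const, simp add: exps_iff)
  finally show "mcoeff (mfps_subst (mfps_const c) G) \<beta> = mcoeff (mfps_const c) \<beta>" .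
qed

lemma subst_power: "zero_const G \<Longrightarrow> mfps_subst (f ^ k) G = mfps_subst f G ^ k"
  by (induction k) (auto simp: subst_one subst_times)

lemma subst_prod: "zero_const G \<Longrightarrow> mfps_subst (prod f A) G = (\<Prod>a\<in>A. mfps_subst (f a) G)"
  by (induction A rule: infinite_finite_induct) (auto simp: subst_one subst_times)

lemma subst_mpow:
  "zero_const H \<Longrightarrow> mfps_subst (mpow G \<alpha>) H = mpow (formal_comp G H) \<alpha>"
  by (simp add: mpow_def subst_prod subst_power formal_comp_def)

definition mtrunc :: "nat \<Rightarrow> nat \<Rightarrow> 'a::comm_ring_1 mfps \<Rightarrow> 'a mfps" where
  "mtrunc n N f = (\<Sum>\<alpha>\<in>exps n N. mfps_const (mcoeff f \<alpha>) * mfps_monom \<alpha>)"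

lemma mcoeff_mtrunc: "mcoeff (mtrunc n N f) \<alpha> = (if \<alpha> \<in> exps n N then mcoeff f \<alpha> else 0)"
proof -
  have "mcoeff (mtrunc n N f) \<alpha> = (\<Sum>\<gamma>\<in>exps n N. if \<gamma> = \<alpha> then mcoeff f \<alpha> else 0)"
    unfolding mtrunc_def mcoeff_sum by (intro sum.cong) (auto simp: mcoeff_monom)
  then show ?thesis by simp
qed

lemma mtrunc_cong: "in_vars n f \<Longrightarrow> f - mtrunc n N f \<in> ord_ge (Suc N)"
  by (auto simp: ord_ge_def mcoeff_mtrunc exps_def in_vars_def)

lemma subst_mtrunc_cong:
  assumes "zero_const G" "n = dim_vec G"
  shows "mfps_subst f G - (\<Sum>\<alpha>\<in>exps n N. mfps_const (mcoeff f \<alpha>) * mpow G \<alpha>) \<in> ord_ge (Suc N)"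
  using assms by (auto simp: ord_ge_def mcoeff_subst[of G _ N])

lemma zero_const_comp: "zero_const G \<Longrightarrow> zero_const H \<Longrightarrow> zero_const (formal_comp G H)"
  by (auto simp: zero_const_def formal_comp_def intro!: subst_ord_ge)

lemma dim_formal_comp [simp]: "dim_vec (formal_comp F G) = dim_vec F"
  by (simp add: formal_comp_def)

text \<open>Modulo order K + 1 both sides depend only on a polynomial truncation of f, and for
  polynomials the identity is the homomorphism property of substitution.\<close>

lemma subst_subst:
  assumes G: "zero_const G" and H: "zero_const H"
  shows "mfps_subst (mfps_subst f G) H = mfps_subst f (formal_comp G H)"
proof (rule ord_ge_all_eq)
  fix K
  let ?n = "dim_vec G"
  let ?c = "\<lambda>\<alpha>. mfps_const (mcoeff f \<alpha>)"
  define p where "p = (\<Sum>\<alpha>\<in>exps ?n K. ?c \<alpha> * mpow G \<alpha>)"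
  define q where "q = (\<Sum>\<alpha>\<in>exps ?n K. ?c \<alpha> * mpow (formal_comp G H) \<alpha>)"
  have "mfps_subst (mfps_subst f G - p) H \<in> ord_ge (Suc K)"
    unfolding p_def by (intro subst_ord_ge H subst_mtrunc_cong G refl)
  moreover have "mfps_subst p H = q"
    by (simp add: p_def q_def subst_sum subst_times subst_const H subst_mpow)
  ultimately have 1: "mfps_subst (mfps_subst f G) H - q \<in> ord_ge (Suc K)"
    by (simp add: subst_diff)
  have 2: "mfps_subst f (formal_comp G H) - q \<in> ord_ge (Suc K)"
    unfolding q_def by (intro subst_mtrunc_cong zero_const_comp G H) simp
  show "mfps_subst (mfps_subst f G) H - mfps_subst f (formal_comp G H) \<in> ord_ge K"
    using ord_ge_diff_trans[OF 1 ord_ge_diff_sym[OF 2]] by (rule ord_ge_mono) simp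
qed

declare One_nat_def [simp del]

lemma single_1_neq_0 [simp]: "single i 1 \<noteq> (0 :: nat \<Rightarrow>\<^sub>0 nat)"
  by (simp flip: total_degree_eq_0_iff)

lemma single_1_neq_0' [simp]: "0 \<noteq> (single i 1 :: nat \<Rightarrow>\<^sub>0 nat)"
  using single_1_neq_0 by (rule not_sym)

lemma zero_const_X: "zero_const (vec n mfps_X)"
  unfolding zero_const_def ord_ge_1_iff by (simp add: mfps_X_monom mcoeff_monom)

lemma subst_vars: "in_vars n f \<Longrightarrow> mfps_subst f (vec n mfps_X) = f"
proof (rule ord_ge_all_eq)
  fix K assume f: "in_vars n f"
  have "(\<Sum>\<alpha>\<in>exps n K. mfps_const (mcoeff f \<alpha>) * mpow (vec n mfps_X) \<alpha>) = mtrunc n K f"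
    unfolding mtrunc_def by (intro sum.cong) (auto simp: exps_iff mpow_X)
  then have "mfps_subst f (vec n mfps_X) - mtrunc n K f \<in> ord_ge (Suc K)"
    using subst_mtrunc_cong[OF zero_const_X, of n n f K] by simp
  from ord_ge_diff[OF this mtrunc_cong[OF f, of K]]
  show "mfps_subst f (vec n mfps_X) - f \<in> ord_ge K" by (auto intro: ord_ge_mono)
qed

lemma in_vars_subst:
  assumes "\<And>i. i < dim_vec G \<Longrightarrow> in_vars n (G $ i)"
  shows "in_vars n (mfps_subst f G)"
  unfolding in_vars_def
proof (intro allI impI)
  fix \<beta> assume "mcoeff (mfps_subst f G) \<beta> \<noteq> 0"
  then obtain \<alpha> where "mcoeff (mpow G \<alpha>) \<beta> \<noteq> 0"
    unfolding mfps_subst_def mcoeff_Abs_mfps mpow_def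
    by (metis (no_types, lifting) sum.not_neutral_contains_not_neutral mult_zero_right)
  then show "keys \<beta> \<subseteq> {..<n}"
    using in_vars_mpow[of G n \<alpha>, OF assms] by (auto simp: in_vars_def)
qed

section \<open>Tuples of series and linear maps\<close>

lemma formal_comp_index [simp]: "i < dim_vec F \<Longrightarrow> formal_comp F G $ i = mfps_subst (F $ i) G"
  by (simp add: formal_comp_def)

text \<open>With K = 1 these are the formal maps fixing the origin, with larger K the vector fields
  by which such maps are perturbed.\<close>

definition vser :: "nat \<Rightarrow> nat \<Rightarrow> 'a::comm_ring_1 mfps vec set" where
  "vser n K = {F \<in> carrier_vec n. \<forall>i<n. in_vars n (F $ i) \<and> F $ i \<in> ord_ge K}"

lemma vserI: "dim_vec F = n \<Longrightarrow> (\<And>i. i < n \<Longrightarrow> in_vars n (F $ i)) \<Longrightarrow> (\<And>i. i < n \<Longrightarrow> F $ i \<in> ord_ge K) \<Longrightarrow> F \<in> vser n K"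
  unfolding vser_def using carrier_vecI by blast

lemma vserD:
  assumes "F \<in> vser n K"
  shows "dim_vec F = n" "F \<in> carrier_vec n" "i < n \<Longrightarrow> in_vars n (F $ i)" "i < n \<Longrightarrow> F $ i \<in> ord_ge K"
  using assms by (auto simp: vser_def)

lemma vser_mono: "F \<in> vser n K \<Longrightarrow> J \<le> K \<Longrightarrow> F \<in> vser n J"
  by (auto simp: vser_def intro: ord_ge_mono)

lemma vser_zero_const: "F \<in> vser n K \<Longrightarrow> 1 \<le> K \<Longrightarrow> zero_const F"
  by (auto simp: vser_def zero_const_def intro: ord_ge_mono)

lemma vser_add: "F \<in> vser n K \<Longrightarrow> G \<in> vser n K \<Longrightarrow> F + G \<in> vser n K"
  and vser_diff: "F \<in> vser n K \<Longrightarrow> G \<in> vser n K \<Longrightarrow> F - G \<in> vser n K"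
  and vser_uminus: "F \<in> vser n K \<Longrightarrow> - F \<in> vser n K"
  and vser_smult: "F \<in> vser n K \<Longrightarrow> mfps_const c \<cdot>\<^sub>v F \<in> vser n K"
  and vser_zero [simp]: "0\<^sub>v n \<in> vser n K"
  by (auto simp: vser_def intro!: ord_ge_mult_left ord_ge_add ord_ge_diff ord_ge_uminus
      in_vars_add in_vars_diff in_vars_uminus in_vars_mult)

lemma vser_X: "vec n mfps_X \<in> vser n 1"
  using zero_const_X[of n] by (auto intro!: vserI in_vars_X simp: zero_const_def)

lemma comp_vser: "F \<in> vser n K \<Longrightarrow> G \<in> vser n 1 \<Longrightarrow> formal_comp F G \<in> vser n K"
  by (intro vserI) (auto simp: vserD intro!: in_vars_subst subst_ord_ge intro: vser_zero_const)

lemma comp_assoc: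
  "zero_const G \<Longrightarrow> zero_const H \<Longrightarrow> formal_comp (formal_comp F G) H = formal_comp F (formal_comp G H)"
  by (rule eq_vecI) (auto simp: subst_subst)

lemma comp_assoc_vser:
  "G \<in> vser n 1 \<Longrightarrow> H \<in> vser n 1 \<Longrightarrow> formal_comp (formal_comp F G) H = formal_comp F (formal_comp G H)"
  by (intro comp_assoc) (auto intro: vser_zero_const)

lemma comp_X_right: "F \<in> vser n K \<Longrightarrow> formal_comp F (vec n mfps_X) = F"
  by (rule eq_vecI) (auto simp: vserD subst_vars)

lemma comp_X_left: "G \<in> vser n 1 \<Longrightarrow> formal_comp (vec n mfps_X) G = G"
  by (rule eq_vecI) (auto simp: vserD subst_X vser_zero_const)

lemma comp_add_left: "dim_vec F = dim_vec G \<Longrightarrow> formal_comp (F + G) H = formal_comp F H + formal_comp G H"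
  and comp_diff_left: "dim_vec F = dim_vec G \<Longrightarrow> formal_comp (F - G) H = formal_comp F H - formal_comp G H"
  by (rule eq_vecI; simp add: subst_add subst_diff)+

lemma comp_smult_left: "zero_const H \<Longrightarrow> formal_comp (mfps_const c \<cdot>\<^sub>v F) H = mfps_const c \<cdot>\<^sub>v formal_comp F H"
  by (rule eq_vecI; simp add: subst_times subst_const)

section \<open>Linear maps as tuples of linear forms\<close>

definition lin :: "'a::comm_ring_1 mat \<Rightarrow> 'a mfps vec" where
  "lin M = vec (dim_row M) (\<lambda>i. \<Sum>j<dim_col M. mfps_const (M $$ (i, j)) * mfps_X j)"

lemma dim_lin [simp]: "dim_vec (lin M) = dim_row M"
  by (simp add: lin_def)

lemma lin_vser: "M \<in> carrier_mat n n \<Longrightarrow> lin M \<in> vser n 1"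
  using vserD(4)[OF vser_X]
  by (intro vserI) (auto simp: lin_def intro!: in_vars_sum in_vars_mult in_vars_X ord_ge_sum ord_ge_mult_left)

lemma comp_lin_left:
  assumes "zero_const G" "dim_vec G = dim_col M"
  shows "formal_comp (lin M) G = vec (dim_row M) (\<lambda>i. \<Sum>j<dim_col M. mfps_const (M $$ (i, j)) * G $ j)"
  using assms by (intro eq_vecI) (auto simp: lin_def subst_sum subst_times subst_const subst_X)

lemma comp_lin_add:
  assumes "zero_const G" "zero_const H" "dim_vec G = dim_col M" "dim_vec H = dim_col M"
  shows "formal_comp (lin M) (G + H) = formal_comp (lin M) G + formal_comp (lin M) H"
proof -
  have "zero_const (G + H)" using assms by (auto simp: zero_const_def)
  then show ?thesis using assms
    by (intro eq_vecI) (auto simp: comp_lin_left distrib_left sum.distrib)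
qed

lemma comp_lin_smult:
  assumes "zero_const G" "dim_vec G = dim_col M"
  shows "formal_comp (lin M) (mfps_const c \<cdot>\<^sub>v G) = mfps_const c \<cdot>\<^sub>v formal_comp (lin M) G"
proof -
  have "zero_const (mfps_const c \<cdot>\<^sub>v G)" using assms by (auto simp: zero_const_def intro: ord_ge_mult_left)
  then show ?thesis using assms
    by (intro eq_vecI) (auto simp: comp_lin_left sum_distrib_left mult_ac)
qed

lemma comp_lin_lin:
  assumes "A \<in> carrier_mat n n" "B \<in> carrier_mat n n"
  shows "formal_comp (lin A) (lin B) = lin (A * B)"
proof (rule eq_vecI)
  fix i assume "i < dim_vec (lin (A * B))"
  then have i: "i < n" using assms by simp
  have "formal_comp (lin A) (lin B) $ i
      = (\<Sum>j<n. mfps_const (A $$ (i, j)) * (\<Sum>k<n. mfps_const (B $$ (j, k)) * mfps_X k))"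
    using i assms comp_lin_left[OF vser_zero_const[OF lin_vser[OF assms(2)] order_refl], of A]
    by (simp add: lin_def[of B])
  also have "\<dots> = (\<Sum>j<n. \<Sum>k<n. mfps_const (A $$ (i, j) * B $$ (j, k)) * mfps_X k)"
    by (simp add: sum_distrib_left mfps_const_simps mult_ac)
  also have "\<dots> = (\<Sum>k<n. \<Sum>j<n. mfps_const (A $$ (i, j) * B $$ (j, k)) * mfps_X k)"
    by (rule sum.swap)
  also have "\<dots> = lin (A * B) $ i"
    using i assms by (auto simp: lin_def scalar_prod_def mfps_const_sum sum_distrib_right atLeast0LessThan)
  finally show "formal_comp (lin A) (lin B) $ i = lin (A * B) $ i" .
qed (use assms in simp)

lemma lin_one: "lin (1\<^sub>m n) = vec n mfps_X"
proof (rule eq_vecI)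
  fix i assume i: "i < dim_vec (vec n mfps_X :: 'a mfps vec)"
  have "(\<Sum>j<n. mfps_const (1\<^sub>m n $$ (i, j)) * mfps_X j) = (\<Sum>j<n. if j = i then mfps_X j else 0 :: 'a mfps)"
    using i by (intro sum.cong) (auto simp: mfps_const_simps)
  then show "lin (1\<^sub>m n) $ i = (vec n mfps_X :: 'a mfps vec) $ i"
    using i by (simp add: lin_def)
qed simp

lemma linear_part_carrier [simp]: "linear_part n F \<in> carrier_mat n n"
  by (simp add: linear_part_def)

lemma dim_linear_part [simp]: "dim_row (linear_part n F) = n" "dim_col (linear_part n F) = n"
  by (simp_all add: linear_part_def)

lemma linear_part_index [simp]: "i < n \<Longrightarrow> j < n \<Longrightarrow> linear_part n F $$ (i, j) = mcoeff (F $ i) (single j 1)"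
  by (simp add: linear_part_def)

lemma single_1_eq_iff [simp]: "(single i 1 :: nat \<Rightarrow>\<^sub>0 nat) = single j 1 \<longleftrightarrow> i = j"
proof
  assume "(single i 1 :: nat \<Rightarrow>\<^sub>0 nat) = single j 1"
  from arg_cong[OF this, of "\<lambda>p. lookup p j"] show "i = j" by (simp add: lookup_single when_def split: if_splits)
qed simp

lemma mcoeff_X_single: "mcoeff (mfps_X i) (single j 1) = (if i = j then 1 else 0)"
  by (auto simp: mfps_X_monom mcoeff_monom)

lemma linear_part_lin: "M \<in> carrier_mat n n \<Longrightarrow> linear_part n (lin M) = M"
  by (rule eq_matI) (auto simp: lin_def mcoeff_X_single if_distrib cong: if_cong)

lemma linear_part_cong:
  assumes "F - G \<in> vser n 2" "dim_vec F = n" "dim_vec G = n"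
  shows "linear_part n F = linear_part n G"
proof (rule eq_matI)
  fix i j assume "i < dim_row (linear_part n G)" "j < dim_col (linear_part n G)"
  then have ij: "i < n" "j < n" by (auto simp: linear_part_def)
  have "mcoeff ((F - G) $ i) (single j 1) = 0"
    using vserD(4)[OF assms(1)] ij by (intro ord_geD[of _ 2]) auto
  then show "linear_part n F $$ (i, j) = linear_part n G $$ (i, j)"
    using ij assms by simp
qed (auto simp: linear_part_def)

lemma diff_lin_linear_part:
  assumes "F \<in> vser n 1"
  shows "F - lin (linear_part n F) \<in> vser n 2"
proof -
  have l: "lin (linear_part n F) \<in> vser n 1" by (simp add: lin_vser)
  have "(F - lin (linear_part n F)) $ i \<in> ord_ge 2" if i: "i < n" for i
    unfolding ord_ge_def
  proof (clarify)
    fix \<alpha> assume "total_degree \<alpha> < 2"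
    then consider "\<alpha> = 0" | "total_degree \<alpha> = 1" by (metis less_2_cases One_nat_def total_degree_eq_0_iff)
    then show "mcoeff ((F - lin (linear_part n F)) $ i) \<alpha> = 0"
    proof cases
      case 1
      then show ?thesis using vserD(4)[OF vser_diff[OF assms l] i] by (simp add: ord_ge_1_iff)
    next
      case 2
      then obtain j where \<alpha>: "\<alpha> = single j 1" by (rule total_degree_1E)
      show ?thesis
      proof (cases "j < n")
        case True
        have "linear_part n (lin (linear_part n F)) $$ (i, j) = linear_part n F $$ (i, j)"
          by (simp add: linear_part_lin)
        then show ?thesis using i True assms \<alpha> l by (simp add: vserD)
      next
        case False
        then have "\<not> keys \<alpha> \<subseteq> {..<n}" using \<alpha> by simp
        then show ?thesis using vserD(3)[OF vser_diff[OF assms l] i] unfolding in_vars_def by blast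
      qed
    qed
  qed
  then show ?thesis
    using vser_diff[OF assms l] by (auto simp: vser_def)
qed

section \<open>First-order behaviour of composition under perturbation\<close>

lemma power_diff_ord_ge:
  assumes "a - b \<in> ord_ge (K + 1)" "a \<in> ord_ge 1" "b \<in> ord_ge 1"
  shows "a ^ k - b ^ k \<in> ord_ge (K + k)"
proof (induction k)
  case (Suc k)
  have "a * (a ^ k - b ^ k) + (a - b) * b ^ k \<in> ord_ge (K + Suc k)"
    using ord_ge_mult[OF assms(2) Suc] ord_ge_mult[OF assms(1) ord_ge_power[OF assms(3), of k]]
    by (intro ord_ge_add) (simp_all add: One_nat_def)
  then show ?case by (simp add: algebra_simps)
qed simp

lemma prod_diff_ord_ge:
  assumes "\<And>a. a \<in> A \<Longrightarrow> f a - g a \<in> ord_ge (K + d a)"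
    "\<And>a. a \<in> A \<Longrightarrow> f a \<in> ord_ge (d a)" "\<And>a. a \<in> A \<Longrightarrow> g a \<in> ord_ge (d a)"
  shows "prod f A - prod g A \<in> ord_ge (K + sum d A)"
  using assms
proof (induction A rule: infinite_finite_induct)
  case (insert x A)
  have "f x * (prod f A - prod g A) \<in> ord_ge (d x + (K + sum d A))"
    using insert by (intro ord_ge_mult) auto
  moreover have "(f x - g x) * prod g A \<in> ord_ge ((K + d x) + sum d A)"
    using insert by (intro ord_ge_mult ord_ge_prod) auto
  ultimately have "f x * (prod f A - prod g A) + (f x - g x) * prod g A \<in> ord_ge (K + sum d (insert x A))"
    using insert by (intro ord_ge_add) (auto simp: ac_simps)
  then show ?case using insert by (simp add: algebra_simps)
qed auto

text \<open>The difference of two monomials of degree t telescopes into terms with one factor G_i -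
  H_i, of order K + 1, and t - 1 factors of order 1. The resulting order K + t is what makes
  nonlinear terms of a map insensitive to small perturbations of its argument.\<close>

lemma mpow_diff_ord_ge:
  assumes "zero_const G" "zero_const H" "dim_vec G = dim_vec H"
    "\<And>i. i < dim_vec G \<Longrightarrow> G $ i - H $ i \<in> ord_ge (K + 1)"
    "keys \<alpha> \<subseteq> {..<dim_vec G}"
  shows "mpow G \<alpha> - mpow H \<alpha> \<in> ord_ge (K + total_degree \<alpha>)"
proof -
  have p: "a ^ k \<in> ord_ge k" if "a \<in> ord_ge 1" for a :: "'a mfps" and k
    using ord_ge_power[OF that, of k] by simp
  have "mpow G \<alpha> - mpow H \<alpha> \<in> ord_ge (K + (\<Sum>i<dim_vec G. lookup \<alpha> i))"
    unfolding mpow_def assms(3)[symmetric]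
    by (intro prod_diff_ord_ge power_diff_ord_ge p) (use assms in \<open>auto simp: zero_const_def\<close>)
  then show ?thesis using assms(5) by (simp add: total_degree_eq_sum[of "{..<dim_vec G}"])
qed

lemma subst_diff_ord_ge:
  assumes "zero_const G" "zero_const H" "dim_vec G = dim_vec H"
    "\<And>i. i < dim_vec G \<Longrightarrow> G $ i - H $ i \<in> ord_ge (K + 1)" "f \<in> ord_ge J"
  shows "mfps_subst f G - mfps_subst f H \<in> ord_ge (K + J)"
  unfolding ord_ge_def
proof (clarify)
  fix \<beta> assume \<beta>: "total_degree \<beta> < K + J"
  have "mcoeff (mfps_subst f G - mfps_subst f H) \<beta>
    = (\<Sum>\<alpha>\<in>exps (dim_vec G) (total_degree \<beta>). mcoeff f \<alpha> * mcoeff (mpow G \<alpha> - mpow H \<alpha>) \<beta>)"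
    by (simp add: mcoeff_subst[OF assms(1) order_refl] mcoeff_subst[OF assms(2) order_refl]
        assms(3) right_diff_distrib sum_subtractf)
  also have "\<dots> = 0"
  proof (rule sum.neutral, rule ballI)
    fix \<alpha> assume \<alpha>: "\<alpha> \<in> exps (dim_vec G) (total_degree \<beta>)"
    show "mcoeff f \<alpha> * mcoeff (mpow G \<alpha> - mpow H \<alpha>) \<beta> = 0"
    proof (cases "total_degree \<alpha> < J")
      case True
      then show ?thesis using assms(5) by (simp add: ord_geD)
    next
      case False
      with \<beta> have "total_degree \<beta> < K + total_degree \<alpha>" by simp
      then have "mcoeff (mpow G \<alpha> - mpow H \<alpha>) \<beta> = 0"
        by (intro ord_geD[OF mpow_diff_ord_ge[OF assms(1-4)]]) (use \<alpha> in \<open>auto simp: exps_iff\<close>)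
      then show ?thesis by simp
    qed
  qed
  finally show "mcoeff (mfps_subst f G - mfps_subst f H) \<beta> = 0" .
qed

lemma comp_diff_vser:
  assumes "G \<in> vser n 1" "H \<in> vser n 1" "G - H \<in> vser n (K + 1)" "F \<in> vser n J"
  shows "formal_comp F G - formal_comp F H \<in> vser n (K + J)"
proof (rule vserI)
  fix i assume i: "i < n"
  note d = vserD(1)[OF assms(1)] vserD(1)[OF assms(2)] vserD(1)[OF assms(4)]
  show "in_vars n ((formal_comp F G - formal_comp F H) $ i)"
    using i comp_vser[OF assms(4,1)] comp_vser[OF assms(4,2)] vserD(3)[OF vser_diff] by blast
  have "G $ j - H $ j \<in> ord_ge (K + 1)" if "j < n" for j
    using vserD(4)[OF assms(3) that] d that by simp
  then show "(formal_comp F G - formal_comp F H) $ i \<in> ord_ge (K + J)"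
    using i d vserD(4)[OF assms(4) i] assms(1,2)
    by (auto intro!: subst_diff_ord_ge vser_zero_const[of _ n 1])
qed (use assms in \<open>auto simp: vserD\<close>)

lemma vec_add_diff_cancel: "G \<in> carrier_vec n \<Longrightarrow> v \<in> carrier_vec n \<Longrightarrow> (G + v) - G = v"
  for G v :: "'a::comm_ring_1 mfps vec"
  by (rule eq_vecI) auto

text \<open>Only the linear part of G is visible to the leading term of w: replacing G by it changes
  the argument in order 2, and w has order K.\<close>

lemma comp_order_ge:
  assumes "w \<in> vser n K" "G \<in> vser n 1"
  shows "formal_comp w G - formal_comp w (lin (linear_part n G)) \<in> vser n (Suc K)"
proof -
  have "G - lin (linear_part n G) \<in> vser n (1 + 1)"
    using diff_lin_linear_part[OF assms(2)] by simp
  from comp_diff_vser[OF assms(2) lin_vser[OF linear_part_carrier] this assms(1)]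
  show ?thesis by (simp add: One_nat_def)
qed

text \<open>First-order Taylor expansion. The linear part of F is additive, and the remainder of F,
  of order 2, reacts to a change v of its argument only in order K + 1.\<close>

lemma comp_perturb_right:
  assumes F: "F \<in> vser n 1" and G: "G \<in> vser n 1" and v: "v \<in> vser n K" and "1 \<le> K"
  shows "formal_comp F (G + v) - (formal_comp F G + formal_comp (lin (linear_part n F)) v) \<in> vser n (Suc K)"
proof -
  let ?L = "lin (linear_part n F)"
  have L: "?L \<in> vser n 1" by (simp add: lin_vser)
  have v1: "v \<in> vser n 1" using v \<open>1 \<le> K\<close> by (rule vser_mono)
  have Gv: "G + v \<in> vser n 1" by (rule vser_add[OF G v1])
  have R: "F - ?L \<in> vser n 2" by (rule diff_lin_linear_part[OF F])
  \<comment> \<open>Written as K - 1 + 1, the order of v yields (K - 1) + 2 = K + 1 for the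
    remainder of order 2.\<close>
  have "G + v - G \<in> vser n (K - 1 + 1)"
    using v \<open>1 \<le> K\<close> by (simp add: vec_add_diff_cancel[OF vserD(2)[OF G] vserD(2)[OF v]])
  from comp_diff_vser[OF Gv G this R]
  have "formal_comp (F - ?L) (G + v) - formal_comp (F - ?L) G \<in> vser n (Suc K)"
    using \<open>1 \<le> K\<close> by (simp add: numeral_2_eq_2)
  moreover have "formal_comp (F - ?L) (G + v) - formal_comp (F - ?L) G
    = formal_comp F (G + v) - (formal_comp F G + formal_comp ?L v)"
  proof -
    have "formal_comp ?L (G + v) = formal_comp ?L G + formal_comp ?L v"
      using G v1 by (intro comp_lin_add) (auto simp: vser_zero_const vserD linear_part_def)
    moreover have "formal_comp (F - ?L) (G + v) = formal_comp F (G + v) - formal_comp ?L (G + v)"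
       "formal_comp (F - ?L) G = formal_comp F G - formal_comp ?L G"
      using vserD(1)[OF F] vserD(1)[OF L] by (auto simp: comp_diff_left)
    ultimately show ?thesis
      using vserD(1)[OF F] vserD(1)[OF L] by (intro eq_vecI) auto
  qed
  ultimately show ?thesis by simp
qed

lemma linear_part_comp:
  assumes F: "F \<in> vser n 1" and G: "G \<in> vser n 1"
  shows "linear_part n (formal_comp F G) = linear_part n F * linear_part n G"
proof -
  let ?L = "lin (linear_part n F)"
  have L: "?L \<in> vser n 1" by (simp add: lin_vser)
  have "formal_comp F G - formal_comp ?L G = formal_comp (F - ?L) G"
    using vserD(1)[OF F] vserD(1)[OF L] by (simp add: comp_diff_left)
  also have "\<dots> \<in> vser n 2" by (rule comp_vser[OF diff_lin_linear_part[OF F] G])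
  finally have "linear_part n (formal_comp F G) = linear_part n (formal_comp ?L G)"
    using vserD(1)[OF F] vserD(1)[OF L] by (intro linear_part_cong) auto
  also have "\<dots> = linear_part n F * linear_part n G"
    using G by (intro eq_matI)
      (auto simp: comp_lin_left vser_zero_const vserD scalar_prod_def linear_part_def atLeast0LessThan)
  finally show ?thesis .
qed

section \<open>Coefficientwise limits\<close>

lemma vser_limit:
  fixes S :: "nat \<Rightarrow> 'a::comm_ring_1 mfps vec"
  assumes S: "\<And>k. S k \<in> vser n J" and d: "\<And>k. S (Suc k) - S k \<in> vser n (Suc k)"
  obtains T where "T \<in> vser n J" "\<And>k. T - S k \<in> vser n (Suc k)"
proof
  \<comment> \<open>The coefficients of degree at most k no longer change from \<open>S k\<close>
    on, so the coefficient of \<alpha> can be read off at stage |\<alpha>|.\<close>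
  define T where "T = vec n (\<lambda>i. Abs_mfps (\<lambda>\<alpha>. mcoeff (S (total_degree \<alpha>) $ i) \<alpha>))"
  have st: "mcoeff (S (k + m) $ i) \<alpha> = mcoeff (S k $ i) \<alpha>" if "total_degree \<alpha> \<le> k" "i < n" for k m i \<alpha>
  proof (induction m)
    case (Suc m)
    have "mcoeff ((S (Suc (k + m)) - S (k + m)) $ i) \<alpha> = 0"
      using vserD(4)[OF d that(2)] that(1) by (auto intro!: ord_geD)
    then show ?case using Suc that S vserD(1) by (metis add_Suc_right eq_iff_diff_eq_0 index_minus_vec(1) mcoeff_minus)
  qed simp
  have T: "mcoeff (T $ i) \<alpha> = mcoeff (S k $ i) \<alpha>" if "total_degree \<alpha> \<le> k" "i < n" for k i \<alpha>
    using st[OF order_refl \<open>i < n\<close>, of \<alpha> "k - total_degree \<alpha>"] that by (simp add: T_def)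
  have Td: "dim_vec T = n" by (simp add: T_def)
  show TJ: "T \<in> vser n J"
  proof (rule vserI[OF Td])
    fix i assume i: "i < n"
    show "in_vars n (T $ i)" 
      unfolding in_vars_def using vserD(3)[OF S i] T[OF order_refl i] by (metis in_vars_def)
    show "T $ i \<in> ord_ge J"
      using vserD(4)[OF S i] T[OF order_refl i] by (simp add: ord_ge_def)
  qed
  show "T - S k \<in> vser n (Suc k)" for k
  proof -
    have "T - S k \<in> vser n J" by (rule vser_diff[OF TJ S])
    moreover have "(T - S k) $ i \<in> ord_ge (Suc k)" if "i < n" for i
      using T[OF _ that, of _ k] vserD(1)[OF S] that by (simp add: ord_ge_def)
    ultimately show ?thesis by (simp add: vser_def)
  qed
qed

lemma vser_all_eq:
  assumes "F \<in> vser n J" "G \<in> vser n J" "\<And>K. F - G \<in> vser n K"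
  shows "F = G"
proof (rule eq_vecI)
  fix i assume "i < dim_vec G"
  then have i: "i < n" using assms by (simp add: vserD)
  show "F $ i = G $ i"
  proof (rule ord_ge_all_eq)
    fix K show "F $ i - G $ i \<in> ord_ge K"
      using vserD(4)[OF assms(3) i] i assms(1,2) by (simp add: vserD)
  qed
qed (use assms in \<open>simp add: vserD\<close>)

section \<open>The group of formal maps\<close>

lemma invertible_mat_iff_det:
  assumes A: "(A :: 'a::field mat) \<in> carrier_mat n n"
  shows "invertible_mat A \<longleftrightarrow> det A \<noteq> 0"
proof
  assume "invertible_mat A"
  then obtain B where AB: "A * B = 1\<^sub>m (dim_row A)" and BA: "B * A = 1\<^sub>m (dim_row B)"
    unfolding invertible_mat_def inverts_mat_def by blast
  have B: "B \<in> carrier_mat n n"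
    using A arg_cong[OF AB, of dim_col] arg_cong[OF BA, of dim_col] by (intro carrier_matI) auto
  have "det A * det B = 1"
    using A AB by (simp flip: det_mult[OF A B])
  then show "det A \<noteq> 0" by auto
next
  assume "det A \<noteq> 0"
  from det_non_zero_imp_unit[OF A this, of "()"] obtain B
    where "B \<in> carrier_mat n n" "A * B = 1\<^sub>m n" "B * A = 1\<^sub>m n"
    unfolding Units_def ring_mat_def by auto
  then show "invertible_mat A"
    unfolding invertible_mat_def inverts_mat_def using A by auto
qed

lemma det_nonzero_inverse:
  assumes A: "(A :: 'a::field mat) \<in> carrier_mat n n" and "det A \<noteq> 0"
  obtains B where "B \<in> carrier_mat n n" "A * B = 1\<^sub>m n" "B * A = 1\<^sub>m n"
  using det_non_zero_imp_unit[OF A assms(2), of "()"] unfolding Units_def ring_mat_def by auto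

text \<open>Both sides are required to have zero constant term, so that the relation can be chained
  by transitivity and is preserved by composition without further side conditions.\<close>

definition vcong :: "nat \<Rightarrow> nat \<Rightarrow> 'a::comm_ring_1 mfps vec \<Rightarrow> 'a mfps vec \<Rightarrow> bool" where
  "vcong n K F G \<longleftrightarrow> F \<in> vser n 1 \<and> G \<in> vser n 1 \<and> F - G \<in> vser n K"

lemma vcongD:
  assumes "vcong n K F G"
  shows "F \<in> vser n 1" "G \<in> vser n 1" "F - G \<in> vser n K"
  using assms by (auto simp: vcong_def)

lemma vcong_refl: "F \<in> vser n 1 \<Longrightarrow> vcong n K F F"
  unfolding vcong_def by (auto intro!: vserI simp: vserD)

lemma vec_diff_rearrange:
  fixes A B C D :: "'a::comm_ring_1 mfps vec"
  assumes "A \<in> carrier_vec n" "B \<in> carrier_vec n" "C \<in> carrier_vec n" "D \<in> carrier_vec n"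
  shows "(A - B) + (B - C) = A - C" "- (A - B) = B - A"
    "(A + C) - (B + D) = (A - B) + (C - D)" "(A - C) - (B - D) = (A - B) - (C - D)"
    "B + (A - B) = A"
  using assms by (auto intro!: eq_vecI)

lemma vcong_sym: "vcong n K F G \<Longrightarrow> vcong n K G F"
  unfolding vcong_def using vser_uminus[of "F - G" n K] vec_diff_rearrange(2)[of F n G F F] vserD(2) by metis

lemma vcong_trans [trans]: "vcong n K F G \<Longrightarrow> vcong n K G H \<Longrightarrow> vcong n K F H"
  unfolding vcong_def using vser_add[of "F - G" n K "G - H"] vec_diff_rearrange(1)[of F n G H H] vserD(2) by metis

lemma vcong_mono: "vcong n K F G \<Longrightarrow> J \<le> K \<Longrightarrow> vcong n J F G"
  by (auto simp: vcong_def intro: vser_mono)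

lemma vcong_add: "vcong n K F G \<Longrightarrow> vcong n K F' G' \<Longrightarrow> vcong n K (F + F') (G + G')"
  unfolding vcong_def using vec_diff_rearrange(3)[of F n G F' G'] vserD(2) vser_add by metis

lemma vcong_diff: "vcong n K F G \<Longrightarrow> vcong n K F' G' \<Longrightarrow> vcong n K (F - F') (G - G')"
  unfolding vcong_def using vec_diff_rearrange(4)[of F n G F' G'] vserD(2) vser_diff by metis

lemma vcong_add_small:
  assumes "F \<in> vser n 1" "r \<in> vser n K" "1 \<le> K" shows "vcong n K (F + r) F"
  using assms vec_add_diff_cancel[OF vserD(2)[OF assms(1)] vserD(2)[OF assms(2)]] vser_add[OF assms(1) vser_mono[OF assms(2,3)]]
  by (simp add: vcong_def)

lemma vcong_comp_left:
  assumes "vcong n K F F'" "G \<in> vser n 1"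
  shows "vcong n K (formal_comp F G) (formal_comp F' G)"
  using comp_vser[OF vcongD(3)[OF assms(1)] assms(2)] comp_vser[OF vcongD(1)[OF assms(1)] assms(2)]
    comp_vser[OF vcongD(2)[OF assms(1)] assms(2)] vserD(1)[OF vcongD(1)[OF assms(1)]] vserD(1)[OF vcongD(2)[OF assms(1)]]
  by (simp add: vcong_def comp_diff_left)

lemma vcong_comp_right:
  assumes "vcong n K G G'" "F \<in> vser n 1" "1 \<le> K"
  shows "vcong n K (formal_comp F G) (formal_comp F G')"
proof -
  have "G - G' \<in> vser n (K - 1 + 1)" using vcongD(3)[OF assms(1)] assms(3) by simp
  from comp_diff_vser[OF vcongD(1,2)[OF assms(1)] this assms(2)]
  show ?thesis
    using assms(3) comp_vser[OF assms(2) vcongD(1)[OF assms(1)]] comp_vser[OF assms(2) vcongD(2)[OF assms(1)]]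
    by (simp add: vcong_def)
qed

lemma vcong_comp:
  assumes "vcong n K F F'" "vcong n K G G'" "1 \<le> K"
  shows "vcong n K (formal_comp F G) (formal_comp F' G')"
  using vcong_trans[OF vcong_comp_left[OF assms(1) vcongD(1)[OF assms(2)]]
      vcong_comp_right[OF assms(2) vcongD(2)[OF assms(1)] assms(3)]] .

lemma vcong_order_ge:
  assumes "w \<in> vser n K" "G \<in> vser n 1" "1 \<le> K"
  shows "vcong n (Suc K) (formal_comp w G) (formal_comp w (lin (linear_part n G)))"
  using comp_order_ge[OF assms(1,2)] comp_vser[OF vser_mono[OF assms(1,3)]] assms(2)
  by (simp add: vcong_def lin_vser)

lemma vcong_perturb_right:
  assumes "F \<in> vser n 1" "G \<in> vser n 1" "v \<in> vser n K" "1 \<le> K"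
  shows "vcong n (Suc K) (formal_comp F (G + v)) (formal_comp F G + formal_comp (lin (linear_part n F)) v)"
  using comp_perturb_right[OF assms] vser_mono[OF assms(3,4)] assms(1,2)
  by (simp add: vcong_def lin_vser comp_vser vser_add)

lemma linear_part_vcong: "vcong n K F G \<Longrightarrow> 2 \<le> K \<Longrightarrow> linear_part n F = linear_part n G"
  by (intro linear_part_cong) (auto simp: vcong_def vserD intro: vser_mono)

lemma vcong_all_eq: "(\<And>K. vcong n K F G) \<Longrightarrow> F = G"
  using vser_all_eq[of F n 1 G] by (auto simp: vcong_def)

lemma linear_part_X: "linear_part n (vec n mfps_X) = (1\<^sub>m n :: 'a::comm_ring_1 mat)"
  by (simp flip: lin_one add: linear_part_lin)

lemma vcong_linear_part: "F \<in> vser n 1 \<Longrightarrow> vcong n 2 F (lin (linear_part n F))"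
  by (simp add: vcong_def diff_lin_linear_part lin_vser)

lemma carrier_formal_maps:
  "F \<in> carrier (formal_maps n) \<longleftrightarrow> F \<in> vser n 1 \<and> det (linear_part n F) \<noteq> 0"
  unfolding formal_maps_def vser_def ord_ge_1_iff
  by (auto simp: invertible_mat_iff_det[OF linear_part_carrier])

lemma formal_maps_simps [simp]:
  "monoid.mult (formal_maps n) = formal_comp" "one (formal_maps n) = vec n mfps_X"
  by (simp_all add: formal_maps_def)

text \<open>Successive approximation starting with the inverse B of the linear part. An error E of
  order k + 2 is removed to leading order by subtracting E \<circ> B from G: as B \<circ> F is
  tangent to the identity, (E \<circ> B) \<circ> F agrees with E modulo order k + 3.\<close>

lemma formal_left_inverse:
  assumes F: "F \<in> carrier (formal_maps n)"
  obtains G where "G \<in> vser n 1" "formal_comp G F = vec n mfps_X"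
proof -
  let ?X = "vec n mfps_X :: complex mfps vec"
  have F1: "F \<in> vser n 1" and "det (linear_part n F) \<noteq> 0" using F by (auto simp: carrier_formal_maps)
  from det_nonzero_inverse[OF linear_part_carrier this(2)] obtain B
    where B: "B \<in> carrier_mat n n" "B * linear_part n F = 1\<^sub>m n" by blast
  have lB: "lin B \<in> vser n 1" by (rule lin_vser[OF B(1)])
  have BF: "formal_comp (lin B) F \<in> vser n 1" "linear_part n (formal_comp (lin B) F) = 1\<^sub>m n"
    using B lB F1 by (auto simp: comp_vser linear_part_comp linear_part_lin)
  define P where "P k G \<longleftrightarrow> G \<in> vser n 1 \<and> formal_comp G F - ?X \<in> vser n (k + 2)" for k G
  have "\<exists>S. \<forall>k. P k (S k) \<and> S (Suc k) - S k \<in> vser n (Suc k)"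
  proof (rule dependent_nat_choice)
    have "formal_comp (lin B) F - ?X \<in> vser n 2"
      using diff_lin_linear_part[OF BF(1)] BF(2) by (simp add: lin_one)
    then have "P 0 (lin B)" using lB by (simp add: P_def numeral_2_eq_2)
    then show "\<exists>G. P 0 G" ..
  next
    fix G k assume "P k G"
    then have G: "G \<in> vser n 1" and E: "formal_comp G F - ?X \<in> vser n (k + 2)" by (auto simp: P_def)
    let ?E = "formal_comp G F - ?X"
    let ?e = "formal_comp ?E (lin B)"
    have e: "?e \<in> vser n (k + 2)" by (rule comp_vser[OF E lB])
    have G': "G - ?e \<in> vser n 1" using e by (intro vser_diff[OF G]) (auto intro: vser_mono)
    have "formal_comp ?e F = formal_comp ?E (formal_comp (lin B) F)"
      by (rule comp_assoc_vser[OF lB F1])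
    moreover have "formal_comp ?E (formal_comp (lin B) F) - formal_comp ?E (lin (1\<^sub>m n)) \<in> vser n (Suc (k + 2))"
      using comp_order_ge[OF E BF(1)] BF(2) by simp
    moreover have "formal_comp ?E (lin (1\<^sub>m n)) = ?E"
      by (simp only: lin_one comp_X_right[OF E])
    ultimately have "formal_comp ?e F - ?E \<in> vser n (Suc (k + 2))" by simp
    from vser_uminus[OF this] have "- (formal_comp ?e F - ?E) \<in> vser n (Suc (k + 2))" .
    moreover have "- (formal_comp ?e F - ?E) = formal_comp (G - ?e) F - ?X"
      using vserD(1)[OF G] vserD(1)[OF e] by (subst comp_diff_left) (auto intro!: eq_vecI)
    ultimately have "P (Suc k) (G - ?e)" using G' by (simp add: P_def)
    moreover have "(G - ?e) - G = - ?e"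
      using vserD(1)[OF G] vserD(1)[OF e] by (auto intro!: eq_vecI)
    then have "(G - ?e) - G \<in> vser n (Suc k)" using vser_uminus[OF e] by (auto intro: vser_mono)
    ultimately show "\<exists>G'. P (Suc k) G' \<and> G' - G \<in> vser n (Suc k)" by blast
  qed
  then obtain S where S: "\<And>k. P k (S k)" "\<And>k. S (Suc k) - S k \<in> vser n (Suc k)" by blast
  from S(1) have S1: "S k \<in> vser n 1" for k by (simp add: P_def)
  from vser_limit[OF S1 S(2)] obtain T where T: "T \<in> vser n 1" "\<And>k. T - S k \<in> vser n (Suc k)" by metis
  have "vcong n K (formal_comp T F) ?X" for K
  proof -
    have "vcong n (Suc K) T (S K)" using T S1 by (simp add: vcong_def)
    from vcong_comp_left[OF this F1] have "vcong n (Suc K) (formal_comp T F) (formal_comp (S K) F)" .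
    also have "vcong n (Suc K) (formal_comp (S K) F) ?X"
      using S(1)[of K] by (auto simp: P_def vcong_def vser_X comp_vser F1 intro: vser_mono)
    finally show ?thesis by (rule vcong_mono) simp
  qed
  then have "formal_comp T F = ?X" by (rule vcong_all_eq)
  with T(1) show thesis by (rule that)
qed

lemma det_linear_part_comp:
  "F \<in> vser n 1 \<Longrightarrow> G \<in> vser n 1 \<Longrightarrow>
    det (linear_part n (formal_comp F G)) = det (linear_part n F) * det (linear_part n G)"
  by (simp add: linear_part_comp det_mult[OF linear_part_carrier linear_part_carrier])

lemma group_formal_maps: "group (formal_maps n)"
proof (rule groupI)
  show "\<one>\<^bsub>formal_maps n\<^esub> \<in> carrier (formal_maps n)"
    by (simp add: carrier_formal_maps vser_X linear_part_X)
next
  fix F G assume "F \<in> carrier (formal_maps n)" "G \<in> carrier (formal_maps n)"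
  then show "F \<otimes>\<^bsub>formal_maps n\<^esub> G \<in> carrier (formal_maps n)"
    by (simp add: carrier_formal_maps comp_vser det_linear_part_comp)
next
  fix F G H assume "F \<in> carrier (formal_maps n)" "G \<in> carrier (formal_maps n)" "H \<in> carrier (formal_maps n)"
  then show "F \<otimes>\<^bsub>formal_maps n\<^esub> G \<otimes>\<^bsub>formal_maps n\<^esub> H = F \<otimes>\<^bsub>formal_maps n\<^esub> (G \<otimes>\<^bsub>formal_maps n\<^esub> H)"
    by (simp add: carrier_formal_maps comp_assoc_vser[of _ n])
next
  fix F assume "F \<in> carrier (formal_maps n)"
  then show "\<one>\<^bsub>formal_maps n\<^esub> \<otimes>\<^bsub>formal_maps n\<^esub> F = F"
    by (simp add: carrier_formal_maps comp_X_left)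
next
  fix F assume F: "F \<in> carrier (formal_maps n)"
  from formal_left_inverse[OF this] obtain G where G: "G \<in> vser n 1" "formal_comp G F = vec n mfps_X" .
  have "det (linear_part n G) * det (linear_part n F) = 1"
    using det_linear_part_comp[OF G(1), of F] F G(2) by (simp add: carrier_formal_maps linear_part_X)
  then have "G \<in> carrier (formal_maps n)" using G(1) by (auto simp: carrier_formal_maps)
  then show "\<exists>G\<in>carrier (formal_maps n). G \<otimes>\<^bsub>formal_maps n\<^esub> F = \<one>\<^bsub>formal_maps n\<^esub>"
    using G(2) by auto
qed

text \<open>The equation F \<circ> F = id makes the determinant of the linear part a square root of
  1, which puts F into the group. In this form the property passes to coefficientwise
  limits.\<close>

lemma formal_maps_involution_iff:
  "F \<in> involutions (formal_maps n) \<longleftrightarrow> F \<in> vser n 1 \<and> formal_comp F F = vec n mfps_X"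
proof -
  interpret group "formal_maps n" by (rule group_formal_maps)
  have "F \<in> carrier (formal_maps n)" if "F \<in> vser n 1" "formal_comp F F = vec n mfps_X"
  proof -
    have "det (linear_part n F) * det (linear_part n F) = 1"
      using det_linear_part_comp[OF that(1) that(1)] that(2) by (simp add: linear_part_X)
    then show ?thesis using that by (auto simp: carrier_formal_maps)
  qed
  moreover have "inv\<^bsub>formal_maps n\<^esub> F = F \<longleftrightarrow> formal_comp F F = vec n mfps_X" if "F \<in> carrier (formal_maps n)"
    using that r_inv[of F] inv_equality[of F F] by auto
  ultimately show ?thesis
    by (auto simp: involutions_def carrier_formal_maps)
qed

section \<open>Perturbing products of involutions by conjugation\<close>

text \<open>The adjoint action on vector fields, when B is the inverse of A; for an involution it is
  \<open>act D D\<close>. With the inverse as a separate argument, actions compose by matrix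
  products alone.\<close>

definition act :: "'a::comm_ring_1 mat \<Rightarrow> 'a mat \<Rightarrow> 'a mfps vec \<Rightarrow> 'a mfps vec" where
  "act A B h = formal_comp (formal_comp (lin A) h) (lin B)"

context
  fixes n K :: nat
  assumes K1: "1 \<le> K"
begin

lemma vser_1: "h \<in> vser n K \<Longrightarrow> h \<in> vser n 1"
  using K1 by (auto intro: vser_mono)

lemma vser_Suc: "h \<in> vser n (Suc K) \<Longrightarrow> h \<in> vser n K"
  by (auto intro: vser_mono)

lemma comp_lin_vser:
  assumes "A \<in> carrier_mat n n" "h \<in> vser n K"
  shows "formal_comp (lin A) h \<in> vser n K"
  using assms K1
  by (auto simp: comp_lin_left vser_zero_const vserD intro!: vserI in_vars_sum in_vars_mult ord_ge_sum ord_ge_mult_left)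

lemma act_vser:
  assumes "A \<in> carrier_mat n n" "B \<in> carrier_mat n n" "h \<in> vser n K"
  shows "act A B h \<in> vser n K"
  unfolding act_def using comp_lin_vser[OF assms(1,3)] lin_vser[OF assms(2)] by (rule comp_vser)

lemma act_add:
  assumes "A \<in> carrier_mat n n" "h \<in> vser n K" "g \<in> vser n K"
  shows "act A B (h + g) = act A B h + act A B g"
  unfolding act_def
  using assms K1 by (simp add: comp_lin_add comp_add_left vser_zero_const[of _ n K] vserD[of _ n K])

lemma act_smult:
  assumes "A \<in> carrier_mat n n" "B \<in> carrier_mat n n" "h \<in> vser n K"
  shows "act A B (mfps_const c \<cdot>\<^sub>v h) = mfps_const c \<cdot>\<^sub>v act A B h"
  unfolding act_def
  using assms K1 vser_zero_const[OF lin_vser[OF assms(2)]]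
  by (simp add: comp_lin_smult comp_smult_left vser_zero_const[of _ n K] vserD[of _ n K])

lemma smult_minus_one: "mfps_const (-1) \<cdot>\<^sub>v h = - h"
  by (rule eq_vecI) (auto simp: mfps_const_simps)

lemma smult_zero: "h \<in> vser n K \<Longrightarrow> mfps_const 0 \<cdot>\<^sub>v h = 0\<^sub>v n"
  by (rule eq_vecI) (auto simp: mfps_const_simps vserD)

lemma act_uminus:
  assumes "A \<in> carrier_mat n n" "B \<in> carrier_mat n n" "h \<in> vser n K"
  shows "act A B (- h) = - act A B h"
  using act_smult[OF assms, of "-1"] by (simp add: smult_minus_one)

lemma act_zero:
  assumes "A \<in> carrier_mat n n" "B \<in> carrier_mat n n"
  shows "act A B (0\<^sub>v n) = 0\<^sub>v n"
  using act_smult[OF assms vser_zero, of 0] act_vser[OF assms vser_zero]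
  by (simp add: smult_zero)

lemma act_act:
  assumes "A \<in> carrier_mat n n" "B \<in> carrier_mat n n" "C \<in> carrier_mat n n" "D \<in> carrier_mat n n" "h \<in> vser n K"
  shows "act A B (act C D h) = act (A * C) (D * B) h"
proof -
  note l = lin_vser[OF assms(1)] lin_vser[OF assms(2)] lin_vser[OF assms(3)] lin_vser[OF assms(4)]
  note h = vser_1[OF assms(5)]
  have "act A B (act C D h) = formal_comp (lin A) (formal_comp (lin C) (formal_comp h (formal_comp (lin D) (lin B))))"
    unfolding act_def using l h by (simp add: comp_assoc_vser[of _ n] comp_vser)
  also have "\<dots> = act (A * C) (D * B) h"
    unfolding act_def comp_lin_lin[OF assms(1,3), symmetric] comp_lin_lin[OF assms(4,2), symmetric]
    using l h by (simp add: comp_assoc_vser[of _ n] comp_vser)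
  finally show ?thesis .
qed

text \<open>Conjugating the factors of a product with linear parts \<open>Ds\<close> by maps \<open>id + h\<close>, \<open>h\<close> of order
  \<open>K\<close>, multiplies the product by \<open>id + w\<close> modulo order \<open>K + 1\<close>; this is the set of the
  reachable \<open>w\<close>.\<close>

fun reach :: "'a::comm_ring_1 mat list \<Rightarrow> 'a mfps vec set" where
  "reach [] = vser n (Suc K)"
| "reach (D # Ds) = {w \<in> vser n K. \<exists>h\<in>vser n K. \<exists>v\<in>reach Ds.
     w - ((act D D h - h) + act D D v) \<in> vser n (Suc K)}"

lemma reach_ConsI:
  assumes "h \<in> vser n K" "v \<in> reach Ds" "w \<in> vser n K" "w - ((act D D h - h) + act D D v) \<in> vser n (Suc K)"
  shows "w \<in> reach (D # Ds)"
  using assms by auto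

lemma reach_vser: "w \<in> reach Ds \<Longrightarrow> w \<in> vser n K"
  by (cases Ds) (auto intro: vser_Suc)

lemma small_reach:
  assumes "set Ds \<subseteq> carrier_mat n n" "r \<in> vser n (Suc K)"
  shows "r \<in> reach Ds"
  using assms
proof (induction Ds arbitrary: r)
  case (Cons D Ds)
  then have D: "D \<in> carrier_mat n n" and r: "r \<in> vser n (Suc K)" by auto
  have "0\<^sub>v n \<in> reach Ds" using Cons by simp
  moreover have "r - ((act D D (0\<^sub>v n) - 0\<^sub>v n) + act D D (0\<^sub>v n)) = r"
    using vserD(1)[OF r] by (intro eq_vecI) (auto simp: act_zero[OF D D])
  ultimately show ?case using r by (auto simp: vser_Suc intro!: bexI[of _ "0\<^sub>v n"])
qed simp

lemma reach_add:
  assumes "set Ds \<subseteq> carrier_mat n n" "u \<in> reach Ds" "w \<in> reach Ds"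
  shows "u + w \<in> reach Ds"
  using assms
proof (induction Ds arbitrary: u w)
  case (Cons D Ds)
  then have D: "D \<in> carrier_mat n n" by auto
  from Cons.prems obtain h v where 1: "u \<in> vser n K" "h \<in> vser n K" "v \<in> reach Ds"
    "u - ((act D D h - h) + act D D v) \<in> vser n (Suc K)" by auto
  from Cons.prems obtain h' v' where 2: "w \<in> vser n K" "h' \<in> vser n K" "v' \<in> reach Ds"
    "w - ((act D D h' - h') + act D D v') \<in> vser n (Suc K)" by auto
  note v = reach_vser[OF 1(3)] reach_vser[OF 2(3)]
  have "(u + w) - ((act D D (h + h') - (h + h')) + act D D (v + v'))
    = (u - ((act D D h - h) + act D D v)) + (w - ((act D D h' - h') + act D D v'))"
    using vserD(1)[OF act_vser[OF D D]] 1(1,2) 2(1,2) v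
    by (intro eq_vecI) (simp_all add: act_add[OF D] vserD)
  moreover have "\<dots> \<in> vser n (Suc K)" by (rule vser_add[OF 1(4) 2(4)])
  moreover have "v + v' \<in> reach Ds" using Cons 1 2 by auto
  ultimately show ?case using 1 2 by (intro reach_ConsI[of "h + h'" "v + v'"] vser_add) simp_all
qed (auto intro: vser_add)

lemma reach_smult:
  assumes "set Ds \<subseteq> carrier_mat n n" "u \<in> reach Ds"
  shows "mfps_const c \<cdot>\<^sub>v u \<in> reach Ds"
  using assms
proof (induction Ds arbitrary: u)
  case (Cons D Ds)
  then have D: "D \<in> carrier_mat n n" by auto
  from Cons.prems obtain h v where 1: "u \<in> vser n K" "h \<in> vser n K" "v \<in> reach Ds"
    "u - ((act D D h - h) + act D D v) \<in> vser n (Suc K)" by auto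
  note v = reach_vser[OF 1(3)]
  let ?c = "\<lambda>v. mfps_const c \<cdot>\<^sub>v v"
  have "?c u - ((act D D (?c h) - ?c h) + act D D (?c v)) = ?c (u - ((act D D h - h) + act D D v))"
    using vserD(1)[OF act_vser[OF D D]] 1(1,2) v
    by (intro eq_vecI) (simp_all add: act_smult[OF D D] vserD algebra_simps)
  moreover have "\<dots> \<in> vser n (Suc K)" by (rule vser_smult[OF 1(4)])
  moreover have "?c v \<in> reach Ds" using Cons 1 by auto
  ultimately show ?case using 1 by (intro reach_ConsI[of "?c h" "?c v"] vser_smult) simp_all
qed (auto intro: vser_smult)

lemma reach_diff:
  assumes "set Ds \<subseteq> carrier_mat n n" "u \<in> reach Ds" "w \<in> reach Ds"
  shows "u - w \<in> reach Ds"
proof -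
  have "u - w = u + mfps_const (-1) \<cdot>\<^sub>v w"
    using vserD(1)[OF reach_vser[OF assms(2)]] vserD(1)[OF reach_vser[OF assms(3)]]
    by (intro eq_vecI) (auto simp: mfps_const_simps)
  then show ?thesis using reach_add[OF assms(1,2) reach_smult[OF assms(1,3)]] by simp
qed

text \<open>A field reached behind D arrives at the front as its transport by D. Conjugating D with
  -w in addition turns this transport back into w itself.\<close>

lemma reach_Cons_mono:
  assumes "D \<in> carrier_mat n n" "w \<in> reach Ds"
  shows "w \<in> reach (D # Ds)"
proof -
  have w: "w \<in> vser n K" by (rule reach_vser[OF assms(2)])
  have "w - ((act D D (- w) - (- w)) + act D D w) = 0\<^sub>v n"
    using vserD(1)[OF act_vser[OF assms(1,1) w]] vserD(1)[OF w]
    by (intro eq_vecI) (simp_all add: act_uminus[OF assms(1,1) w])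
  then have "w - ((act D D (- w) - (- w)) + act D D w) \<in> vser n (Suc K)" by simp
  with w assms(2) vser_uminus[OF w] show ?thesis by auto
qed

text \<open>The position of D in the list is irrelevant: the twist is reachable when D is at the
  head, and by \<open>reach_Cons_mono\<close> it stays so when further factors are put in
  front.\<close>

lemma act_diff_reach:
  assumes "set Ds \<subseteq> carrier_mat n n" "D \<in> set Ds" "h \<in> vser n K"
  shows "act D D h - h \<in> reach Ds"
  using assms
proof (induction Ds)
  case (Cons E Ds)
  have DE: "D \<in> carrier_mat n n" "E \<in> carrier_mat n n" using Cons by auto
  show ?case
  proof (cases "D = E")
    case True
    have a: "act D D h \<in> vser n K" by (rule act_vser[OF DE(1,1) Cons.prems(3)])
    have z: "0\<^sub>v n \<in> reach Ds" using Cons by (intro small_reach) auto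
    have "(act D D h - h) - ((act D D h - h) + act D D (0\<^sub>v n)) = 0\<^sub>v n"
      using vserD(1)[OF a] vserD(1)[OF Cons.prems(3)]
      by (intro eq_vecI) (simp_all add: act_zero[OF DE(1,1)])
    then have "(act D D h - h) - ((act D D h - h) + act D D (0\<^sub>v n)) \<in> vser n (Suc K)" by simp
    moreover have "act D D h - h \<in> vser n K" by (rule vser_diff[OF a Cons.prems(3)])
    ultimately show ?thesis using z Cons.prems(3) True by auto
  next
    case False
    then show ?thesis using Cons DE by (intro reach_Cons_mono) auto
  qed
qed simp

end

section \<open>Conjugated factors and their products\<close>

lemma list_product_simps [simp]:
  "list_product G [] = \<one>\<^bsub>G\<^esub>" "list_product G (g # gs) = g \<otimes>\<^bsub>G\<^esub> list_product G gs"
  by (simp_all add: list_product_def)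

lemma (in monoid) list_product_closed: "set gs \<subseteq> carrier G \<Longrightarrow> list_product G gs \<in> carrier G"
  by (induction gs) auto

lemma involutions_carrier: "involutions G \<subseteq> carrier G"
  by (auto simp: involutions_def)

lemma involution_linear_part:
  assumes "F \<in> involutions (formal_maps n)"
  shows "linear_part n F * linear_part n F = 1\<^sub>m n"
  using assms linear_part_comp[of F n F] by (simp add: formal_maps_involution_iff linear_part_X)

text \<open>The conjugate u^-1 S u with u = id + h is an exact involution. Modulo order K + 1, u^-1
  is id - h, and only the linear part D of S meets h, which gives S + D h - h D. As D D = 1, the
  change is the twist D h D - h composed with D.\<close>

lemma formal_conjugate_involution:
  assumes "2 \<le> K" and S: "S \<in> involutions (formal_maps n)" and h: "h \<in> vser n K"
  defines "D \<equiv> linear_part n S"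
  obtains S' where "S' \<in> involutions (formal_maps n)"
    "vcong n (Suc K) S' (S + formal_comp (act D D h - h) (lin D))"
proof -
  let ?X = "vec n mfps_X :: complex mfps vec"
  let ?G = "formal_maps n"
  interpret group ?G by (rule group_formal_maps)
  have K1: "1 \<le> K" using \<open>2 \<le> K\<close> by simp
  define u where "u = ?X + h"
  have h1: "h \<in> vser n 1" using h K1 by (rule vser_mono)
  have u1: "u \<in> vser n 1" unfolding u_def by (rule vser_add[OF vser_X h1])
  have uX: "vcong n K u ?X" unfolding u_def by (rule vcong_add_small[OF vser_X h K1])
  have Lu: "linear_part n u = 1\<^sub>m n"
    using linear_part_vcong[OF uX \<open>2 \<le> K\<close>] by (simp add: linear_part_X)
  have uG: "u \<in> carrier ?G" using u1 Lu by (simp add: carrier_formal_maps)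
  define ui where "ui = inv\<^bsub>?G\<^esub> u"
  have uiG: "ui \<in> carrier ?G" unfolding ui_def using uG by simp
  then have ui1: "ui \<in> vser n 1" by (simp add: carrier_formal_maps)
  have inv1: "formal_comp u ui = ?X" "formal_comp ui u = ?X"
    using r_inv[OF uG] l_inv[OF uG] by (simp_all add: ui_def)
  have SG: "S \<in> carrier ?G" and S1: "S \<in> vser n 1" and SS: "formal_comp S S = ?X"
    using S involutions_carrier[of ?G] by (auto simp: formal_maps_involution_iff)
  have D: "D \<in> carrier_mat n n" "D * D = 1\<^sub>m n"
    unfolding D_def using involution_linear_part[OF S] by simp_all
  have lD: "lin D \<in> vser n 1" by (rule lin_vser[OF D(1)])
  define S' where "S' = formal_comp ui (formal_comp S u)"
  have S'1: "S' \<in> vser n 1" unfolding S'_def by (intro comp_vser ui1 S1 u1)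
  have "S' \<in> involutions ?G"
  proof -
    have "formal_comp S' S' = formal_comp ui (formal_comp S (formal_comp (formal_comp u ui) (formal_comp S u)))"
      unfolding S'_def using ui1 S1 u1 by (simp add: comp_assoc_vser[of _ n] comp_vser)
    also have "\<dots> = formal_comp ui (formal_comp (formal_comp S S) u)"
      using ui1 S1 u1 by (simp add: inv1 comp_X_left comp_vser comp_assoc_vser[of _ n])
    also have "\<dots> = ?X" by (simp add: SS comp_X_left[OF u1] inv1)
    finally show ?thesis using S'1 by (simp add: formal_maps_involution_iff)
  qed
  moreover have "vcong n (Suc K) S' (S + formal_comp (act D D h - h) (lin D))"
  proof -
    have Xh: "?X - h \<in> vser n 1" by (rule vser_diff[OF vser_X h1])
    have hu: "vcong n (Suc K) (formal_comp h u) h"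
      using vcong_order_ge[OF h u1 K1] by (simp add: Lu lin_one comp_X_right[OF h])
    have diff_comp: "formal_comp (?X - h) G = G - formal_comp h G" if "G \<in> vser n 1" for G
      using vserD(1)[OF h] by (simp add: comp_diff_left comp_X_left[OF that])
    have "vcong n (Suc K) (formal_comp (?X - h) u) ?X"
    proof -
      have "vcong n (Suc K) (formal_comp (?X - h) u) (u - h)"
        unfolding diff_comp[OF u1] by (rule vcong_diff[OF vcong_refl[OF u1] hu])
      moreover have "u - h = ?X" unfolding u_def using vserD(1)[OF h] by (intro eq_vecI) auto
      ultimately show ?thesis by simp
    qed
    \<comment> \<open>Composition with u^-1 on the right turns (id - h) \<circ> u = id into id - h =
      u^-1, both modulo order K + 1.\<close>
    from vcong_comp_left[OF this ui1]
    have "vcong n (Suc K) (?X - h) ui"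
      by (simp add: comp_assoc_vser[OF u1 ui1] inv1 comp_X_right[OF Xh] comp_X_left[OF ui1])
    then have "vcong n (Suc K) S' (formal_comp (?X - h) (formal_comp S u))"
      unfolding S'_def by (intro vcong_comp_left comp_vser S1 u1) (rule vcong_sym)
    also have "formal_comp (?X - h) (formal_comp S u) = formal_comp S u - formal_comp h (formal_comp S u)"
      by (intro diff_comp comp_vser S1 u1)
    also have "vcong n (Suc K) \<dots> ((S + formal_comp (lin D) h) - formal_comp h (lin D))"
    proof (rule vcong_diff)
      show "vcong n (Suc K) (formal_comp S u) (S + formal_comp (lin D) h)"
        using vcong_perturb_right[OF S1 vser_X h K1] by (simp add: u_def D_def comp_X_right[OF S1])
      show "vcong n (Suc K) (formal_comp h (formal_comp S u)) (formal_comp h (lin D))"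
        using vcong_order_ge[OF h comp_vser[OF S1 u1] K1] by (simp add: linear_part_comp[OF S1 u1] Lu D_def)
    qed
    also have "(S + formal_comp (lin D) h) - formal_comp h (lin D) = S + formal_comp (act D D h - h) (lin D)"
    proof -
      have "formal_comp (act D D h) (lin D) = formal_comp (lin D) h"
        unfolding act_def using comp_assoc_vser[OF lD lD] comp_lin_lin[OF D(1) D(1)]
          comp_X_right[OF comp_lin_vser[OF K1 D(1) h]] by (simp add: D(2) lin_one)
      then have "formal_comp (act D D h - h) (lin D) = formal_comp (lin D) h - formal_comp h (lin D)"
        using vserD(1)[OF act_vser[OF K1 D(1) D(1) h]] vserD(1)[OF h] by (simp add: comp_diff_left)
      then show ?thesis
        using vserD(1)[OF S1] vserD(1)[OF h] D(1) by (intro eq_vecI) auto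
    qed
    finally show ?thesis .
  qed
  ultimately show thesis by (rule that)
qed

text \<open>Perturbations are recorded on the left of the whole product, as P' = (id + w) \<circ> P
  modulo order K + 1. A perturbation v of the tail stands to the right of the head factor, and
  moving it to the left conjugates it by D, which is the term \<open>act D D v\<close> in
  \<open>reach\<close>.\<close>

lemma formal_product_perturb:
  assumes "2 \<le> K" and "set Ss \<subseteq> involutions (formal_maps n)"
    and "w \<in> reach n K (map (linear_part n) Ss)"
  defines "P \<equiv> list_product (formal_maps n)"
  shows "\<exists>Ss'. length Ss' = length Ss \<and> set Ss' \<subseteq> involutions (formal_maps n) \<and>
    (\<forall>i<length Ss. vcong n K (Ss' ! i) (Ss ! i)) \<and>
    vcong n (Suc K) (P Ss') (P Ss + formal_comp w (lin (linear_part n (P Ss))))"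
  using assms(2,3)
proof (induction Ss arbitrary: w)
  case Nil
  have K1: "1 \<le> K" using \<open>2 \<le> K\<close> by simp
  from Nil K1 have w: "w \<in> vser n (Suc K)" by simp
  have "vcong n (Suc K) (vec n mfps_X + w) (vec n mfps_X)"
    by (rule vcong_add_small[OF vser_X w]) simp
  from vcong_sym[OF this] show ?case
    by (simp add: P_def linear_part_X lin_one comp_X_right[OF w])
next
  case (Cons S Ss)
  let ?G = "formal_maps n"
  interpret group ?G by (rule group_formal_maps)
  have K1: "1 \<le> K" using \<open>2 \<le> K\<close> by simp
  define D where "D = linear_part n S"
  define M where "M = linear_part n (P Ss)"
  have S: "S \<in> involutions ?G" and Ss: "set Ss \<subseteq> involutions ?G" using Cons.prems by auto
  have S1: "S \<in> vser n 1" using S by (simp add: formal_maps_involution_iff)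
  have PG: "P Ss \<in> carrier ?G"
    unfolding P_def by (rule list_product_closed[OF order_trans[OF Ss involutions_carrier]])
  then have P1: "P Ss \<in> vser n 1" by (simp add: carrier_formal_maps)
  have D: "D \<in> carrier_mat n n" "D * D = 1\<^sub>m n" and M: "M \<in> carrier_mat n n"
    unfolding D_def M_def using involution_linear_part[OF S] by simp_all
  note lD = lin_vser[OF D(1)] and lM = lin_vser[OF M]
  have DM: "D * M \<in> carrier_mat n n" using D M by simp
  note lDM = lin_vser[OF DM]
  have DDM: "D * (D * M) = M" using assoc_mult_mat[OF D(1) D(1) M] D(2) M by simp
  from Cons.prems(2)[folded D_def] K1 obtain h v where w: "w \<in> vser n K" and h: "h \<in> vser n K"
    and v: "v \<in> reach n K (map (linear_part n) Ss)"
    and e: "w - ((act D D h - h) + act D D v) \<in> vser n (Suc K)"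
    by (auto simp: D_def)
  have vK: "v \<in> vser n K" by (rule reach_vser[OF K1 v])
  define a where "a = act D D h - h"
  have aK: "a \<in> vser n K" unfolding a_def by (intro vser_diff act_vser K1 D h)
  have bK: "act D D v \<in> vser n K" by (intro act_vser K1 D vK)
  note small = vser_mono[OF _ K1]
  from formal_conjugate_involution[OF \<open>2 \<le> K\<close> S h] obtain S' where S': "S' \<in> involutions ?G"
    and cS: "vcong n (Suc K) S' (S + formal_comp a (lin D))"
    unfolding a_def D_def by blast
  from Cons.IH[OF Ss v] obtain Ss' where Ss': "length Ss' = length Ss" "set Ss' \<subseteq> involutions ?G"
    "\<forall>i<length Ss. vcong n K (Ss' ! i) (Ss ! i)"
    and cP: "vcong n (Suc K) (P Ss') (P Ss + formal_comp v (lin M))"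
    unfolding M_def by blast
  have alD: "formal_comp a (lin D) \<in> vser n K" by (rule comp_vser[OF aK lD])
  have vlM: "formal_comp v (lin M) \<in> vser n K" by (rule comp_vser[OF vK lM])
  have cS0: "vcong n K S' S"
    using vcong_trans[OF vcong_mono[OF cS] vcong_add_small[OF S1 alD K1]] by simp
  have "vcong n K (P Ss') (P Ss)"
    using vcong_trans[OF vcong_mono[OF cP] vcong_add_small[OF P1 vlM K1]] by simp
  from linear_part_vcong[OF this \<open>2 \<le> K\<close>] have LP': "linear_part n (P Ss') = M" by (simp add: M_def)
  note P'1 = vcongD(1)[OF cP]
  have "vcong n (Suc K) (formal_comp S' (P Ss')) (formal_comp (S + formal_comp a (lin D)) (P Ss'))"
    by (rule vcong_comp_left[OF cS P'1])
  also have "formal_comp (S + formal_comp a (lin D)) (P Ss') = formal_comp S (P Ss') + formal_comp (formal_comp a (lin D)) (P Ss')"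
    using vserD(1)[OF S1] vserD(1)[OF aK] by (intro comp_add_left) simp
  also have "vcong n (Suc K) \<dots> ((formal_comp S (P Ss) + formal_comp (lin D) (formal_comp v (lin M))) + formal_comp a (lin (D * M)))"
  proof (rule vcong_add)
    have "vcong n (Suc K) (formal_comp S (P Ss')) (formal_comp S (P Ss + formal_comp v (lin M)))"
      by (rule vcong_comp_right[OF cP S1]) simp
    also have "vcong n (Suc K) \<dots> (formal_comp S (P Ss) + formal_comp (lin D) (formal_comp v (lin M)))"
      unfolding D_def by (rule vcong_perturb_right[OF S1 P1 vlM K1])
    finally show "vcong n (Suc K) (formal_comp S (P Ss')) (formal_comp S (P Ss) + formal_comp (lin D) (formal_comp v (lin M)))" .
    show "vcong n (Suc K) (formal_comp (formal_comp a (lin D)) (P Ss')) (formal_comp a (lin (D * M)))"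
      using vcong_order_ge[OF alD P'1 K1] by (simp add: LP' comp_assoc_vser[OF lD lM] comp_lin_lin[OF D(1) M])
  qed
  also have "(formal_comp S (P Ss) + formal_comp (lin D) (formal_comp v (lin M))) + formal_comp a (lin (D * M))
    = formal_comp S (P Ss) + formal_comp (a + act D D v) (lin (D * M))"
  proof -
    \<comment> \<open>(D v D) \<circ> (D M) = D v M, because D D = 1.\<close>
    have "formal_comp (act D D v) (lin (D * M)) = formal_comp (lin D) (formal_comp v (lin M))"
      unfolding act_def comp_assoc_vser[OF lD lDM] comp_lin_lin[OF D(1) DM] DDM
      by (rule comp_assoc_vser[OF small[OF vK] lM])
    then have "formal_comp (a + act D D v) (lin (D * M)) = formal_comp a (lin (D * M)) + formal_comp (lin D) (formal_comp v (lin M))"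
      using vserD(1)[OF aK] vserD(1)[OF bK] by (simp add: comp_add_left)
    then show ?thesis
      using vserD(1)[OF S1] vserD(1)[OF aK] D(1) by (intro eq_vecI) auto
  qed
  also have "vcong n (Suc K) \<dots> (formal_comp S (P Ss) + formal_comp w (lin (D * M)))"
  proof (intro vcong_add vcong_refl comp_vser S1 P1)
    have "vcong n (Suc K) w (a + act D D v)"
      using e small[OF w] small[OF aK] small[OF bK] by (simp add: vcong_def a_def vser_add)
    from vcong_comp_left[OF vcong_sym[OF this] lDM]
    show "vcong n (Suc K) (formal_comp (a + act D D v) (lin (D * M))) (formal_comp w (lin (D * M)))" .
  qed
  finally have "vcong n (Suc K) (P (S' # Ss')) (P (S # Ss) + formal_comp w (lin (linear_part n (P (S # Ss)))))"
    by (simp add: P_def linear_part_comp[OF S1 P1[unfolded P_def]] D_def M_def)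
  moreover have "\<forall>i<length (S # Ss). vcong n K ((S' # Ss') ! i) ((S # Ss) ! i)"
    using cS0 Ss'(3) by (auto simp: nth_Cons split: nat.split)
  ultimately show ?case using S' Ss' by (intro exI[of _ "S' # Ss'"]) auto
qed

lemma vcong_list_product:
  assumes "length Fs = length Gs" "\<And>i. i < length Gs \<Longrightarrow> vcong n K (Fs ! i) (Gs ! i)" "1 \<le> K"
  shows "vcong n K (list_product (formal_maps n) Fs) (list_product (formal_maps n) Gs)"
  using assms
proof (induction Fs Gs rule: list_induct2)
  case Nil
  then show ?case by (simp add: vcong_refl vser_X)
next
  case (Cons F Fs G Gs)
  from Cons.prems(1)[of 0] Cons.prems(1)[of "Suc _"] Cons show ?case
    by (auto intro!: vcong_comp)
qed

definition mat_list_prod :: "nat \<Rightarrow> 'a::comm_ring_1 mat list \<Rightarrow> 'a mat" where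
  "mat_list_prod n Ds = foldr (*) Ds (1\<^sub>m n)"

lemma mat_list_prod_simps [simp]:
  "mat_list_prod n [] = 1\<^sub>m n" "mat_list_prod n (D # Ds) = D * mat_list_prod n Ds"
  by (simp_all add: mat_list_prod_def)

lemma mat_list_prod_carrier: "set Ds \<subseteq> carrier_mat n n \<Longrightarrow> mat_list_prod n Ds \<in> carrier_mat n n"
  by (induction Ds) auto

text \<open>The linear maps D_i give the product with the right linear part; each degree K from 2 on
  is then corrected by conjugating the factors. Since these corrections are tangent to the identity,
  the linear parts remain the D_i and the same reachability hypothesis applies in every
  degree.\<close>

theorem formal_map_product_of_involutions:
  assumes F: "F \<in> carrier (formal_maps n)"
    and Ds: "set Ds \<subseteq> {D \<in> carrier_mat n n. D * D = 1\<^sub>m n}"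
    and L: "linear_part n F = mat_list_prod n Ds"
    and reach: "\<And>K. 2 \<le> K \<Longrightarrow> vser n K \<subseteq> reach n K Ds"
  shows "\<exists>Ss. length Ss = length Ds \<and> set Ss \<subseteq> involutions (formal_maps n) \<and>
    F = list_product (formal_maps n) Ss"
proof -
  let ?G = "formal_maps n"
  let ?I = "involutions ?G"
  let ?P = "list_product ?G"
  interpret group ?G by (rule group_formal_maps)
  have F1: "F \<in> vser n 1" and dF: "det (linear_part n F) \<noteq> 0" using F by (auto simp: carrier_formal_maps)
  from det_nonzero_inverse[OF linear_part_carrier dF] obtain B
    where B: "B \<in> carrier_mat n n" "B * linear_part n F = 1\<^sub>m n" by blast
  note lB = lin_vser[OF B(1)]
  have P1: "?P Ss \<in> vser n 1" if "set Ss \<subseteq> ?I" for Ss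
    using list_product_closed[OF order_trans[OF that involutions_carrier]] by (simp add: carrier_formal_maps)
  \<comment> \<open>At stage k the product agrees with F in all degrees below k + 2, so stage 0
    needs agreement of linear parts only.\<close>
  define Q where "Q k Ss \<longleftrightarrow> length Ss = length Ds \<and> set Ss \<subseteq> ?I \<and> map (linear_part n) Ss = Ds
    \<and> vcong n (k + 2) (?P Ss) F" for k :: nat and Ss
  define R where "R k Ss Ss' \<longleftrightarrow> (\<forall>i<length Ds. Ss' ! i - Ss ! i \<in> vser n (Suc k))"
    for k and Ss Ss' :: "complex mfps vec list"
  have "\<exists>S. \<forall>k. Q k (S k) \<and> R k (S k) (S (Suc k))"
  proof (rule dependent_nat_choice)
    have pl: "?P (map lin Ds) = lin (mat_list_prod n Ds)" if "set Ds \<subseteq> carrier_mat n n" for Ds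
      using that by (induction Ds) (auto simp: lin_one comp_lin_lin mat_list_prod_carrier)
    have "set (map lin Ds) \<subseteq> ?I"
      using Ds by (auto simp: formal_maps_involution_iff lin_vser comp_lin_lin lin_one)
    moreover have "map (linear_part n) (map lin Ds) = Ds"
      unfolding map_map by (rule map_idI) (use Ds in \<open>auto simp: linear_part_lin\<close>)
    moreover have "vcong n 2 (lin (linear_part n F)) F" by (rule vcong_sym[OF vcong_linear_part[OF F1]])
    moreover have "?P (map lin Ds) = lin (linear_part n F)"
      unfolding L by (rule pl) (use Ds in auto)
    ultimately have "Q 0 (map lin Ds)" by (simp add: Q_def numeral_2_eq_2)
    then show "\<exists>Ss. Q 0 Ss" ..
  next
    fix Ss k assume "Q k Ss"
    then have Ss: "length Ss = length Ds" "set Ss \<subseteq> ?I" "map (linear_part n) Ss = Ds"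
      and c: "vcong n (k + 2) (?P Ss) F" by (auto simp: Q_def)
    let ?K = "k + 2"
    define E where "E = F - ?P Ss"
    have E: "E \<in> vser n ?K" using vcongD(3)[OF vcong_sym[OF c]] by (simp add: E_def)
    \<comment> \<open>The perturbation adds w composed with the linear part of the product. Dividing
      E by that linear part beforehand makes the added term equal to E.\<close>
    define w where "w = formal_comp E (lin B)"
    have "w \<in> vser n ?K" unfolding w_def by (rule comp_vser[OF E lB])
    with reach[of ?K] have "w \<in> reach n ?K (map (linear_part n) Ss)" by (auto simp: Ss(3))
    from formal_product_perturb[OF _ Ss(2) this] obtain Ss' where Ss': "length Ss' = length Ss" "set Ss' \<subseteq> ?I"
      "\<forall>i<length Ss. vcong n ?K (Ss' ! i) (Ss ! i)"
      "vcong n (Suc ?K) (?P Ss') (?P Ss + formal_comp w (lin (linear_part n (?P Ss))))" by auto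
    have "linear_part n (?P Ss) = linear_part n F" using linear_part_vcong[OF c] by simp
    then have "formal_comp w (lin (linear_part n (?P Ss))) = formal_comp E (formal_comp (lin B) (lin (linear_part n F)))"
      unfolding w_def by (simp add: comp_assoc_vser[OF lB lin_vser[OF linear_part_carrier]])
    also have "\<dots> = E" by (simp add: comp_lin_lin[OF B(1) linear_part_carrier] B(2) lin_one comp_X_right[OF E])
    finally have "?P Ss + formal_comp w (lin (linear_part n (?P Ss))) = F"
      using vec_diff_rearrange(5)[of F n "?P Ss" F F] vserD(2)[OF F1] vserD(2)[OF P1[OF Ss(2)]] by (simp add: E_def)
    with Ss'(4) have c': "vcong n (Suc ?K) (?P Ss') F" by simp
    have "map (linear_part n) Ss' = Ds"
    proof -
      have "linear_part n (Ss' ! i) = linear_part n (Ss ! i)" if "i < length Ss" for i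
        using Ss'(3) that by (intro linear_part_vcong[of n ?K]) auto
      then show ?thesis unfolding Ss(3)[symmetric] using Ss'(1) by (intro nth_equalityI) simp_all
    qed
    then have "Q (Suc k) Ss'" using Ss' Ss c' by (simp add: Q_def)
    moreover have "R k Ss Ss'"
      using Ss'(3) Ss(1) by (auto simp: R_def vcong_def intro: vser_mono)
    ultimately show "\<exists>Ss'. Q (Suc k) Ss' \<and> R k Ss Ss'" by blast
  qed
  then obtain S where S: "\<And>k. Q k (S k)" "\<And>k. R k (S k) (S (Suc k))" by blast
  have SI: "S k ! i \<in> ?I" if "i < length Ds" for k i
  proof -
    have "set (S k) \<subseteq> ?I" "length (S k) = length Ds" using S(1)[of k] by (simp_all add: Q_def)
    then show ?thesis using nth_mem[of i "S k"] that by auto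
  qed
  then have S1: "S k ! i \<in> vser n 1" if "i < length Ds" for k i
    using that by (simp add: formal_maps_involution_iff)
  have "\<exists>T. T \<in> vser n 1 \<and> (\<forall>k. T - S k ! i \<in> vser n (Suc k))" if "i < length Ds" for i
    using vser_limit[of "\<lambda>k. S k ! i" n 1] S1[OF that] S(2) that unfolding R_def by metis
  then obtain T where T: "\<And>i. i < length Ds \<Longrightarrow> T i \<in> vser n 1"
    "\<And>i k. i < length Ds \<Longrightarrow> T i - S k ! i \<in> vser n (Suc k)" by metis
  have cT: "vcong n (Suc k) (T i) (S k ! i)" if "i < length Ds" for i k
    using T[OF that] S1[OF that] by (simp add: vcong_def)
  let ?Ts = "map T [0..<length Ds]"
  have "T i \<in> ?I" if i: "i < length Ds" for i
  proof -
    have "vcong n K (formal_comp (T i) (T i)) (vec n mfps_X)" for K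
      using vcong_mono[OF vcong_comp[OF cT[OF i] cT[OF i]], of K K] SI[OF i]
      by (simp add: formal_maps_involution_iff)
    from vcong_all_eq[OF this] show ?thesis using T(1)[OF i] by (simp add: formal_maps_involution_iff)
  qed
  then have "set ?Ts \<subseteq> ?I" by auto
  moreover have "F = ?P ?Ts"
  proof (rule vcong_all_eq)
    fix K
    have "vcong n (Suc K) (?P ?Ts) (?P (S K))"
      using S(1)[of K] cT by (intro vcong_list_product) (auto simp: Q_def)
    moreover have "vcong n (Suc K) (?P (S K)) F"
      using S(1)[of K] by (auto simp: Q_def intro: vcong_mono)
    ultimately have "vcong n (Suc K) F (?P ?Ts)" by (blast intro: vcong_trans vcong_sym)
    then show "vcong n K F (?P ?Ts)" by (rule vcong_mono) simp
  qed
  ultimately show ?thesis by (intro exI[of _ ?Ts]) simp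
qed

section \<open>Factoring matrices into involutions\<close>

lemma similar_matI:
  assumes "A \<in> carrier_mat n n" "B \<in> carrier_mat n n" "P \<in> carrier_mat n n" "Q \<in> carrier_mat n n"
    "P * Q = 1\<^sub>m n" "Q * P = 1\<^sub>m n" "A * P = P * B"
  shows "similar_mat A B"
proof -
  have "P * B * Q = A * P * Q" using assms by simp
  also have "\<dots> = A" using assms assoc_mult_mat[of A n n P n Q n] by simp
  finally have "A = P * B * Q" ..
  then show ?thesis unfolding similar_mat_def similar_mat_wit_def using assms
    by (intro exI[of _ P] exI[of _ Q]) (auto simp: Let_def)
qed

lemma similar_matE:
  assumes "similar_mat A B" "A \<in> carrier_mat n n"
  obtains P Q where "B \<in> carrier_mat n n" "P \<in> carrier_mat n n" "Q \<in> carrier_mat n n"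
    "P * Q = 1\<^sub>m n" "Q * P = 1\<^sub>m n" "A = P * B * Q"
proof -
  from assms(1) obtain P Q where w: "similar_mat_wit A B P Q" unfolding similar_mat_def by blast
  have n: "dim_row A = n" using assms(2) by simp
  show thesis
    by (rule that[of P Q]) (use w[unfolded similar_mat_wit_def Let_def n] in blast)+
qed

lemma similar_mat_transpose:
  assumes "similar_mat A B" "(A :: 'a::comm_ring_1 mat) \<in> carrier_mat n n"
  shows "similar_mat A\<^sup>T B\<^sup>T"
proof -
  from similar_matE[OF assms] obtain P Q where c: "B \<in> carrier_mat n n" "P \<in> carrier_mat n n" "Q \<in> carrier_mat n n"
    and e: "P * Q = 1\<^sub>m n" "Q * P = 1\<^sub>m n" "A = P * B * Q" by metis
  have "Q\<^sup>T * P\<^sup>T = 1\<^sub>m n" "P\<^sup>T * Q\<^sup>T = 1\<^sub>m n"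
    using transpose_mult[OF c(2,3), symmetric] transpose_mult[OF c(3,2), symmetric] e(1,2) by simp_all
  moreover have "A\<^sup>T = Q\<^sup>T * (B\<^sup>T * P\<^sup>T)"
    using c e(3) transpose_mult[of "P * B" n n Q n] transpose_mult[of P n n B n] by simp
  then have "A\<^sup>T * Q\<^sup>T = Q\<^sup>T * B\<^sup>T"
    using c \<open>P\<^sup>T * Q\<^sup>T = 1\<^sub>m n\<close> assoc_mult_mat[of "Q\<^sup>T" n n "B\<^sup>T * P\<^sup>T" n "Q\<^sup>T" n]
      assoc_mult_mat[of "B\<^sup>T" n n "P\<^sup>T" n "Q\<^sup>T" n] by simp
  ultimately show ?thesis using c assms(2) by (intro similar_matI[of _ n _ "Q\<^sup>T" "P\<^sup>T"]) auto
qed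

lemma mat_uminus_cancel:
  "x \<in> carrier_mat nr nc \<Longrightarrow> x + - x = 0\<^sub>m nr nc" "x \<in> carrier_mat nr nc \<Longrightarrow> - x + x = 0\<^sub>m nr nc"
  "- 0\<^sub>m nr nc = (0\<^sub>m nr nc :: 'a mat)"
  for x :: "'a::comm_ring_1 mat"
  by (auto intro!: eq_matI)

section \<open>Bordered matrices and their diagonalization\<close>

abbreviation mat11 :: "'a \<Rightarrow> 'a mat" where
  "mat11 d \<equiv> mat 1 1 (\<lambda>_. d)"

lemmas mult_bordered = mult_four_block_mat[of _ 1 1 _ m _ m _ _ 1 _ m] for m

lemma mat11_mult:
  "b \<in> carrier_mat 1 m \<Longrightarrow> mat11 d * b = d \<cdot>\<^sub>m b"
  "c \<in> carrier_mat m 1 \<Longrightarrow> c * mat11 d = d \<cdot>\<^sub>m c"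
  for b c :: "'a::comm_ring_1 mat"
  by (auto intro!: eq_matI simp: scalar_prod_def One_nat_def)

lemma carrier_mat_1_1: "a \<in> carrier_mat 1 1 \<Longrightarrow> a = mat11 (a $$ (0, 0))"
  by (rule eq_matI) auto

lemma mat_diag_Cons:
  "mat_diag (Suc (length ls)) (nth (l # ls))
    = four_block_mat (mat11 l) (0\<^sub>m 1 (length ls)) (0\<^sub>m (length ls) 1) (mat_diag (length ls) (nth ls))"
  by (rule eq_matI) (auto simp: mat_diag_def nth_Cons')

text \<open>As l is no eigenvalue of X, the equation X y + c = l y has a solution. The column (1, y)
  is then an eigenvector for l and completes the eigenvectors of X to an eigenbasis of the bordered
  matrix.\<close>

lemma similar_diag_lower:
  fixes X :: "'a::field mat"
  assumes X: "X \<in> carrier_mat m m" and c: "c \<in> carrier_mat m 1"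
    and ls: "length ls = m" "l \<notin> set ls" and sim: "similar_mat X (mat_diag m (nth ls))"
  shows "similar_mat (four_block_mat (mat11 l) (0\<^sub>m 1 m) c X) (mat_diag (Suc m) (nth (l # ls)))"
proof -
  let ?D = "mat_diag m (nth ls)"
  from similar_matE[OF sim X] obtain P Q where PQ: "P \<in> carrier_mat m m" "Q \<in> carrier_mat m m"
    "P * Q = 1\<^sub>m m" "Q * P = 1\<^sub>m m" and XP: "X = P * ?D * Q" by metis
  have D: "?D \<in> carrier_mat m m" by simp
  \<comment> \<open>The equation in the eigenbasis of X, where it splits into scalar ones: (l - l_i)
    z_i = (Q c)_i.\<close>
  define z where "z = mat m 1 (\<lambda>(i, j). (Q * c) $$ (i, 0) / (l - ls ! i))"
  have z: "z \<in> carrier_mat m 1" by (simp add: z_def)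
  have Qc: "Q * c \<in> carrier_mat m 1" using PQ c by simp
  have Dz: "?D * z + Q * c = l \<cdot>\<^sub>m z"
  proof (rule eq_matI)
    fix i j assume "i < dim_row (l \<cdot>\<^sub>m z)" "j < dim_col (l \<cdot>\<^sub>m z)"
    then have ij: "i < m" "j = 0" using z by auto
    then have "l - ls ! i \<noteq> 0" using ls by auto
    moreover have "(?D * z) $$ (i, 0) = ls ! i * z $$ (i, 0)"
      using ij by (simp add: mat_diag_mult_left[OF z])
    moreover have "z $$ (i, 0) = (Q * c) $$ (i, 0) / (l - ls ! i)"
      using ij by (simp add: z_def)
    moreover have "(?D * z + Q * c) $$ (i, j) = (?D * z) $$ (i, 0) + (Q * c) $$ (i, 0)"
      "(l \<cdot>\<^sub>m z) $$ (i, j) = l * z $$ (i, 0)"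
      using ij Qc z PQ(2) c by auto
    moreover have "r * (q / (l - r)) + q = l * (q / (l - r))" if "l - r \<noteq> 0" for q r
      using that by (simp add: field_simps)
    ultimately show "(?D * z + Q * c) $$ (i, j) = (l \<cdot>\<^sub>m z) $$ (i, j)"
      by presburger
  qed (use Qc z in auto)
  define y where "y = P * z"
  have y: "y \<in> carrier_mat m 1" using PQ z by (simp add: y_def)
  have XPD: "X * P = P * ?D"
    using PQ D XP assoc_mult_mat[of "P * ?D" m m Q m P m] right_mult_one_mat[of "P * ?D" m m] by simp
  have Xy: "X * y + c = l \<cdot>\<^sub>m y"
  proof -
    have Xy: "X * y = P * (?D * z)"
      unfolding y_def using assoc_mult_mat[OF X PQ(1) z] assoc_mult_mat[OF PQ(1) D z] XPD by simp
    have c: "c = P * (Q * c)" using assoc_mult_mat[OF PQ(1,2) c] PQ c by simp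
    have "P * (?D * z) + P * (Q * c) = P * (?D * z + Q * c)"
      by (rule mult_add_distrib_mat[OF PQ(1) mult_carrier_mat[OF D z] Qc, symmetric])
    then have "X * y + c = P * (l \<cdot>\<^sub>m z)" unfolding Xy by (subst c) (simp only: Dz)
    then show ?thesis using mult_smult_distrib[OF PQ(1) z] by (simp add: y_def)
  qed
  let ?A = "four_block_mat (mat11 l) (0\<^sub>m 1 m) c X"
  let ?B = "four_block_mat (mat11 l) (0\<^sub>m 1 m) (0\<^sub>m m 1) ?D"
  let ?P = "four_block_mat (1\<^sub>m 1) (0\<^sub>m 1 m) y P"
  let ?Q = "four_block_mat (1\<^sub>m 1) (0\<^sub>m 1 m) (- (Q * y)) Q"
  have m11: "mat11 l \<in> carrier_mat 1 1" by simp
  have Qy: "Q * y \<in> carrier_mat m 1" using PQ y by simp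
  have PQy: "P * (Q * y) = y" using assoc_mult_mat[OF PQ(1,2) y] PQ y by simp
  have "?P * ?Q = 1\<^sub>m (1 + m)"
    using PQ y Qy PQy
    by (subst mult_bordered[where m = m]) (auto simp: mat_uminus_cancel)
  moreover have "?Q * ?P = 1\<^sub>m (1 + m)"
    using PQ y Qy
    by (subst mult_bordered[where m = m])
      (auto simp: mat_uminus_cancel(3) mat_uminus_cancel(2)[OF Qy])
  moreover have "?A * ?P = ?P * ?B"
  proof -
    have "?A * ?P = four_block_mat (mat11 l) (0\<^sub>m 1 m) (c + X * y) (X * P)"
      using PQ y X c by (subst mult_bordered[where m = m]) auto
    moreover have "?P * ?B = four_block_mat (mat11 l) (0\<^sub>m 1 m) (l \<cdot>\<^sub>m y) (P * ?D)"
      using PQ y D mat11_mult(2)[OF y, of l]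
      by (subst mult_bordered[where m = m]) (auto simp: left_mult_zero_mat[OF D])
    moreover have "c + X * y = l \<cdot>\<^sub>m y" using Xy comm_add_mat[of c m 1 "X * y"] X c y by simp
    ultimately show ?thesis using XPD by simp
  qed
  ultimately have "similar_mat ?A ?B"
    using X c PQ y Qy by (intro similar_matI[of _ "1 + m" _ ?P ?Q]) auto
  then show ?thesis using mat_diag_Cons[of ls l] ls(1) by simp
qed

text \<open>Transposition reduces this to the lower triangular case.\<close>

lemma similar_diag_upper:
  fixes Y :: "'a::field mat"
  assumes Y: "Y \<in> carrier_mat m m" and b: "b \<in> carrier_mat 1 m"
    and us: "length us = m" "u \<notin> set us" and sim: "similar_mat Y (mat_diag m (nth us))"
  shows "similar_mat (four_block_mat (mat11 u) b (0\<^sub>m m 1) Y) (mat_diag (Suc m) (nth (u # us)))"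
proof -
  have t: "transpose_mat (mat_diag k f) = (mat_diag k f :: 'a mat)" for k f
    by (rule eq_matI) (auto simp: mat_diag_def)
  have "similar_mat Y\<^sup>T (mat_diag m (nth us))"
    using similar_mat_transpose[OF sim Y] by (simp add: t)
  from similar_diag_lower[OF _ _ us this, of "b\<^sup>T"] Y b
  have "similar_mat (four_block_mat (mat11 u) (0\<^sub>m 1 m) b\<^sup>T Y\<^sup>T) (mat_diag (Suc m) (nth (u # us)))" by simp
  from similar_mat_transpose[OF this, of "1 + m"] Y b
  have "similar_mat (four_block_mat (mat11 u) (0\<^sub>m 1 m) b\<^sup>T Y\<^sup>T)\<^sup>T (mat_diag (Suc m) (nth (u # us)))"
    by (simp add: t)
  moreover have "(four_block_mat (mat11 u) (0\<^sub>m 1 m) b\<^sup>T Y\<^sup>T)\<^sup>T = four_block_mat (mat11 u) b (0\<^sub>m m 1) Y"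
    using Y b by (subst transpose_four_block_mat[of _ 1 1 _ m _ m]) (auto intro!: arg_cong2[of _ _ _ _ "\<lambda>x. four_block_mat x _ _"] eq_matI)
  ultimately show ?thesis by simp
qed

section \<open>Prescribing the corner of a nonscalar matrix\<close>

lemma similar_lower_shear:
  fixes a b c E x :: "'a::comm_ring_1 mat"
  assumes c: "a \<in> carrier_mat 1 1" "b \<in> carrier_mat 1 m" "c \<in> carrier_mat m 1" "E \<in> carrier_mat m m" "x \<in> carrier_mat m 1"
  shows "similar_mat (four_block_mat a b c E)
    (four_block_mat (a + b * x) b (c + E * x - x * (a + b * x)) (E - x * b))"
proof -
  let ?P = "four_block_mat (1\<^sub>m 1) (0\<^sub>m 1 m) x (1\<^sub>m m)"
  let ?Q = "four_block_mat (1\<^sub>m 1) (0\<^sub>m 1 m) (- x) (1\<^sub>m m)"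
  have bx: "b * x \<in> carrier_mat 1 1" "E * x \<in> carrier_mat m 1" "x * (a + b * x) \<in> carrier_mat m 1" "x * b \<in> carrier_mat m m" using c by auto
  have "?P * ?Q = 1\<^sub>m (1 + m)" "?Q * ?P = 1\<^sub>m (1 + m)"
    using c by (subst mult_bordered[where m = m]; auto simp: mat_uminus_cancel)+
  moreover have "four_block_mat a b c E * ?P = four_block_mat (a + b * x) b (c + E * x) E"
    using c by (subst mult_bordered[where m = m]) auto
  moreover have "?P * four_block_mat (a + b * x) b (c + E * x - x * (a + b * x)) (E - x * b) = four_block_mat (a + b * x) b (c + E * x) E"
  proof -
    have "x * (a + b * x) + (c + E * x - x * (a + b * x)) = c + E * x" "x * b + (E - x * b) = E"
      using c bx by (intro eq_matI; auto)+
    then show ?thesis using c bx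
      by (subst mult_bordered[where m = m]) auto
  qed
  ultimately show ?thesis
    using c bx by (intro similar_matI[of _ "1 + m" _ ?P ?Q]) auto
qed

text \<open>Conjugation by an upper shear keeps the column c and lowers the corner by y c. If c is
  nonzero, every value of the corner can be obtained; the lower shear serves to make c nonzero
  first.\<close>

lemma similar_upper_shear:
  fixes a b c E y :: "'a::comm_ring_1 mat"
  assumes c: "a \<in> carrier_mat 1 1" "b \<in> carrier_mat 1 m" "c \<in> carrier_mat m 1" "E \<in> carrier_mat m m" "y \<in> carrier_mat 1 m"
  shows "similar_mat (four_block_mat a b c E)
    (four_block_mat (a - y * c) (a * y + b - y * (c * y + E)) c (c * y + E))"
proof -
  let ?P = "four_block_mat (1\<^sub>m 1) y (0\<^sub>m m 1) (1\<^sub>m m)"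
  let ?Q = "four_block_mat (1\<^sub>m 1) (- y) (0\<^sub>m m 1) (1\<^sub>m m)"
  have bx: "y * c \<in> carrier_mat 1 1" "a * y \<in> carrier_mat 1 m" "c * y \<in> carrier_mat m m" "y * (c * y + E) \<in> carrier_mat 1 m" using c by auto
  have "?P * ?Q = 1\<^sub>m (1 + m)" "?Q * ?P = 1\<^sub>m (1 + m)"
    using c by (subst mult_bordered[where m = m]; auto simp: mat_uminus_cancel)+
  moreover have "four_block_mat a b c E * ?P = four_block_mat a (a * y + b) c (c * y + E)"
    using c by (subst mult_bordered[where m = m]) auto
  moreover have "?P * four_block_mat (a - y * c) (a * y + b - y * (c * y + E)) c (c * y + E)
     = four_block_mat a (a * y + b) c (c * y + E)"
  proof -
    have "(a - y * c) + y * c = a" "(a * y + b - y * (c * y + E)) + y * (c * y + E) = a * y + b"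
      using c bx by (intro eq_matI; auto)+
    then show ?thesis using c bx
      by (subst mult_bordered[where m = m]) auto
  qed
  ultimately show ?thesis
    using c bx by (intro similar_matI[of _ "1 + m" _ ?P ?Q]) auto
qed

text \<open>If every lower shear led to a zero column, every vector (1, x) would be an eigenvector
  of A, which forces A to be scalar.\<close>

lemma nonscalar_first_column:
  fixes A :: "complex mat"
  assumes A: "A \<in> carrier_mat (Suc m) (Suc m)" and nonscalar: "\<And>k. A \<noteq> k \<cdot>\<^sub>m 1\<^sub>m (Suc m)"
  obtains a b c E where "a \<in> carrier_mat 1 1" "b \<in> carrier_mat 1 m" "c \<in> carrier_mat m 1" "E \<in> carrier_mat m m"
    "c \<noteq> 0\<^sub>m m 1" "similar_mat A (four_block_mat a b c E)"
proof -
  obtain a b c E where "split_block A 1 1 = (a, b, c, E)" by (metis prod_cases4)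
  from split_block[OF this, of m m] A have bl: "a \<in> carrier_mat 1 1" "b \<in> carrier_mat 1 m" "c \<in> carrier_mat m 1" "E \<in> carrier_mat m m"
    and Ae: "A = four_block_mat a b c E" by auto
  have "\<exists>x\<in>carrier_mat m 1. c + E * x - x * (a + b * x) \<noteq> 0\<^sub>m m 1"
  proof (rule ccontr)
    assume "\<not> ?thesis"
    then have z: "c + E * x - x * (a + b * x) = 0\<^sub>m m 1" if "x \<in> carrier_mat m 1" for x using that by auto
    define \<alpha> where "\<alpha> = a $$ (0, 0)"
    have zi: "c $$ (i, 0) + (\<Sum>k<m. E $$ (i, k) * f k) - f i * (\<alpha> + (\<Sum>k<m. b $$ (0, k) * f k)) = 0" if "i < m" for f i
    proof -
      have "(c + E * mat m 1 (\<lambda>(j, _). f j) - mat m 1 (\<lambda>(j, _). f j) * (a + b * mat m 1 (\<lambda>(j, _). f j))) $$ (i, 0) = 0"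
        using z[of "mat m 1 (\<lambda>(j, _). f j)"] that by simp
      then show ?thesis using that bl
        by (simp add: scalar_prod_def \<alpha>_def One_nat_def atLeast0LessThan)
    qed
    have c0: "c $$ (i, 0) = 0" if "i < m" for i
      using zi[OF that, of "\<lambda>_. 0"] by simp
    have e: "E $$ (i, j) * t = (if i = j then t * (\<alpha> + b $$ (0, j) * t) else 0)" if "i < m" "j < m" for i j t
      using zi[OF that(1), of "\<lambda>k. if k = j then t else 0"] c0[OF that(1)] that
      by (simp add: if_distrib cong: if_cong)
    \<comment> \<open>With x = t e_j the eigenvector condition is E_jj t = t (\<alpha> + b_j t). The
      values t = 1 and t = 2 separate the quadratic term from the linear one.\<close>
    have b0: "b $$ (0, j) = 0" and Ej: "E $$ (j, j) = \<alpha>" if "j < m" for j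
      using e[OF that that, of 1] e[OF that that, of 2] by (simp_all add: algebra_simps)
    have "A = \<alpha> \<cdot>\<^sub>m 1\<^sub>m (Suc m)"
    proof (rule eq_matI)
      fix i j assume "i < dim_row (\<alpha> \<cdot>\<^sub>m 1\<^sub>m (Suc m))" "j < dim_col (\<alpha> \<cdot>\<^sub>m 1\<^sub>m (Suc m))"
      then have ij: "i < Suc m" "j < Suc m" by auto
      show "A $$ (i, j) = (\<alpha> \<cdot>\<^sub>m 1\<^sub>m (Suc m)) $$ (i, j)"
      proof (cases i; cases j)
        fix i' j' assume "i = Suc i'" "j = Suc j'"
        then show ?thesis using ij bl Ej[of i'] e[of i' j' 1] by (auto simp: Ae One_nat_def)
      qed (use ij bl c0 b0 in \<open>auto simp: Ae \<alpha>_def One_nat_def\<close>)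
    qed (use A in auto)
    with nonscalar show False by blast
  qed
  then obtain x where x: "x \<in> carrier_mat m 1" "c + E * x - x * (a + b * x) \<noteq> 0\<^sub>m m 1" by blast
  from similar_lower_shear[OF bl x(1)]
  have "similar_mat A (four_block_mat (a + b * x) b (c + E * x - x * (a + b * x)) (E - x * b))" by (simp add: Ae)
  moreover have "a + b * x \<in> carrier_mat 1 1" "x * (a + b * x) \<in> carrier_mat m 1" "x * b \<in> carrier_mat m m"
    using bl x(1) by auto
  ultimately show thesis
    using bl x by (intro that[of "a + b * x" b "c + E * x - x * (a + b * x)" "E - x * b"] minus_carrier_mat) auto
qed

lemma nonzero_column:
  assumes "c \<in> carrier_mat m 1" "c \<noteq> 0\<^sub>m m 1"
  obtains p where "p < m" "c $$ (p, 0) \<noteq> 0"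
proof -
  have "\<exists>p<m. c $$ (p, 0) \<noteq> 0"
  proof (rule ccontr)
    assume "\<not> ?thesis"
    then have "c = 0\<^sub>m m 1" using assms(1) by (intro eq_matI) (auto simp: One_nat_def)
    with assms(2) show False ..
  qed
  with that show thesis by blast
qed

text \<open>Once c has a nonzero entry, a row y supported at that position solves y c = a - d, and
  the upper shear by y moves the corner to d.\<close>

lemma nonscalar_corner:
  fixes A :: "complex mat"
  assumes A: "A \<in> carrier_mat (Suc m) (Suc m)" and nonscalar: "\<And>k. A \<noteq> k \<cdot>\<^sub>m 1\<^sub>m (Suc m)"
  obtains b c E where "b \<in> carrier_mat 1 m" "c \<in> carrier_mat m 1" "E \<in> carrier_mat m m"
    "c \<noteq> 0\<^sub>m m 1" "similar_mat A (four_block_mat (mat11 d) b c E)"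
proof -
  from nonscalar_first_column[OF assms] obtain a b c E
    where bl: "a \<in> carrier_mat 1 1" "b \<in> carrier_mat 1 m" "c \<in> carrier_mat m 1" "E \<in> carrier_mat m m"
      and c: "c \<noteq> 0\<^sub>m m 1" and sim: "similar_mat A (four_block_mat a b c E)" by metis
  from nonzero_column[OF bl(3) c] obtain p where p: "p < m" "c $$ (p, 0) \<noteq> 0" .
  define y where "y = mat 1 m (\<lambda>(_, j). if j = p then (a $$ (0, 0) - d) / c $$ (p, 0) else 0)"
  have y: "y \<in> carrier_mat 1 m" by (simp add: y_def)
  have "a - y * c = mat11 d"
  proof (rule eq_matI)
    fix i j assume "i < dim_row (mat11 d)" "j < dim_col (mat11 d)"
    then have ij: "i = 0" "j = 0" by (auto simp: One_nat_def)
    have "(y * c) $$ (0, 0) = (\<Sum>k<m. y $$ (0, k) * c $$ (k, 0))"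
      using bl y by (simp add: scalar_prod_def atLeast0LessThan)
    also have "\<dots> = (\<Sum>k<m. if k = p then a $$ (0, 0) - d else 0)"
      using p by (intro sum.cong) (auto simp: y_def)
    finally have "(y * c) $$ (0, 0) = (\<Sum>k<m. if k = p then a $$ (0, 0) - d else 0)" .
    then show "(a - y * c) $$ (i, j) = mat11 d $$ (i, j)"
      using ij bl p y by simp
  qed (use bl y in auto)
  with similar_upper_shear[OF bl y]
  have "similar_mat (four_block_mat a b c E) (four_block_mat (mat11 d) (a * y + b - y * (c * y + E)) c (c * y + E))" by simp
  moreover have "a * y \<in> carrier_mat 1 m" "y * (c * y + E) \<in> carrier_mat 1 m" "c * y \<in> carrier_mat m m"
    using bl y by auto
  ultimately show thesis
    using bl y c similar_mat_trans[OF sim]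
    by (intro that[of "a * y + b - y * (c * y + E)" c "c * y + E"] minus_carrier_mat) auto
qed

text \<open>Block elimination: a unipotent lower factor times an upper one whose diagonal blocks are
  d and the Schur complement.\<close>

lemma det_four_block_schur:
  fixes b c E :: "'a::field mat"
  assumes c: "b \<in> carrier_mat 1 m" "c \<in> carrier_mat m 1" "E \<in> carrier_mat m m" and d: "d \<noteq> 0"
  shows "det (four_block_mat (mat11 d) b c E) = d * det (E - (1 / d) \<cdot>\<^sub>m (c * b))"
proof -
  let ?S = "E - (1 / d) \<cdot>\<^sub>m (c * b)"
  let ?L = "four_block_mat (1\<^sub>m 1) (0\<^sub>m 1 m) ((1 / d) \<cdot>\<^sub>m c) (1\<^sub>m m)"
  let ?U = "four_block_mat (mat11 d) b (0\<^sub>m m 1) ?S"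
  have cb: "c * b \<in> carrier_mat m m" using c by simp
  have "?L * ?U = four_block_mat (mat11 d) b c E"
  proof -
    have "(1 / d) \<cdot>\<^sub>m c * mat11 d = c"
      using c d by (subst mat11_mult(2)[of _ m]) (auto intro!: eq_matI)
    moreover have "(1 / d) \<cdot>\<^sub>m c * b + ?S = E"
      using c cb mult_smult_assoc_mat[OF c(2,1)] by (intro eq_matI) auto
    ultimately show ?thesis
      using c cb by (subst mult_bordered[where m = m]) auto
  qed
  moreover have "det ?L = 1"
    using c by (subst det_four_block_mat_upper_right_zero[of _ 1 _ m]) auto
  moreover have "det ?U = d * det ?S"
    using c cb det_single[of "mat11 d"] by (subst det_four_block_mat_lower_left_zero[of _ 1 _ m]) auto
  moreover have "det (?L * ?U) = det ?L * det ?U"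
    using c cb by (intro det_mult[of _ "1 + m"]) auto
  ultimately show ?thesis by simp
qed

text \<open>The induction of the factorization continues with the Schur complement, which must
  therefore be nonscalar again unless it has size 1. If it is s I, then s is nonzero by the
  determinant, and an upper shear by some y with y c = 0 keeps the corner and changes the complement
  to s I + (s/d) c y.\<close>

lemma nonscalar_corner_schur:
  fixes A :: "complex mat"
  assumes A: "A \<in> carrier_mat (Suc m) (Suc m)" and nonscalar: "\<And>k. A \<noteq> k \<cdot>\<^sub>m 1\<^sub>m (Suc m)"
    and detA: "det A \<noteq> 0" and d: "d \<noteq> 0" and m: "m \<noteq> 0"
  obtains b c E where "b \<in> carrier_mat 1 m" "c \<in> carrier_mat m 1" "E \<in> carrier_mat m m"
    "similar_mat A (four_block_mat (mat11 d) b c E)"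
    "m = 1 \<or> (\<forall>k. E - (1 / d) \<cdot>\<^sub>m (c * b) \<noteq> k \<cdot>\<^sub>m 1\<^sub>m m)"
proof -
  from nonscalar_corner[OF A nonscalar, of d] obtain b c E
    where bl: "b \<in> carrier_mat 1 m" "c \<in> carrier_mat m 1" "E \<in> carrier_mat m m"
      and c: "c \<noteq> 0\<^sub>m m 1" and sim: "similar_mat A (four_block_mat (mat11 d) b c E)" by metis
  have d11: "mat11 d \<in> carrier_mat 1 1" by simp
  let ?S = "E - (1 / d) \<cdot>\<^sub>m (c * b)"
  show thesis
  proof (cases "m = 1 \<or> (\<forall>k. ?S \<noteq> k \<cdot>\<^sub>m 1\<^sub>m m)")
    case True
    from that[OF bl sim this] show thesis .
  next
    case False
    then obtain s where s: "?S = s \<cdot>\<^sub>m 1\<^sub>m m" and m1: "m \<noteq> 1" by blast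
    have "det A = d * s ^ m"
      using det_similar[OF sim] det_four_block_schur[OF bl d] s by simp
    with detA m have s0: "s \<noteq> 0" by auto
    from nonzero_column[OF bl(2) c] obtain p where p: "p < m" "c $$ (p, 0) \<noteq> 0" .
    obtain q where q: "q < m" "q \<noteq> p" using m m1 by (metis One_nat_def less_one nat_neq_iff neq0_conv)
    \<comment> \<open>Orthogonal to c by construction, and (c y)_pq = c_p^2 is a nonzero entry off
      the diagonal, so s I + (s/d) c y is not scalar.\<close>
    define y where "y = mat 1 m (\<lambda>(_, j). if j = p then - c $$ (q, 0) else if j = q then c $$ (p, 0) else 0)"
    have y: "y \<in> carrier_mat 1 m" by (simp add: y_def)
    have yc: "y * c = 0\<^sub>m 1 1"
    proof (rule eq_matI)
      fix i j assume "i < dim_row (0\<^sub>m 1 1)" "j < dim_col (0\<^sub>m 1 1)"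
      then have ij: "i = 0" "j = 0" by (auto simp: One_nat_def)
      have "(y * c) $$ (0, 0) = (\<Sum>k<m. y $$ (0, k) * c $$ (k, 0))"
        using bl y by (simp add: scalar_prod_def atLeast0LessThan)
      also have "\<dots> = (\<Sum>k<m. (if k = p then - c $$ (q, 0) * c $$ (p, 0) else 0) + (if k = q then c $$ (p, 0) * c $$ (q, 0) else 0))"
        using p q by (intro sum.cong) (auto simp: y_def)
      also have "\<dots> = 0" using p q by (simp add: sum.distrib)
      finally show "(y * c) $$ (i, j) = 0\<^sub>m 1 1 $$ (i, j)" using ij by simp
    qed (use y bl in auto)
    have cy: "c * y \<in> carrier_mat m m" and cb: "c * b \<in> carrier_mat m m" and yE: "y * E \<in> carrier_mat 1 m"
      using y bl by auto
    have ycy: "y * (c * y) = 0\<^sub>m 1 m"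
      using assoc_mult_mat[OF y bl(2) y] yc y by simp
    have cypq: "(c * y) $$ (p, q) \<noteq> 0"
      using p q bl y by (simp add: scalar_prod_def y_def One_nat_def)
    have Ee: "E = s \<cdot>\<^sub>m 1\<^sub>m m + (1 / d) \<cdot>\<^sub>m (c * b)"
    proof -
      have "E = ?S + (1 / d) \<cdot>\<^sub>m (c * b)" using bl cb by (intro eq_matI) auto
      then show ?thesis using s by simp
    qed
    have "y * E = s \<cdot>\<^sub>m y"
    proof -
      have "y * E = y * (s \<cdot>\<^sub>m 1\<^sub>m m) + y * ((1 / d) \<cdot>\<^sub>m (c * b))"
        unfolding Ee using y cb by (intro mult_add_distrib_mat) auto
      moreover have "y * (s \<cdot>\<^sub>m 1\<^sub>m m) = s \<cdot>\<^sub>m y"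
        using mult_smult_distrib[OF y, of "1\<^sub>m m" m s] y by simp
      moreover have "y * ((1 / d) \<cdot>\<^sub>m (c * b)) = 0\<^sub>m 1 m"
      proof -
        have "y * (c * b) = 0\<^sub>m 1 m" using assoc_mult_mat[OF y bl(2,1), symmetric] yc bl by simp
        moreover have "(1 / d) \<cdot>\<^sub>m 0\<^sub>m 1 m = 0\<^sub>m 1 m" by (intro eq_matI) auto
        ultimately show ?thesis using mult_smult_distrib[OF y cb, of "1 / d"] by simp
      qed
      ultimately show ?thesis using y by simp
    qed
    then have ycE: "y * (c * y + E) = s \<cdot>\<^sub>m y"
      using mult_add_distrib_mat[OF y cy bl(3)] ycy y by simp
    define b' where "b' = d \<cdot>\<^sub>m y + b - s \<cdot>\<^sub>m y"
    define E' where "E' = c * y + E"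
    have b': "b' \<in> carrier_mat 1 m" and E': "E' \<in> carrier_mat m m" using y bl cy by (auto simp: b'_def E'_def)
    have "mat11 d - y * c = mat11 d" using yc by (intro eq_matI) auto
    then have "similar_mat (four_block_mat (mat11 d) b c E) (four_block_mat (mat11 d) b' c E')"
      using similar_upper_shear[OF d11 bl y] by (simp add: ycE mat11_mult(1)[OF y] b'_def E'_def)
    from similar_mat_trans[OF sim this] have sim': "similar_mat A (four_block_mat (mat11 d) b' c E')" .
    have cb': "c * b' = (d - s) \<cdot>\<^sub>m (c * y) + c * b"
    proof -
      have "b' = (d - s) \<cdot>\<^sub>m y + b" using y bl by (intro eq_matI) (auto simp: b'_def algebra_simps)
      then have "c * b' = c * ((d - s) \<cdot>\<^sub>m y) + c * b"
        using y bl mult_add_distrib_mat[of c m 1 "(d - s) \<cdot>\<^sub>m y" m b] by simp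
      then show ?thesis using mult_smult_distrib[OF bl(2) y] by simp
    qed
    have S': "E' - (1 / d) \<cdot>\<^sub>m (c * b') = s \<cdot>\<^sub>m 1\<^sub>m m + (s / d) \<cdot>\<^sub>m (c * y)"
    proof (rule eq_matI)
      fix i j assume "i < dim_row (s \<cdot>\<^sub>m 1\<^sub>m m + (s / d) \<cdot>\<^sub>m (c * y))" "j < dim_col (s \<cdot>\<^sub>m 1\<^sub>m m + (s / d) \<cdot>\<^sub>m (c * y))"
      then have ij: "i < m" "j < m" using cy by auto
      define Y where "Y = (c * y) $$ (i, j)"
      define Z where "Z = (c * b) $$ (i, j)"
      define I where "I = (1\<^sub>m m $$ (i, j) :: complex)"
      have EE: "E $$ (i, j) = s * I + (1 / d) * Z"
        using ij cb bl by (subst Ee) (simp add: Z_def I_def del: index_mult_mat(1))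
      have "(E' - (1 / d) \<cdot>\<^sub>m (c * b')) $$ (i, j) = (Y + E $$ (i, j)) - (1 / d) * ((d - s) * Y + Z)"
        unfolding cb' using ij y cy cb bl by (simp add: E'_def Y_def Z_def del: index_mult_mat(1))
      also have "\<dots> = s * I + (s / d) * Y" unfolding EE using d by (simp add: field_simps)
      also have "\<dots> = (s \<cdot>\<^sub>m 1\<^sub>m m + (s / d) \<cdot>\<^sub>m (c * y)) $$ (i, j)"
        using ij y bl cy by (simp add: I_def Y_def del: index_mult_mat(1))
      finally show "(E' - (1 / d) \<cdot>\<^sub>m (c * b')) $$ (i, j) = (s \<cdot>\<^sub>m 1\<^sub>m m + (s / d) \<cdot>\<^sub>m (c * y)) $$ (i, j)" .
    qed (use E' cb' cy cb y bl in auto)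
    have "E' - (1 / d) \<cdot>\<^sub>m (c * b') \<noteq> k \<cdot>\<^sub>m 1\<^sub>m m" for k
    proof
      assume "E' - (1 / d) \<cdot>\<^sub>m (c * b') = k \<cdot>\<^sub>m 1\<^sub>m m"
      then have "(k \<cdot>\<^sub>m 1\<^sub>m m) $$ (p, q) = (s \<cdot>\<^sub>m 1\<^sub>m m + (s / d) \<cdot>\<^sub>m (c * y)) $$ (p, q)" using S' by simp
      then have "(s / d) * (c * y) $$ (p, q) = 0"
        using p q cy y bl by (simp del: index_mult_mat(1))
      then show False using s0 d cypq by simp
    qed
    then have "m = 1 \<or> (\<forall>k. E' - (1 / d) \<cdot>\<^sub>m (c * b') \<noteq> k \<cdot>\<^sub>m 1\<^sub>m m)" by blast
    from that[OF b' bl(2) E' sim' this] show thesis .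
  qed
qed

lemmas square_mat_simps = assoc_mult_mat[of _ n n _ n _ n] mult_carrier_mat[of _ n n _ n] for n

lemma similar_mat_conj:
  assumes "X \<in> carrier_mat n n" "P \<in> carrier_mat n n" "Q \<in> carrier_mat n n" "P * Q = 1\<^sub>m n" "Q * P = 1\<^sub>m n"
  shows "similar_mat (P * X * Q) X"
  unfolding similar_mat_def similar_mat_wit_def using assms
  by (intro exI[of _ P] exI[of _ Q]) (auto simp: Let_def)

lemma conj_mult_conj:
  fixes X :: "'a::comm_ring_1 mat"
  assumes "X \<in> carrier_mat n n" "Y \<in> carrier_mat n n" "P \<in> carrier_mat n n" "Q \<in> carrier_mat n n" "Q * P = 1\<^sub>m n"
  shows "(P * X * Q) * (P * Y * Q) = P * (X * Y) * Q"
proof -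
  have "(P * X * Q) * (P * Y * Q) = P * X * ((Q * P) * (Y * Q))"
    using assms(1-4) by (simp add: square_mat_simps[where n = n])
  also have "\<dots> = P * (X * Y) * Q"
    unfolding assms(5) using assms(1-4) by (simp add: square_mat_simps[where n = n] left_mult_one_mat[of "Y * Q" n n])
  finally show ?thesis .
qed

text \<open>Sourour's factorization with prescribed spectra, for distinct eigenvalues.\<close>

lemma nonscalar_factorization:
  fixes A :: "complex mat"
  assumes "A \<in> carrier_mat n n" "length ls = n" "length us = n" "distinct ls" "distinct us"
    "0 \<notin> set ls" "0 \<notin> set us" "det A = prod_list ls * prod_list us"
    "n = 1 \<or> (\<forall>k. A \<noteq> k \<cdot>\<^sub>m 1\<^sub>m n)"
  shows "\<exists>X\<in>carrier_mat n n. \<exists>Y\<in>carrier_mat n n. A = X * Y \<and>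
    similar_mat X (mat_diag n (nth ls)) \<and> similar_mat Y (mat_diag n (nth us))"
  using assms
proof (induction n arbitrary: A ls us)
  case 0
  \<comment> \<open>The empty matrix counts as scalar, which contradicts the last
    hypothesis.\<close>
  then have "A = 0 \<cdot>\<^sub>m 1\<^sub>m 0" by (intro eq_matI) auto
  with 0 show ?case by (auto simp: One_nat_def)
next
  case (Suc m)
  from Suc.prems(2,3) obtain l ls' u us' where lu: "ls = l # ls'" "us = u # us'" "length ls' = m" "length us' = m"
    by (metis length_Suc_conv)
  have lu0: "l \<noteq> 0" "u \<noteq> 0" using Suc.prems lu by auto
  show ?case
  proof (cases "m = 0")
    case True
    have A1: "A \<in> carrier_mat 1 1" using Suc.prems(1) True by (simp add: One_nat_def)
    have "det A = l * u" using Suc.prems(8) lu True by simp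
    then have "A = mat_diag 1 (nth ls) * mat_diag 1 (nth us)"
      unfolding mat_diag_diag using carrier_mat_1_1[OF A1] det_single[OF A1] lu True
      by (auto intro!: eq_matI simp: mat_diag_def)
    then show ?thesis
      using True similar_mat_refl[OF mat_diag_dim[of "Suc 0" "nth ls"]] similar_mat_refl[OF mat_diag_dim[of "Suc 0" "nth us"]]
      by (intro bexI[of _ "mat_diag 1 (nth ls)"] bexI[of _ "mat_diag 1 (nth us)"]) (simp_all add: One_nat_def)
  next
    case False
    then have ns: "\<And>k. A \<noteq> k \<cdot>\<^sub>m 1\<^sub>m (Suc m)" using Suc.prems(9) by (auto simp: One_nat_def)
    have "prod_list ls \<noteq> 0" "prod_list us \<noteq> 0" using Suc.prems(6,7) by (simp_all add: prod_list_zero_iff)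
    then have "det A \<noteq> 0" using Suc.prems(8) by simp
    \<comment> \<open>The corner is prescribed as l u because X' below is lower triangular in block
      form with corner l, and Y' upper triangular with corner u. Their product has the required
      border automatically, and its remaining block is right exactly when X Y is the Schur
      complement.\<close>
    from nonscalar_corner_schur[OF Suc.prems(1) ns this, of "l * u"] lu0 False obtain b c E
      where bl: "b \<in> carrier_mat 1 m" "c \<in> carrier_mat m 1" "E \<in> carrier_mat m m"
        and sim: "similar_mat A (four_block_mat (mat11 (l * u)) b c E)"
        and S: "m = 1 \<or> (\<forall>k. E - (1 / (l * u)) \<cdot>\<^sub>m (c * b) \<noteq> k \<cdot>\<^sub>m 1\<^sub>m m)" by (metis mult_eq_0_iff)
    define S where "S = E - (1 / (l * u)) \<cdot>\<^sub>m (c * b)"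
    have cb: "c * b \<in> carrier_mat m m" using bl by simp
    have Sc: "S \<in> carrier_mat m m" unfolding S_def using cb by (intro minus_carrier_mat) auto
    have "det A = l * u * det S"
      using det_similar[OF sim] det_four_block_schur[OF bl, of "l * u"] lu0 by (simp add: S_def)
    then have "det S = prod_list ls' * prod_list us'" using Suc.prems(8) lu lu0 by simp
    from Suc.IH[OF Sc lu(3,4) _ _ _ _ this] Suc.prems lu S obtain X Y
      where XY: "X \<in> carrier_mat m m" "Y \<in> carrier_mat m m" "S = X * Y"
        and simXY: "similar_mat X (mat_diag m (nth ls'))" "similar_mat Y (mat_diag m (nth us'))"
      by (auto simp: S_def)
    define X' where "X' = four_block_mat (mat11 l) (0\<^sub>m 1 m) ((1 / u) \<cdot>\<^sub>m c) X"
    define Y' where "Y' = four_block_mat (mat11 u) ((1 / l) \<cdot>\<^sub>m b) (0\<^sub>m m 1) Y"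
    have X': "X' \<in> carrier_mat (Suc m) (Suc m)" and Y': "Y' \<in> carrier_mat (Suc m) (Suc m)"
      using XY bl by (auto simp: X'_def Y'_def One_nat_def)
    have sX: "similar_mat X' (mat_diag (Suc m) (nth ls))" and sY: "similar_mat Y' (mat_diag (Suc m) (nth us))"
      unfolding X'_def Y'_def lu(1,2)
      using Suc.prems(4,5) lu bl XY simXY by (auto intro!: similar_diag_lower similar_diag_upper)
    have X'Y': "X' * Y' = four_block_mat (mat11 (l * u)) b c E"
    proof -
      have "mat11 l * mat11 u = mat11 (l * u)"
        by (subst mat11_mult(1)[of _ 1]) (auto intro!: eq_matI)
      moreover have "mat11 l * ((1 / l) \<cdot>\<^sub>m b) = b"
        using bl lu0 by (subst mat11_mult(1)[of _ m]) (auto intro!: eq_matI)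
      moreover have "(1 / u) \<cdot>\<^sub>m c * mat11 u = c"
        using bl lu0 by (subst mat11_mult(2)[of _ m]) (auto intro!: eq_matI)
      moreover have "(1 / u) \<cdot>\<^sub>m c * ((1 / l) \<cdot>\<^sub>m b) + X * Y = E"
      proof -
        have "(1 / u) \<cdot>\<^sub>m c * ((1 / l) \<cdot>\<^sub>m b) = (1 / (l * u)) \<cdot>\<^sub>m (c * b)"
          using bl mult_smult_assoc_mat[of c m 1 "(1 / l) \<cdot>\<^sub>m b" m "1 / u"] mult_smult_distrib[OF bl(2,1), of "1 / l"]
          by (intro eq_matI) (auto simp: mult.commute)
        then show ?thesis unfolding XY(3)[symmetric] S_def using bl cb by (intro eq_matI) auto
      qed
      moreover have "mat11 l * mat11 u + 0\<^sub>m 1 m * 0\<^sub>m m 1 = mat11 l * mat11 u"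
         "mat11 l * ((1 / l) \<cdot>\<^sub>m b) + 0\<^sub>m 1 m * Y = mat11 l * ((1 / l) \<cdot>\<^sub>m b)"
         "(1 / u) \<cdot>\<^sub>m c * mat11 u + X * 0\<^sub>m m 1 = (1 / u) \<cdot>\<^sub>m c * mat11 u"
        using bl XY by auto
      ultimately show ?thesis unfolding X'_def Y'_def using bl XY
        by (subst mult_bordered[where m = m]) auto
    qed
    from similar_matE[OF sim Suc.prems(1)] obtain P Q where PQ: "P \<in> carrier_mat (Suc m) (Suc m)" "Q \<in> carrier_mat (Suc m) (Suc m)"
      "P * Q = 1\<^sub>m (Suc m)" "Q * P = 1\<^sub>m (Suc m)" "A = P * (X' * Y') * Q"
      unfolding X'Y' by metis
    have "A = (P * X' * Q) * (P * Y' * Q)"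
      using conj_mult_conj[OF X' Y' PQ(1,2,4)] PQ(5) by simp
    moreover have "similar_mat (P * X' * Q) (mat_diag (Suc m) (nth ls))" "similar_mat (P * Y' * Q) (mat_diag (Suc m) (nth us))"
      using similar_mat_trans[OF similar_mat_conj[OF X' PQ(1-4)] sX] similar_mat_trans[OF similar_mat_conj[OF Y' PQ(1-4)] sY] by auto
    moreover have "P * X' * Q \<in> carrier_mat (Suc m) (Suc m)" "P * Y' * Q \<in> carrier_mat (Suc m) (Suc m)"
      using PQ X' Y' by auto
    ultimately show ?thesis by blast
  qed
qed

section \<open>Monomial matrices and products of two involutions\<close>

definition mat_monomial :: "nat \<Rightarrow> (nat \<Rightarrow> nat) \<Rightarrow> (nat \<Rightarrow> 'a::zero) \<Rightarrow> 'a mat" where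
  "mat_monomial n \<pi> f = mat n n (\<lambda>(i, j). if j = \<pi> i then f j else 0)"

lemma mat_monomial_carrier [simp]: "mat_monomial n \<pi> f \<in> carrier_mat n n"
  by (simp add: mat_monomial_def)

text \<open>\<open>mat_monomial n \<pi> f\<close> is the permutation matrix of \<pi> times diag f,
  and for an involutive \<pi> the permutations cancel. With f = 1 this writes diag g as a product of
  two monomial matrices; with f = g it is the condition for an involution.\<close>

lemma mat_monomial_mult:
  fixes f g :: "nat \<Rightarrow> 'a::comm_ring_1"
  assumes \<pi>: "\<And>i. i < n \<Longrightarrow> \<pi> i < n \<and> \<pi> (\<pi> i) = i"
  shows "mat_monomial n \<pi> f * mat_monomial n \<pi> g = mat_diag n (\<lambda>i. f (\<pi> i) * g i)"
proof (rule eq_matI)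
  fix i j assume "i < dim_row (mat_diag n (\<lambda>i. f (\<pi> i) * g i))" "j < dim_col (mat_diag n (\<lambda>i. f (\<pi> i) * g i))"
  then have ij: "i < n" "j < n" by (auto simp: mat_diag_def)
  then have "(mat_monomial n \<pi> f * mat_monomial n \<pi> g) $$ (i, j)
    = (\<Sum>k<n. mat_monomial n \<pi> f $$ (i, k) * mat_monomial n \<pi> g $$ (k, j))"
    by (simp add: mat_monomial_def scalar_prod_def atLeast0LessThan)
  also have "\<dots> = (\<Sum>k<n. if k = \<pi> i then (if i = j then f (\<pi> i) * g i else 0) else 0)"
    using ij \<pi> by (intro sum.cong) (auto simp: mat_monomial_def)
  also have "\<dots> = mat_diag n (\<lambda>i. f (\<pi> i) * g i) $$ (i, j)"
    using ij \<pi> by (simp add: mat_diag_def)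
  finally show "(mat_monomial n \<pi> f * mat_monomial n \<pi> g) $$ (i, j) = mat_diag n (\<lambda>i. f (\<pi> i) * g i) $$ (i, j)" .
qed (simp_all add: mat_monomial_def mat_diag_def)

lemma mat_diag_eq_one: "(\<And>i. i < n \<Longrightarrow> g i = 1) \<Longrightarrow> mat_diag n g = 1\<^sub>m n"
  by (intro eq_matI) (auto simp: mat_diag_def)

text \<open>Let R be the permutation that reverses the order of the basis. Then diag f = R (R diag
  f), and the second factor squares to 1 because opposite entries of f are reciprocal.\<close>

lemma similar_diag_two_involutions:
  fixes X :: "'a::comm_ring_1 mat"
  assumes X: "X \<in> carrier_mat n n" and sim: "similar_mat X (mat_diag n f)"
    and f: "\<And>i. i < n \<Longrightarrow> f (n - 1 - i) * f i = 1"
  obtains R S where "R \<in> carrier_mat n n" "S \<in> carrier_mat n n" "R * R = 1\<^sub>m n" "S * S = 1\<^sub>m n" "X = R * S"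
proof -
  from similar_matE[OF sim X] obtain P Q where PQ: "P \<in> carrier_mat n n" "Q \<in> carrier_mat n n"
      "P * Q = 1\<^sub>m n" "Q * P = 1\<^sub>m n" "X = P * mat_diag n f * Q" by metis
  define \<rho> where "\<rho> i = n - 1 - i" for i
  define R where "R = (mat_monomial n \<rho> (\<lambda>_. 1) :: 'a mat)"
  define S where "S = mat_monomial n \<rho> f"
  have c: "R \<in> carrier_mat n n" "S \<in> carrier_mat n n" by (simp_all add: R_def S_def)
  have \<rho>: "\<rho> i < n \<and> \<rho> (\<rho> i) = i" if "i < n" for i using that by (auto simp: \<rho>_def)
  have "f (\<rho> i) * f i = 1" if "i < n" for i using f[OF that] by (simp only: \<rho>_def)
  then have RS: "R * R = 1\<^sub>m n" "S * S = 1\<^sub>m n" "R * S = mat_diag n f"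
    by (simp_all add: R_def S_def mat_monomial_mult[OF \<rho>] mat_diag_eq_one)
  have "(P * R * Q) * (P * R * Q) = 1\<^sub>m n" "(P * S * Q) * (P * S * Q) = 1\<^sub>m n" "X = (P * R * Q) * (P * S * Q)"
    using conj_mult_conj[OF c(1,1) PQ(1,2,4)] conj_mult_conj[OF c(2,2) PQ(1,2,4)] conj_mult_conj[OF c PQ(1,2,4)] RS PQ
    by simp_all
  with that[of "P * R * Q" "P * S * Q"] show thesis using PQ c by simp
qed

text \<open>Both factors of the factorization get the same spectrum, consisting of distinct numbers
  and closed under reciprocals, so that each of them is a product of two involutions.\<close>

lemma nonscalar_four_involutions:
  fixes A :: "complex mat"
  assumes A: "A \<in> carrier_mat n n" and "det A = 1" and ns: "\<And>k. A \<noteq> k \<cdot>\<^sub>m 1\<^sub>m n"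
  obtains D1 D2 D3 D4 where "{D1, D2, D3, D4} \<subseteq> {D \<in> carrier_mat n n. D * D = 1\<^sub>m n}" "A = D1 * D2 * (D3 * D4)"
proof -
  \<comment> \<open>Distinct exponents, symmetric about 0 under reversal of the index: the
    eigenvalues 2^(e i) are distinct, have product 1, and those at i and n - 1 - i are
    reciprocal.\<close>
  define e where "e i = 2 * real i - (real n - 1)" for i
  define f where "f i = complex_of_real (2 powr e i)" for i
  define ls where "ls = map f [0..<n]"
  have f0: "f i \<noteq> 0" for i by (simp add: f_def)
  have "inj f" by (auto simp: f_def e_def powr_inj intro!: injI)
  then have dist: "distinct ls" by (auto simp: ls_def distinct_map intro: inj_on_subset)
  have "(\<Sum>i<n. e i) = 0"
  proof -
    have "(\<Sum>i<n. 2 * real i) = real n * (real n - 1)" by (induction n) (auto simp: algebra_simps)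
    then show ?thesis by (simp add: e_def sum_subtractf)
  qed
  then have "(\<Prod>i<n. 2 powr e i) = 1"
    using powr_sum[of 2 e "{..<n}"] by simp
  then have "(\<Prod>i<n. f i) = 1"
    unfolding f_def by (simp flip: of_real_prod)
  then have pl: "prod_list ls = 1"
    by (simp add: ls_def prod.distinct_set_conv_list[symmetric] atLeast0LessThan)
  have "\<exists>X\<in>carrier_mat n n. \<exists>Y\<in>carrier_mat n n. A = X * Y \<and>
    similar_mat X (mat_diag n (nth ls)) \<and> similar_mat Y (mat_diag n (nth ls))"
    using ns f0 by (intro nonscalar_factorization A dist) (auto simp: pl \<open>det A = 1\<close>, auto simp: ls_def)
  then obtain X Y where XY: "X \<in> carrier_mat n n" "Y \<in> carrier_mat n n" "A = X * Y"
    "similar_mat X (mat_diag n (nth ls))" "similar_mat Y (mat_diag n (nth ls))" by blast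
  have m: "ls ! (n - 1 - i) * ls ! i = 1" if "i < n" for i
  proof -
    have "e (n - 1 - i) + e i = 0" using that by (simp add: e_def of_nat_diff)
    then have "2 powr e (n - 1 - i) * 2 powr e i = 1" by (simp flip: powr_add)
    then have "f (n - 1 - i) * f i = 1" unfolding f_def by (simp flip: of_real_mult)
    then show ?thesis using that by (simp add: ls_def)
  qed
  from similar_diag_two_involutions[OF XY(1,4) m] obtain D1 D2 where "D1 \<in> carrier_mat n n" "D2 \<in> carrier_mat n n"
    "D1 * D1 = 1\<^sub>m n" "D2 * D2 = 1\<^sub>m n" "X = D1 * D2" by metis
  moreover from similar_diag_two_involutions[OF XY(2,5) m] obtain D3 D4 where "D3 \<in> carrier_mat n n" "D4 \<in> carrier_mat n n"
    "D3 * D3 = 1\<^sub>m n" "D4 * D4 = 1\<^sub>m n" "Y = D3 * D4" by metis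
  ultimately show thesis using that[of D1 D2 D3 D4] XY(3) by simp
qed

section \<open>Reaching all perturbations\<close>

text \<open>The monomial vector field x^\<alpha> d/dx_j.\<close>

definition monom_vec :: "nat \<Rightarrow> (nat \<Rightarrow>\<^sub>0 nat) \<Rightarrow> nat \<Rightarrow> 'a::comm_ring_1 mfps vec" where
  "monom_vec n \<alpha> j = vec n (\<lambda>i. if i = j then mfps_monom \<alpha> else 0)"

lemma monom_vec_vser:
  "keys \<alpha> \<subseteq> {..<n} \<Longrightarrow> total_degree \<alpha> = K \<Longrightarrow> monom_vec n \<alpha> j \<in> vser n K"
  using mfps_monom_ord_ge[of \<alpha>] by (intro vserI) (auto simp: monom_vec_def in_vars_monom)

lemma dim_monom_vec [simp]: "dim_vec (monom_vec n \<alpha> j) = n"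
  by (simp add: monom_vec_def)

text \<open>Modulo order K + 1, w is a finite combination of monomial fields of degree K, which are
  split off one at a time. Asking only for the monomials that occur in w makes the lemma applicable
  to fields without resonant terms.\<close>

lemma monom_vec_decomposition:
  fixes S :: "'a::comm_ring_1 mfps vec set"
  assumes add: "\<And>u v. u \<in> S \<Longrightarrow> v \<in> S \<Longrightarrow> u + v \<in> S" and smult: "\<And>c u. u \<in> S \<Longrightarrow> mfps_const c \<cdot>\<^sub>v u \<in> S"
    and small: "vser n (Suc K) \<subseteq> S"
    and w: "w \<in> vser n K"
    and monoms: "\<And>j \<alpha>. j < n \<Longrightarrow> keys \<alpha> \<subseteq> {..<n} \<Longrightarrow> total_degree \<alpha> = K \<Longrightarrow>
      mcoeff (w $ j) \<alpha> \<noteq> 0 \<Longrightarrow> monom_vec n \<alpha> j \<in> S"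
  shows "w \<in> S"
proof -
  define I where "I w = {(j, \<alpha>). j < n \<and> \<alpha> \<in> exps n K \<and> total_degree \<alpha> = K \<and> mcoeff (w $ j) \<alpha> \<noteq> 0}"
    for w :: "'a mfps vec"
  have fin: "finite (I w)" for w
    by (rule finite_subset[of _ "{..<n} \<times> exps n K"]) (auto simp: I_def)
  have "\<lbrakk>w \<in> vser n K; \<And>j \<alpha>. (j, \<alpha>) \<in> I w \<Longrightarrow> monom_vec n \<alpha> j \<in> S\<rbrakk> \<Longrightarrow> w \<in> S" for w
  proof (induction "card (I w)" arbitrary: w)
    case 0
    then have e: "I w = {}" using fin by simp
    have "w $ j \<in> ord_ge (Suc K)" if j: "j < n" for j
      unfolding ord_ge_def
    proof (clarify)
      fix \<alpha> assume "total_degree \<alpha> < Suc K"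
      then consider "total_degree \<alpha> < K" | "total_degree \<alpha> = K" by linarith
      then show "mcoeff (w $ j) \<alpha> = 0"
      proof cases
        case 1
        then show ?thesis using ord_geD[OF vserD(4)[OF 0(2) j]] by blast
      next
        case 2
        show ?thesis
        proof (cases "keys \<alpha> \<subseteq> {..<n}")
          case True
          then show ?thesis using e 2 j by (auto simp: I_def exps_iff)
        next
          case False
          then show ?thesis using vserD(3)[OF 0(2) j] by (auto simp: in_vars_def)
        qed
      qed
    qed
    then have "w \<in> vser n (Suc K)" using 0(2) by (simp add: vser_def)
    with small show ?case by blast
  next
    case (Suc k)
    then obtain j \<alpha> where ja: "(j, \<alpha>) \<in> I w" by (metis card_eq_0_iff equals0I nat.simps(3) surj_pair)
    then have j: "j < n" and \<alpha>: "keys \<alpha> \<subseteq> {..<n}" "total_degree \<alpha> = K" by (auto simp: I_def exps_iff)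
    define m where "m = mfps_const (mcoeff (w $ j) \<alpha>) \<cdot>\<^sub>v monom_vec n \<alpha> j"
    have m: "m \<in> vser n K" unfolding m_def by (intro vser_smult monom_vec_vser \<alpha>)
    have w': "w - m \<in> vser n K" by (rule vser_diff[OF Suc.prems(1) m])
    have co: "mcoeff ((w - m) $ i) \<beta> = (if i = j \<and> \<beta> = \<alpha> then 0 else mcoeff (w $ i) \<beta>)" if "i < n" for i \<beta>
      using that vserD(1)[OF Suc.prems(1)] by (auto simp: m_def monom_vec_def mcoeff_monom)
    have Iw: "I (w - m) = I w - {(j, \<alpha>)}"
      unfolding I_def by (auto simp: co split: if_splits)
    have "card (I (w - m)) = k" unfolding Iw using Suc(2) ja fin by simp
    have "w - m \<in> S"
    proof (rule Suc(1)[OF _ w'])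
      show "k = card (I (w - m))" using \<open>card (I (w - m)) = k\<close> ..
      show "monom_vec n \<beta> i \<in> S" if "(i, \<beta>) \<in> I (w - m)" for i \<beta>
        using that Suc.prems(2) unfolding Iw by blast
    qed
    moreover have "m \<in> S" unfolding m_def by (intro smult Suc.prems(2) ja)
    moreover have "w = (w - m) + m"
      using vserD(1)[OF Suc.prems(1)] vserD(1)[OF m] by (intro eq_vecI) auto
    ultimately show ?case using add by metis
  qed
  then show ?thesis using w monoms by (auto simp: I_def exps_iff)
qed

lemma comp_lin_monom_vec:
  assumes "M \<in> carrier_mat n n" "j < n" "keys \<alpha> \<subseteq> {..<n}" "\<alpha> \<noteq> 0"
  shows "formal_comp (lin M) (monom_vec n \<alpha> j) = vec n (\<lambda>i. mfps_const (M $$ (i, j)) * mfps_monom \<alpha>)"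
proof (rule eq_vecI)
  have "1 \<le> total_degree \<alpha>"
    using assms(4) total_degree_eq_0_iff[of \<alpha>] by linarith
  then have z: "zero_const (monom_vec n \<alpha> j :: 'a mfps vec)"
    using monom_vec_vser[OF assms(3) refl, of j] by (rule vser_zero_const[rotated])
  fix i assume "i < dim_vec (vec n (\<lambda>i. mfps_const (M $$ (i, j)) * mfps_monom \<alpha>))"
  then have i: "i < n" by simp
  have "formal_comp (lin M) (monom_vec n \<alpha> j) $ i = (\<Sum>k<n. mfps_const (M $$ (i, k)) * monom_vec n \<alpha> j $ k)"
    using i assms(1) by (subst comp_lin_left[OF z]) auto
  also have "\<dots> = (\<Sum>k<n. if k = j then mfps_const (M $$ (i, j)) * mfps_monom \<alpha> else 0)"
    by (intro sum.cong refl) (auto simp: monom_vec_def)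
  finally show "formal_comp (lin M) (monom_vec n \<alpha> j) $ i = vec n (\<lambda>i. mfps_const (M $$ (i, j)) * mfps_monom \<alpha>) $ i"
    using i assms(2) by simp
qed (use assms in simp)

text \<open>The two sides of the action separate: M acts on the direction e_j, and N is substituted
  into the monomial.\<close>

lemma act_monom_vec:
  assumes "M \<in> carrier_mat n n" "N \<in> carrier_mat n n" "j < n" "keys \<alpha> \<subseteq> {..<n}" "\<alpha> \<noteq> 0"
  shows "act M N (monom_vec n \<alpha> j) = vec n (\<lambda>i. mfps_const (M $$ (i, j)) * mpow (lin N) \<alpha>)"
  unfolding act_def comp_lin_monom_vec[OF assms(1,3-5)]
  using assms(2,4) vser_zero_const[OF lin_vser[OF assms(2)]]
  by (intro eq_vecI) (auto simp: subst_times subst_const subst_monom)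

section \<open>Diagonal and permutation matrices acting on monomials\<close>

lemma lin_index:
  "M \<in> carrier_mat n n \<Longrightarrow> i < n \<Longrightarrow> lin M $ i = (\<Sum>j<n. mfps_const (M $$ (i, j)) * mfps_X j)"
  by (simp add: lin_def)

lemma lin_mat_diag: "i < n \<Longrightarrow> lin (mat_diag n e) $ i = mfps_const (e i) * mfps_X i"
proof -
  assume i: "i < n"
  have "lin (mat_diag n e) $ i = (\<Sum>j<n. if j = i then mfps_const (e i) * mfps_X i else 0)"
    unfolding lin_index[OF mat_diag_dim i]
    by (intro sum.cong refl) (use i in \<open>auto simp: mat_diag_def mfps_const_simps\<close>)
  with i show ?thesis by simp
qed

lemma lin_mat_monomial: "i < n \<Longrightarrow> \<pi> i < n \<Longrightarrow> lin (mat_monomial n \<pi> (\<lambda>_. 1)) $ i = mfps_X (\<pi> i)"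
proof -
  assume i: "i < n" "\<pi> i < n"
  have "lin (mat_monomial n \<pi> (\<lambda>_. 1)) $ i = (\<Sum>j<n. if j = \<pi> i then mfps_X (\<pi> i) else (0 :: 'a mfps))"
    unfolding lin_index[OF mat_monomial_carrier i(1)]
    by (intro sum.cong refl) (use i in \<open>auto simp: mat_monomial_def mfps_const_simps\<close>)
  with i show ?thesis by simp
qed

lemma mpow_sum: "mpow G (\<Sum>i\<in>I. f i) = (\<Prod>i\<in>I. mpow G (f i))"
  by (induction I rule: infinite_finite_induct) (auto simp: mpow_add)

lemma mpow_lin_mat_diag:
  assumes "keys \<alpha> \<subseteq> {..<n}"
  shows "mpow (lin (mat_diag n e)) \<alpha> = mfps_const (\<Prod>i<n. e i ^ lookup \<alpha> i) * mfps_monom \<alpha>"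
proof -
  have c: "mfps_const (prod f A) = (\<Prod>a\<in>A. mfps_const (f a))" for f :: "nat \<Rightarrow> 'a" and A
    by (induction A rule: infinite_finite_induct) (auto simp: mfps_const_simps)
  have "mpow (lin (mat_diag n e)) \<alpha>
     = (\<Prod>i<n. mfps_const (e i ^ lookup \<alpha> i) * (vec n mfps_X $ i) ^ lookup \<alpha> i)"
    using carrier_matD(1)[OF mat_diag_dim[of n e]]
    by (simp add: mpow_def lin_mat_diag power_mult_distrib mfps_const_power)
  also have "\<dots> = mfps_const (\<Prod>i<n. e i ^ lookup \<alpha> i) * mpow (vec n mfps_X) \<alpha>"
    by (simp add: c prod.distrib mpow_def)
  finally show ?thesis using assms by (simp add: mpow_X)
qed

text \<open>The exponent vector of (x_0 ... x_(n-1))^m.\<close>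

definition const_exp :: "nat \<Rightarrow> nat \<Rightarrow> (nat \<Rightarrow>\<^sub>0 nat)" where
  "const_exp n m = (\<Sum>i<n. single i m)"

lemma lookup_const_exp: "lookup (const_exp n m) i = (if i < n then m else 0)"
  by (simp add: const_exp_def lookup_sum lookup_single when_def)

lemma keys_const_exp: "keys (const_exp n m) \<subseteq> {..<n}"
  by (auto simp: in_keys_iff lookup_const_exp split: if_splits)

lemma total_degree_sum: "total_degree (\<Sum>i\<in>I. f i) = (\<Sum>i\<in>I. total_degree (f i))"
  by (induction I rule: infinite_finite_induct) auto

lemma total_degree_one [simp]: "total_degree 1 = 1"
  using total_degree_single[of 0 1] by simp

lemma total_degree_const_exp: "total_degree (const_exp n m) = n * m"
  by (simp add: const_exp_def total_degree_sum)

text \<open>The product of all variables is invariant under permutations, so only the additional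
  variable is moved.\<close>

lemma mpow_monomial_const_exp:
  fixes \<pi> :: "nat \<Rightarrow> nat"
  assumes \<pi>: "\<And>i. i < n \<Longrightarrow> \<pi> i < n \<and> \<pi> (\<pi> i) = i" and k: "k < n"
  shows "mpow (lin (mat_monomial n \<pi> (\<lambda>_. 1))) (const_exp n m + single k 1)
    = mfps_monom (const_exp n m + single (\<pi> k) 1)"
proof -
  let ?L = "lin (mat_monomial n \<pi> (\<lambda>_. 1)) :: 'a mfps vec"
  have d: "dim_vec ?L = n" by (simp add: mat_monomial_def)
  have "mpow ?L (const_exp n m) = (\<Prod>i<n. mfps_X (\<pi> i) ^ m)"
    unfolding const_exp_def mpow_sum by (intro prod.cong) (use \<pi> d in \<open>auto simp: mpow_single lin_mat_monomial\<close>)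
  also have "\<dots> = (\<Prod>i<n. mfps_X i ^ m)"
    by (rule prod.reindex_bij_witness[of _ \<pi> \<pi>]) (use \<pi> in auto)
  also have "\<dots> = mpow (vec n mfps_X) (const_exp n m)"
    unfolding const_exp_def mpow_sum by (intro prod.cong) (auto simp: mpow_single)
  finally have "mpow ?L (const_exp n m) = mfps_monom (const_exp n m)" by (simp add: mpow_X keys_const_exp)
  then show ?thesis
    using k d \<pi> by (simp add: mpow_add mpow_single lin_mat_monomial mfps_X_monom mfps_monom_mult)
qed

text \<open>The substitution x_0 -> x_0 + x_1, x_1 -> -x_1, fixing the other variables. Its column 0
  is the unit vector, so it carries a field in direction 0 to a field in direction 0.\<close>

definition mix_mat :: "nat \<Rightarrow> 'a::comm_ring_1 mat" where
  "mix_mat n = mat n n (\<lambda>(i, j). if i = j then (if i = 1 then - 1 else 1) else if i = 0 \<and> j = 1 then 1 else 0)"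

lemma mix_mat_carrier [simp]: "mix_mat n \<in> carrier_mat n n"
  by (simp add: mix_mat_def)

lemma lin_mix_mat:
  assumes "2 \<le> n"
  shows "lin (mix_mat n) $ 0 = mfps_X 0 + (mfps_X 1 :: 'a::comm_ring_1 mfps)"
    "lin (mix_mat n) $ 1 = - (mfps_X 1 :: 'a mfps)"
    "2 \<le> i \<Longrightarrow> i < n \<Longrightarrow> lin (mix_mat n) $ i = (mfps_X i :: 'a mfps)"
proof -
  have i: "0 < n" using assms by simp
  have "lin (mix_mat n) $ 0 = (\<Sum>j<n. (if j = 0 then mfps_X 0 else 0) + (if j = 1 then mfps_X 1 else 0 :: 'a mfps))"
    unfolding lin_index[OF mix_mat_carrier i]
    by (intro sum.cong refl) (use assms in \<open>auto simp: mix_mat_def mfps_const_simps\<close>)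
  then show "lin (mix_mat n) $ 0 = mfps_X 0 + (mfps_X 1 :: 'a mfps)"
    using assms by (simp add: sum.distrib)
  have i: "1 < n" using assms by simp
  have "lin (mix_mat n) $ 1 = (\<Sum>j<n. if j = 1 then - mfps_X 1 else 0 :: 'a mfps)"
    unfolding lin_index[OF mix_mat_carrier i]
    by (intro sum.cong refl) (use assms in \<open>auto simp: mix_mat_def mfps_const_simps\<close>)
  then show "lin (mix_mat n) $ 1 = - (mfps_X 1 :: 'a mfps)"
    using assms by simp
  show "lin (mix_mat n) $ i = (mfps_X i :: 'a mfps)" if "2 \<le> i" "i < n"
  proof -
    have "lin (mix_mat n) $ i = (\<Sum>j<n. if j = i then mfps_X i else 0 :: 'a mfps)"
      unfolding lin_index[OF mix_mat_carrier that(2)]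
      by (intro sum.cong refl) (use that in \<open>auto simp: mix_mat_def mfps_const_simps\<close>)
    then show ?thesis using that by simp
  qed
qed

lemma mix_mat_involution:
  assumes "2 \<le> n" shows "mix_mat n * mix_mat n = (1\<^sub>m n :: 'a::comm_ring_1 mat)"
proof (rule eq_matI)
  fix i j assume "i < dim_row (1\<^sub>m n :: 'a mat)" "j < dim_col (1\<^sub>m n :: 'a mat)"
  then have ij: "i < n" "j < n" by auto
  let ?f = "\<lambda>k. mix_mat n $$ (i, k) * (mix_mat n $$ (k, j) :: 'a)"
  have "(mix_mat n * mix_mat n) $$ (i, j) = (\<Sum>k<n. ?f k)"
    using ij by (simp add: mix_mat_def scalar_prod_def atLeast0LessThan)
  also have "\<dots> = (\<Sum>k\<in>{i, 1}. ?f k)"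
    by (rule sum.mono_neutral_right) (use ij assms in \<open>auto simp: mix_mat_def\<close>)
  also have "\<dots> = 1\<^sub>m n $$ (i, j)"
    using ij assms by (cases "i = 1") (auto simp: mix_mat_def)
  finally show "(mix_mat n * mix_mat n) $$ (i, j) = (1\<^sub>m n :: 'a mat) $$ (i, j)" .
qed (auto simp: mix_mat_def)

lemma of_nat_mfps: "of_nat k = mfps_const (of_nat k :: 'a::comm_ring_1)"
  by (induction k) (auto simp: mfps_const_simps)

text \<open>The monomial becomes (x_0 + x_1)^(m+3) (-x_1)^m times the power of the remaining
  variables. The binomial term x_0^(m+2) x_1 produces the resonant monomial x_0 (x_0 ...
  x_(n-1))^(m+1), and m + 3 is its binomial coefficient; over the complex numbers the result is
  nonzero.\<close>

lemma mix_mat_resonant_coeff: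
  fixes \<rho> :: "nat \<Rightarrow>\<^sub>0 nat" and m n :: nat
  defines "\<rho> \<equiv> (\<Sum>k\<in>{2..<n}. single k (Suc m))"
  assumes n: "2 \<le> n"
  shows "mcoeff (mpow (lin (mix_mat n)) (single 0 (m + 3) + single 1 m + \<rho>))
      (const_exp n (Suc m) + single 0 1) = (- 1) ^ m * (of_nat (m + 3) :: 'a::comm_ring_1)"
proof -
  let ?L = "lin (mix_mat n) :: 'a mfps vec"
  have d: "dim_vec ?L = n" by (simp add: mix_mat_def)
  have "mpow ?L \<rho> = (\<Prod>k\<in>{2..<n}. mfps_X k ^ Suc m)"
    unfolding \<rho>_def mpow_sum using n d by (intro prod.cong) (auto simp: mpow_single lin_mix_mat)
  also have "\<dots> = mpow (vec n mfps_X) \<rho>"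
    unfolding \<rho>_def mpow_sum using n by (intro prod.cong) (auto simp: mpow_single)
  also have "\<dots> = mfps_monom \<rho>"
  proof (rule mpow_X)
    show "keys \<rho> \<subseteq> {..<n}"
      by (auto simp: in_keys_iff \<rho>_def lookup_sum lookup_single when_def split: if_splits)
  qed
  finally have \<rho>: "mpow ?L \<rho> = mfps_monom \<rho>" .
  have \<rho>0: "lookup \<rho> 0 = 0" "lookup \<rho> 1 = 0"
    by (simp_all add: \<rho>_def lookup_sum lookup_single when_def)
  have "mpow ?L (single 0 (m + 3) + single 1 m + \<rho>)
    = (mfps_X 0 + mfps_X 1) ^ (m + 3) * (- mfps_X 1) ^ m * mfps_monom \<rho>"
    using n d by (simp add: mpow_add mpow_single lin_mix_mat \<rho>)
  also have "\<dots> = (\<Sum>k\<le>m + 3. mfps_const ((- 1) ^ m * of_nat ((m + 3) choose k)) *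
      mfps_monom (single 0 k + single 1 (m + 3 - k + m) + \<rho>))"
  proof -
    have neg: "(- mfps_X 1) ^ m = mfps_const ((- 1) ^ m) * (mfps_X 1 ^ m :: 'a mfps)"
      by (simp add: mfps_const_power mfps_const_simps power_minus[of "mfps_X 1"])
    have "(mfps_X 0 + mfps_X 1) ^ (m + 3) * (- mfps_X 1) ^ m * (mfps_monom \<rho> :: 'a mfps)
      = (\<Sum>k\<le>m + 3. mfps_const (of_nat ((m + 3) choose k)) * mfps_X 0 ^ k * mfps_X 1 ^ (m + 3 - k)
          * (mfps_const ((- 1) ^ m) * mfps_X 1 ^ m) * mfps_monom \<rho>)"
      by (simp only: neg binomial_ring of_nat_mfps sum_distrib_right)
    also have "\<dots> = (\<Sum>k\<le>m + 3. mfps_const ((- 1) ^ m * of_nat ((m + 3) choose k)) *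
      mfps_monom (single 0 k + single 1 (m + 3 - k + m) + \<rho>))"
    proof (rule sum.cong[OF refl])
      fix k
      have "mfps_monom (single 0 k + single 1 (m + 3 - k + m) + \<rho>)
        = mfps_X 0 ^ k * (mfps_X 1 ^ (m + 3 - k) * mfps_X 1 ^ m) * (mfps_monom \<rho> :: 'a mfps)"
        by (simp only: mfps_monom_mult mfps_X_power single_add)
      then show "mfps_const (of_nat ((m + 3) choose k)) * mfps_X 0 ^ k * mfps_X 1 ^ (m + 3 - k)
          * (mfps_const ((- 1) ^ m) * mfps_X 1 ^ m) * mfps_monom \<rho>
        = mfps_const ((- 1) ^ m * of_nat ((m + 3) choose k)) *
          (mfps_monom (single 0 k + single 1 (m + 3 - k + m) + \<rho>) :: 'a mfps)"
        by (simp only: mfps_const_simps mult_ac)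
    qed
    finally show ?thesis .
  qed
  finally have e: "mpow ?L (single 0 (m + 3) + single 1 m + \<rho>) = \<dots>" .
  have iff: "(const_exp n (Suc m) + single 0 1 = single 0 k + single 1 (m + 3 - k + m) + \<rho>)
      \<longleftrightarrow> k = m + 2" (is "?l k = ?r k \<longleftrightarrow> _") if "k \<le> m + 3" for k
  proof
    assume "?l k = ?r k"
    then have "lookup (?l k) 0 = lookup (?r k) 0" by simp
    then show "k = m + 2" using n by (simp add: lookup_add lookup_const_exp lookup_single \<rho>0)
  next
    assume k: "k = m + 2"
    show "?l k = ?r k"
    proof (rule poly_mapping_eqI)
      fix i :: nat
      consider "i = 0" | "i = 1" | "2 \<le> i" by linarith
      then show "lookup (?l k) i = lookup (?r k) i"
        using n \<rho>0 k by cases (auto simp: lookup_add lookup_const_exp lookup_single \<rho>_def lookup_sum when_def One_nat_def)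
    qed
  qed
  have "mcoeff (mpow ?L (single 0 (m + 3) + single 1 m + \<rho>)) (const_exp n (Suc m) + single 0 1)
    = (\<Sum>k\<le>m + 3. if k = m + 2 then (- 1) ^ m * of_nat ((m + 3) choose k) else 0)"
    unfolding e mcoeff_sum mcoeff_const_times mcoeff_monom
  proof (rule sum.cong[OF refl])
    fix k assume "k \<in> {..m + 3}"
    then have "(?l k = ?r k) = (k = m + 2)" by (intro iff) simp
    then show "(- 1) ^ m * of_nat (m + 3 choose k) * (if ?l k = ?r k then 1 else 0)
      = (if k = m + 2 then (- 1) ^ m * of_nat (m + 3 choose k) else (0 :: 'a))"
      by (cases "k = m + 2") (simp_all only: if_True if_False mult_1_right mult_zero_right simp_thms)
  qed
  also have "\<dots> = (- 1) ^ m * of_nat ((m + 3) choose (m + 2))" by simp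
  also have "(m + 3) choose (m + 2) = m + 3"
    using binomial_Suc_n[of "m + 2"] by (simp add: numeral_3_eq_3 numeral_2_eq_2)
  finally show ?thesis .
qed

text \<open>The diagonal twist rescales every monomial field and reaches those whose factor differs
  from 1. By genericity only x_j (x_0 ... x_(n-1))^m d/dx_j can remain. The field for j = 0 is
  obtained from a nonresonant one by the mixing involution, and the transpositions of neighbours
  contained in the permutations carry it to the other j.\<close>

lemma reach_all:
  fixes d e :: "nat \<Rightarrow> complex"
  assumes n: "2 \<le> n" and K: "2 \<le> K" and Ds: "set Ds \<subseteq> carrier_mat n n"
    and de: "\<And>i. i < n \<Longrightarrow> d i * e i = 1"
    and diag: "\<And>h. h \<in> vser n K \<Longrightarrow> act (mat_diag n d) (mat_diag n e) h - h \<in> reach n K Ds"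
    and generic: "\<And>\<alpha> j. j < n \<Longrightarrow> (\<Prod>i<n. d i ^ \<alpha> i) = d j \<Longrightarrow> \<exists>m. \<forall>i<n. \<alpha> i = m + (if i = j then 1 else 0 :: nat)"
    and perm: "\<And>i. Suc i < n \<Longrightarrow> \<exists>\<pi>. (\<forall>k<n. \<pi> k < n \<and> \<pi> (\<pi> k) = k) \<and> \<pi> i = Suc i \<and> mat_monomial n \<pi> (\<lambda>_. 1) \<in> set Ds"
    and mix: "mix_mat n \<in> set Ds"
  shows "vser n K \<subseteq> reach n K Ds"
proof -
  have K1: "1 \<le> K" using K by simp
  let ?S = "reach n K Ds"
  note add = reach_add[OF K1 Ds] and smult = reach_smult[OF K1 Ds] and dif = reach_diff[OF K1 Ds]
  have small: "vser n (Suc K) \<subseteq> ?S" using small_reach[OF K1 Ds] by blast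
  have unscale: "u \<in> ?S" if "mfps_const c \<cdot>\<^sub>v u \<in> ?S" "c \<noteq> 0" for c u
  proof -
    have "mfps_const (1 / c) \<cdot>\<^sub>v (mfps_const c \<cdot>\<^sub>v u) = u"
      using that(2) by (intro eq_vecI) (auto simp: mult.assoc[symmetric] mfps_const_simps(4)[symmetric] mfps_const_simps(2))
    then show ?thesis using smult[OF that(1), of "1 / c"] by simp
  qed
  \<comment> \<open>The degree K determines m, so in each direction j there is at most one such
    monomial.\<close>
  define res where "res j \<alpha> \<longleftrightarrow> (\<exists>m. n * m + 1 = K \<and> \<alpha> = const_exp n m + single j 1)" for j \<alpha>
  have nonres: "monom_vec n \<alpha> j \<in> ?S" if j: "j < n" and \<alpha>: "keys \<alpha> \<subseteq> {..<n}" "total_degree \<alpha> = K" and nr: "\<not> res j \<alpha>" for \<alpha> j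
  proof -
    \<comment> \<open>The eigenvalue of the diagonal action on x^\<alpha> d/dx_j; it equals 1
      exactly for a resonance d^\<alpha> = d_j.\<close>
    define w where "w = d j * (\<Prod>i<n. e i ^ lookup \<alpha> i)"
    have v: "monom_vec n \<alpha> j \<in> vser n K" by (rule monom_vec_vser[OF \<alpha>])
    have "w \<noteq> 1"
    proof
      assume "w = 1"
      have "(\<Prod>i<n. d i ^ lookup \<alpha> i) * (\<Prod>i<n. e i ^ lookup \<alpha> i) = 1"
        using de by (simp flip: prod.distrib power_mult_distrib)
      with \<open>w = 1\<close> have "(\<Prod>i<n. d i ^ lookup \<alpha> i) = d j"
        unfolding w_def by (metis mult.commute mult_cancel_right mult_zero_right zero_neq_one)
      from generic[OF j this] obtain m where m: "\<forall>i<n. lookup \<alpha> i = m + (if i = j then 1 else 0)" by blast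
      have "\<alpha> = const_exp n m + single j 1"
      proof (rule poly_mapping_eqI)
        fix i show "lookup \<alpha> i = lookup (const_exp n m + single j 1) i"
        proof (cases "i < n")
          case True
          then show ?thesis using m by (auto simp: lookup_add lookup_const_exp lookup_single when_def)
        next
          case False
          then have "i \<notin> keys \<alpha>" using \<alpha>(1) by auto
          then show ?thesis using False j by (auto simp: in_keys_iff lookup_add lookup_const_exp lookup_single when_def)
        qed
      qed
      moreover from this have "n * m + 1 = K" using \<alpha>(2) by (simp add: total_degree_const_exp)
      ultimately show False using nr by (auto simp: res_def)
    qed
    have "\<alpha> \<noteq> 0" using \<alpha>(2) K by auto
    have "act (mat_diag n d) (mat_diag n e) (monom_vec n \<alpha> j) - monom_vec n \<alpha> j = mfps_const (w - 1) \<cdot>\<^sub>v monom_vec n \<alpha> j"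
      unfolding act_monom_vec[OF mat_diag_dim mat_diag_dim j \<alpha>(1) \<open>\<alpha> \<noteq> 0\<close>] mpow_lin_mat_diag[OF \<alpha>(1)]
      using j by (intro eq_vecI) (auto simp: monom_vec_def w_def mat_diag_def mfps_const_simps algebra_simps)
    with diag[OF v] have "mfps_const (w - 1) \<cdot>\<^sub>v monom_vec n \<alpha> j \<in> ?S" by simp
    then show ?thesis by (rule unscale) (use \<open>w \<noteq> 1\<close> in simp)
  qed
  have res0: "monom_vec n (const_exp n m + single 0 1) 0 \<in> ?S" if m: "n * m + 1 = K" for m
  proof -
    \<comment> \<open>K \<ge> 2 excludes m = 0, so the exponent of x_1 can be lowered by one in
      \<gamma>.\<close>
    obtain l where l: "m = Suc l" using m K by (cases m) (auto simp: One_nat_def)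
    define \<rho> where "\<rho> = (\<Sum>k\<in>{2..<n}. single k m)"
    \<comment> \<open>The resonant monomial x_0 (x_0 ... x_(n-1))^m with one factor x_1 replaced by
      x_0: the exponents of x_0 and x_1 now differ by 3, so it is not resonant.\<close>
    define \<gamma> where "\<gamma> = single 0 (l + 3) + single 1 l + \<rho>"
    have \<gamma>l: "lookup \<gamma> 0 = l + 3" "lookup \<gamma> 1 = l"
      by (simp_all add: \<gamma>_def \<rho>_def lookup_add lookup_sum lookup_single when_def)
    have k\<gamma>: "keys \<gamma> \<subseteq> {..<n}"
      using n by (auto simp: in_keys_iff \<gamma>_def \<rho>_def lookup_add lookup_sum lookup_single when_def One_nat_def split: if_splits)
    have d\<gamma>: "total_degree \<gamma> = K"
    proof -
      have "total_degree \<gamma> = l + 3 + l + (n - 2) * m" by (simp add: \<gamma>_def \<rho>_def total_degree_sum)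
      also have "\<dots> = (2 + (n - 2)) * m + 1" unfolding l by (simp add: algebra_simps One_nat_def)
      also have "2 + (n - 2) = n" using n by simp
      finally show ?thesis using m by simp
    qed
    have "\<not> res 0 \<gamma>"
    proof
      assume "res 0 \<gamma>"
      then obtain m' where "\<gamma> = const_exp n m' + single 0 1" by (auto simp: res_def)
      then have "lookup \<gamma> 0 = m' + 1" "lookup \<gamma> 1 = m'"
        using n by (simp_all add: lookup_add lookup_const_exp lookup_single lookup_one when_def)
      then show False using \<gamma>l by simp
    qed
    have n0: "0 < n" using n by simp
    note h = nonres[OF n0 k\<gamma> d\<gamma> \<open>\<not> res 0 \<gamma>\<close>]
    have hv: "monom_vec n \<gamma> 0 \<in> vser n K" by (rule monom_vec_vser[OF k\<gamma> d\<gamma>])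
    define g where "g = (mpow (lin (mix_mat n)) \<gamma> :: complex mfps)"
    define a where "a = act (mix_mat n) (mix_mat n) (monom_vec n \<gamma> 0 :: complex mfps vec)"
    have aK: "a \<in> vser n K" unfolding a_def by (intro act_vser[OF K1] mix_mat_carrier hv)
    have a: "a = vec n (\<lambda>i. if i = 0 then g else 0)"
    proof -
      have "\<gamma> \<noteq> 0" using d\<gamma> K by auto
      then show ?thesis unfolding a_def act_monom_vec[OF mix_mat_carrier mix_mat_carrier n0 k\<gamma> \<open>\<gamma> \<noteq> 0\<close>] g_def
        using n by (intro eq_vecI) (auto simp: mix_mat_def mfps_const_simps)
    qed
    have "a - monom_vec n \<gamma> 0 \<in> ?S" unfolding a_def by (rule act_diff_reach[OF K1 Ds mix hv])
    from add[OF this h] have "a - monom_vec n \<gamma> 0 + monom_vec n \<gamma> 0 \<in> ?S" .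
    moreover have "a - monom_vec n \<gamma> 0 + monom_vec n \<gamma> 0 = a"
      using vserD(1)[OF aK] vserD(1)[OF hv] by (intro eq_vecI) auto
    ultimately have aS: "a \<in> ?S" by simp
    let ?\<beta> = "const_exp n m + single 0 1"
    have k\<beta>: "keys ?\<beta> \<subseteq> {..<n}" "total_degree ?\<beta> = K"
      using n0 keys_const_exp[of n m] m by (auto simp: keys_add_nat total_degree_const_exp)
    define c where "c = mcoeff g ?\<beta>"
    have "c = (- 1) ^ l * of_nat (l + 3)"
      unfolding c_def g_def \<gamma>_def \<rho>_def l by (rule mix_mat_resonant_coeff[OF n])
    then have c0: "c \<noteq> 0" by (simp del: of_nat_add)
    have th: "monom_vec n ?\<beta> 0 \<in> vser n K" by (rule monom_vec_vser[OF k\<beta>])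
    \<comment> \<open>The field a points in direction 0 and contains the resonant monomial with
      coefficient c. Without this term only nonresonant monomials are left, and these are reachable
      already.\<close>
    have "a - mfps_const c \<cdot>\<^sub>v monom_vec n ?\<beta> 0 \<in> ?S"
    proof (rule monom_vec_decomposition[OF add smult small])
      show "a - mfps_const c \<cdot>\<^sub>v monom_vec n ?\<beta> 0 \<in> vser n K"
        by (intro vser_diff aK vser_smult th)
      fix j \<alpha> assume ja: "j < n" "keys \<alpha> \<subseteq> {..<n}" "total_degree \<alpha> = K"
        and ne: "mcoeff ((a - mfps_const c \<cdot>\<^sub>v monom_vec n ?\<beta> 0) $ j) \<alpha> \<noteq> 0"
      have j0: "j = 0" and "\<alpha> \<noteq> ?\<beta>"
        using ne ja(1) by (auto simp: a monom_vec_def mcoeff_monom c_def split: if_splits)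
      have "\<not> res j \<alpha>"
      proof
        assume "res j \<alpha>"
        then obtain m' where m': "n * m' + 1 = K" "\<alpha> = const_exp n m' + single 0 1" by (auto simp: res_def j0)
        have "n * m' = n * m" using m'(1) m by linarith
        then have "m' = m" using n0 by simp
        with m'(2) \<open>\<alpha> \<noteq> ?\<beta>\<close> show False by simp
      qed
      then show "monom_vec n \<alpha> j \<in> ?S" by (rule nonres[OF ja])
    qed
    from dif[OF aS this] have "a - (a - mfps_const c \<cdot>\<^sub>v monom_vec n ?\<beta> 0) \<in> ?S" .
    moreover have "a - (a - mfps_const c \<cdot>\<^sub>v monom_vec n ?\<beta> 0) = mfps_const c \<cdot>\<^sub>v monom_vec n ?\<beta> 0"
      using vserD(1)[OF aK] by (intro eq_vecI) auto
    ultimately show ?thesis using unscale c0 by simp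
  qed
  have resj: "monom_vec n (const_exp n m + single j 1) j \<in> ?S" if m: "n * m + 1 = K" and "j < n" for m j
    using \<open>j < n\<close>
  proof (induction j)
    case 0
    show ?case by (rule res0[OF m])
  next
    case (Suc j)
    let ?\<theta> = "\<lambda>j. monom_vec n (const_exp n m + single j 1) j :: complex mfps vec"
    have j: "j < n" using Suc.prems by simp
    from perm[OF Suc.prems] obtain \<pi> where \<pi>: "\<And>k. k < n \<Longrightarrow> \<pi> k < n \<and> \<pi> (\<pi> k) = k" "\<pi> j = Suc j"
      and in_Ds: "mat_monomial n \<pi> (\<lambda>_. 1) \<in> set Ds" by blast
    have k: "keys (const_exp n m + single j 1) \<subseteq> {..<n}"
      "total_degree (const_exp n m + single j 1) = K"
      using j keys_const_exp[of n m] m by (auto simp: keys_add_nat total_degree_const_exp)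
    have nz: "const_exp n m + single j 1 \<noteq> 0"
      using k(2) K by (metis total_degree_zero not_numeral_le_zero)
    have \<theta>: "?\<theta> j \<in> vser n K" by (rule monom_vec_vser[OF k])
    have \<pi>j: "j = \<pi> i \<longleftrightarrow> i = Suc j" if "i < n" for i
      using \<pi>(1)[OF that] \<pi>(1)[OF j] \<pi>(2) by metis
    have pw: "mpow (lin (mat_monomial n \<pi> (\<lambda>_. 1))) (const_exp n m + single j 1)
        = (mfps_monom (const_exp n m + single (Suc j) 1) :: complex mfps)"
      using mpow_monomial_const_exp[of n \<pi> j m] \<pi> j by simp
    \<comment> \<open>The permutation sends j to j + 1 both in the extra variable and in the
      direction of the field.\<close>
    have "act (mat_monomial n \<pi> (\<lambda>_. 1)) (mat_monomial n \<pi> (\<lambda>_. 1)) (?\<theta> j) = ?\<theta> (Suc j)"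
      unfolding act_monom_vec[OF mat_monomial_carrier mat_monomial_carrier j k(1) nz] pw
      using j by (intro eq_vecI) (auto simp: monom_vec_def mat_monomial_def \<pi>j mfps_const_simps)
    with act_diff_reach[OF K1 Ds in_Ds \<theta>] have "?\<theta> (Suc j) - ?\<theta> j \<in> ?S" by simp
    from add[OF this Suc.IH[OF j]] have "?\<theta> (Suc j) - ?\<theta> j + ?\<theta> j \<in> ?S" .
    moreover have "?\<theta> (Suc j) - ?\<theta> j + ?\<theta> j = ?\<theta> (Suc j)" by (intro eq_vecI) auto
    ultimately show ?case by simp
  qed
  show ?thesis
  proof
    fix w :: "complex mfps vec" assume w: "w \<in> vser n K"
    show "w \<in> ?S"
    proof (rule monom_vec_decomposition[OF add smult small w])
      fix j \<alpha> assume ja: "j < n" "keys \<alpha> \<subseteq> {..<n}" "total_degree \<alpha> = K"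
      show "monom_vec n \<alpha> j \<in> ?S"
      proof (cases "res j \<alpha>")
        case True
        then show ?thesis using resj ja(1) by (auto simp: res_def)
      next
        case False
        then show ?thesis by (rule nonres[OF ja])
      qed
    qed
  qed
qed

section \<open>A multiplicatively generic diagonal matrix\<close>

lemma infinitely_many_primes_inj:
  obtains p :: "nat \<Rightarrow> nat" where "inj p" "\<And>i. prime (p i)"
  using infinite_countable_subset[OF primes_infinite] by blast

lemma multiplicity_prod_power:
  fixes r :: "nat \<Rightarrow> nat"
  assumes "prime p" "\<And>i. r i \<noteq> 0"
  shows "multiplicity p (\<Prod>i<n. r i ^ a i) = (\<Sum>i<n. a i * multiplicity p (r i))"
proof -
  have nz: "r i ^ a i \<noteq> 0" for i using assms(2) by simp
  have "0 \<notin> (\<lambda>i. r i ^ a i) ` {..<n}"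
  proof
    assume "0 \<in> (\<lambda>i. r i ^ a i) ` {..<n}"
    then obtain i where "0 = r i ^ a i" by blast
    with nz[of i] show False by simp
  qed
  then have "multiplicity p (\<Prod>i<n. r i ^ a i) = (\<Sum>i<n. multiplicity p (r i ^ a i))"
    using assms(1) by (intro prime_elem_multiplicity_prod_distrib) auto
  also have "\<dots> = (\<Sum>i<n. a i * multiplicity p (r i))"
    using assms by (intro sum.cong refl prime_elem_multiplicity_power_distrib) auto
  finally show ?thesis .
qed

text \<open>A chain of quotients of distinct primes whose only multiplicative relations are the powers
  of the relation that the product of all entries is \<open>\<plusminus>1\<close>. Up to the sign \<open>s\<close>, the partial
  products of \<open>chain_diag p n s\<close> are the numbers \<open>prime_chain p n\<close>.\<close>

definition prime_chain :: "(nat \<Rightarrow> nat) \<Rightarrow> nat \<Rightarrow> nat \<Rightarrow> nat" where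
  "prime_chain p n i = (if i = 0 \<or> n \<le> i then 1 else p i)"

definition chain_diag :: "(nat \<Rightarrow> nat) \<Rightarrow> nat \<Rightarrow> complex \<Rightarrow> nat \<Rightarrow> complex" where
  "chain_diag p n s i = (if Suc i = n then s else 1) * of_nat (prime_chain p n (Suc i)) / of_nat (prime_chain p n i)"

context
  fixes p :: "nat \<Rightarrow> nat" and n :: nat and s :: complex
  assumes p: "inj p" "\<And>i. prime (p i)" and n: "2 \<le> n" and s: "s * s = 1"
begin

lemma chain_pos: "prime_chain p n i \<noteq> 0"
  using prime_gt_0_nat[OF p(2)[of i]] by (simp add: prime_chain_def)

lemma norm_s: "norm s = 1"
  using s by (metis norm_mult norm_one norm_ge_zero abs_of_nonneg real_sqrt_abs2 real_sqrt_one)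

lemma norm_chain_diag: "norm (chain_diag p n s i) = real (prime_chain p n (Suc i)) / real (prime_chain p n i)"
  by (simp add: chain_diag_def norm_mult norm_divide norm_s)

lemma chain_diag_nonzero: "chain_diag p n s i \<noteq> 0"
  using chain_pos s by (auto simp: chain_diag_def)

lemma multiplicity_chain: "0 < k \<Longrightarrow> k < n \<Longrightarrow> multiplicity (p k) (prime_chain p n i) = (if i = k then 1 else 0)"
  using p(2)[of k] p(2)[of i] inj_eq[OF p(1), of k i]
  by (auto simp: prime_chain_def prime_multiplicity_other)

text \<open>Each prime p_(k+1) with k + 1 < n occurs in the numerator of the k-th entry and in the
  denominator of the next one, and nowhere else. Comparing its multiplicity on both sides shows that
  \<alpha> minus the unit vector of j takes equal values at k and k + 1, hence is constant.\<close>

lemma chain_diag_generic: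
  assumes j: "j < n" and e: "(\<Prod>i<n. chain_diag p n s i ^ \<alpha> i) = chain_diag p n s j"
  shows "\<exists>m. \<forall>i<n. \<alpha> i = m + (if i = j then 1 else 0 :: nat)"
proof -
  \<comment> \<open>Norms discard the sign s and leave an identity of positive rationals, which is
    then cleared of denominators.\<close>
  have "(\<Prod>i<n. (real (prime_chain p n (Suc i)) / real (prime_chain p n i)) ^ \<alpha> i) = real (prime_chain p n (Suc j)) / real (prime_chain p n j)"
    using arg_cong[OF e, of norm] by (simp add: prod_norm[symmetric] norm_power norm_chain_diag)
  then have "(\<Prod>i<n. real (prime_chain p n (Suc i)) ^ \<alpha> i) * real (prime_chain p n j) = real (prime_chain p n (Suc j)) * (\<Prod>i<n. real (prime_chain p n i) ^ \<alpha> i)"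
    using chain_pos by (simp add: power_divide prod_dividef field_simps)
  then have "real ((\<Prod>i<n. prime_chain p n (Suc i) ^ \<alpha> i) * prime_chain p n j) = real (prime_chain p n (Suc j) * (\<Prod>i<n. prime_chain p n i ^ \<alpha> i))"
    by simp
  then have eq: "(\<Prod>i<n. prime_chain p n (Suc i) ^ \<alpha> i) * prime_chain p n j = prime_chain p n (Suc j) * (\<Prod>i<n. prime_chain p n i ^ \<alpha> i)"
    by (simp only: of_nat_eq_iff)
  have step: "\<alpha> k + (if Suc k = j then 1 else 0) = \<alpha> (Suc k) + (if k = j then 1 else 0)" if k: "Suc k < n" for k
  proof -
    let ?p = "p (Suc k)"
    have pr: "prime ?p" by (rule p(2))
    have m: "multiplicity ?p (prime_chain p n i) = (if i = Suc k then 1 else 0)" for i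
      using multiplicity_chain[of "Suc k" i] k by simp
    have nz: "(\<Prod>i<n. prime_chain p n (Suc i) ^ \<alpha> i) \<noteq> 0" "(\<Prod>i<n. prime_chain p n i ^ \<alpha> i) \<noteq> 0" using chain_pos by simp_all
    have "multiplicity ?p ((\<Prod>i<n. prime_chain p n (Suc i) ^ \<alpha> i) * prime_chain p n j) = (\<Sum>i<n. \<alpha> i * multiplicity ?p (prime_chain p n (Suc i))) + multiplicity ?p (prime_chain p n j)"
      using pr nz chain_pos by (simp add: prime_elem_multiplicity_mult_distrib multiplicity_prod_power)
    also have "\<dots> = \<alpha> k + (if Suc k = j then 1 else 0)"
      using k by (auto simp: m if_distrib cong: if_cong)
    finally have 1: "multiplicity ?p ((\<Prod>i<n. prime_chain p n (Suc i) ^ \<alpha> i) * prime_chain p n j) = \<alpha> k + (if Suc k = j then 1 else 0)" .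
    have "multiplicity ?p (prime_chain p n (Suc j) * (\<Prod>i<n. prime_chain p n i ^ \<alpha> i)) = multiplicity ?p (prime_chain p n (Suc j)) + (\<Sum>i<n. \<alpha> i * multiplicity ?p (prime_chain p n i))"
      using pr nz chain_pos by (simp add: prime_elem_multiplicity_mult_distrib multiplicity_prod_power)
    also have "\<dots> = \<alpha> (Suc k) + (if k = j then 1 else 0)"
      using k by (auto simp: m if_distrib cong: if_cong)
    finally show ?thesis using 1 eq by simp
  qed
  have inv: "int (\<alpha> k) - (if k = j then 1 else 0) = int (\<alpha> 0) - (if 0 = j then 1 else 0)" if "k < n" for k
    using that
  proof (induction k)
    case (Suc k)
    then show ?case using step[of k] by (auto split: if_splits)
  qed simp
  \<comment> \<open>An index different from j, at which \<alpha> itself is the constant, so that the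
    constant is a natural number.\<close>
  obtain k where k: "k < n" "k \<noteq> j" using n by (cases "j = 0") (auto intro: that[of 1] that[of 0])
  show ?thesis
  proof (intro exI allI impI)
    fix i assume "i < n"
    then show "\<alpha> i = \<alpha> k + (if i = j then 1 else 0)"
      using inv[of i] inv[of k] k by (auto split: if_splits)
  qed
qed

text \<open>Equality would give p_1^2 = 1 or p_1^2 = p_2 on taking norms, according to whether n =
  2. This makes the square of the diagonal matrix nonscalar.\<close>

lemma chain_diag_square_neq: "chain_diag p n s 0 * chain_diag p n s 0 \<noteq> chain_diag p n s 1 * chain_diag p n s 1"
proof
  assume "chain_diag p n s 0 * chain_diag p n s 0 = chain_diag p n s 1 * chain_diag p n s 1"
  then have "norm (chain_diag p n s 0 * chain_diag p n s 0) = norm (chain_diag p n s 1 * chain_diag p n s 1)" by simp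
  then have "norm (chain_diag p n s 0) = norm (chain_diag p n s 1)" unfolding norm_mult using norm_ge_zero by (metis abs_of_nonneg real_sqrt_abs2)
  then have "real (prime_chain p n 1) * real (prime_chain p n 1) = real (prime_chain p n 2)"
    using chain_pos[of 1] by (simp add: norm_chain_diag prime_chain_def field_simps numeral_2_eq_2 One_nat_def)
  then have "prime_chain p n 1 * prime_chain p n 1 = prime_chain p n 2" by (metis of_nat_eq_iff of_nat_mult)
  moreover have "prime_chain p n 1 = p 1" using n by (simp add: prime_chain_def)
  ultimately have e: "p 1 * p 1 = prime_chain p n 2" by simp
  show False
  proof (cases "n = 2")
    case True
    then show False using e p(2)[of 1] by (simp add: prime_chain_def)
  next
    case False
    then have "p 1 * p 1 = p 2" using e n by (simp add: prime_chain_def)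
    then have "p 1 dvd p 2" by (metis dvd_triv_left)
    then have "p 1 = p 2" using p(2) primes_dvd_imp_eq by blast
    then show False using inj_eq[OF p(1), of 1 2] by simp
  qed
qed

text \<open>The diagonal matrix of the chain is a product of two diagonal matrices, whose entries are
  reciprocal at the positions \<open>2 i, 2 i + 1\<close> and \<open>2 i + 1, 2 i + 2\<close>, respectively; each of them is
  a product of two monomial involutions.\<close>

definition pair_swap :: "bool \<Rightarrow> nat \<Rightarrow> nat" where
  "pair_swap b i = (if even i = b then (if Suc i < n then Suc i else i) else i - 1)"

definition pair_diag :: "bool \<Rightarrow> nat \<Rightarrow> complex" where
  "pair_diag b i = (if even i = b then (if Suc i = n then s else 1) * of_nat (prime_chain p n (Suc i)) else 1 / of_nat (prime_chain p n i))"

lemma pair_swap: "i < n \<Longrightarrow> pair_swap b i < n \<and> pair_swap b (pair_swap b i) = i"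
  by (cases i) (auto simp: pair_swap_def)

text \<open>Every index takes the numerator of its entry from one of the two diagonals and the
  denominator from the other.\<close>

lemma pair_diag_mult: "pair_diag True i * pair_diag False i = chain_diag p n s i"
  by (cases "even i") (simp_all add: pair_diag_def chain_diag_def)

text \<open>Paired neighbours carry a chain number and its reciprocal. At the ends of the chain an
  index may be left alone: the last one has the entry s, whose square is 1, and index 0, fixed
  because 0 - 1 = 0, has the entry 1.\<close>

lemma pair_diag_swap: "i < n \<Longrightarrow> pair_diag b (pair_swap b i) * pair_diag b i = 1"
proof (cases "even i = b")
  case True
  assume "i < n"
  then consider "Suc i < n" | "Suc i = n" by linarith
  then show ?thesis
    using True chain_pos[of i] chain_pos[of "Suc i"] s by cases (auto simp: pair_diag_def pair_swap_def prime_chain_def)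
next
  case False
  assume "i < n"
  then show ?thesis
    using False chain_pos[of i] by (cases i) (auto simp: pair_diag_def pair_swap_def prime_chain_def)
qed

lemma chain_diag_involutions:
  assumes "b \<in> {True, False}"
  defines "P \<equiv> mat_monomial n (pair_swap b) (\<lambda>_. 1)" and "Q \<equiv> mat_monomial n (pair_swap b) (pair_diag b)"
  shows "P * P = 1\<^sub>m n" "Q * Q = 1\<^sub>m n" "P * Q = mat_diag n (pair_diag b)"
  unfolding P_def Q_def by (simp_all add: mat_monomial_mult[OF pair_swap] mat_diag_eq_one pair_diag_swap)

text \<open>The two swaps together join all neighbouring indices, so two permutations connect the
  resonant fields in all directions.\<close>

lemma pair_swap_Suc: "Suc i < n \<Longrightarrow> pair_swap (even i) i = Suc i"
  by (simp add: pair_swap_def)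

text \<open>The quotients telescope, and the chain starts and ends with 1.\<close>

lemma prod_chain_diag: "(\<Prod>i<n. chain_diag p n s i) = s"
proof -
  have "(\<Prod>i<k. chain_diag p n s i) = (if k = n then s else 1) * of_nat (prime_chain p n k)" if "k \<le> n" for k
    using that
  proof (induction k)
    case 0
    then show ?case using n by (simp add: prime_chain_def)
  next
    case (Suc k)
    then show ?case using chain_pos[of k] by (simp add: chain_diag_def)
  qed
  from this[of n] show ?thesis using n by (simp add: prime_chain_def)
qed

end

section \<open>Ten linear involutions that reach every perturbation\<close>

lemma det_mat_diag: "det (mat_diag n f) = (\<Prod>i<n. f i :: 'a::idom)"
proof -
  have "det (mat_diag n f) = prod_list (diag_mat (mat_diag n f))"
    by (rule det_upper_triangular[OF _ mat_diag_dim]) (auto simp: upper_triangular_def mat_diag_def)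
  also have "diag_mat (mat_diag n f) = map f [0..<n]"
    by (auto simp: diag_mat_def mat_diag_def)
  finally show ?thesis by (simp add: prod.distinct_set_conv_list[symmetric] atLeast0LessThan)
qed

text \<open>Telescoping: the twist of h by a product A C is the twist of C h by A plus the twist of
  h by C.\<close>

lemma reach_act_mult:
  assumes K: "1 \<le> K" and Ds: "set Ds \<subseteq> carrier_mat n n"
    and c: "A \<in> carrier_mat n n" "B \<in> carrier_mat n n" "C \<in> carrier_mat n n" "D \<in> carrier_mat n n"
    and AB: "\<And>h. h \<in> vser n K \<Longrightarrow> act A B h - h \<in> reach n K Ds"
    and CD: "\<And>h. h \<in> vser n K \<Longrightarrow> act C D h - h \<in> reach n K Ds"
    and h: "h \<in> vser n K"
  shows "act (A * C) (D * B) h - h \<in> reach n K Ds"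
proof -
  have v: "act C D h \<in> vser n K" by (rule act_vser[OF K c(3,4) h])
  have "(act A B (act C D h) - act C D h) + (act C D h - h) \<in> reach n K Ds"
    by (rule reach_add[OF K Ds AB[OF v] CD[OF h]])
  moreover have "(act A B (act C D h) - act C D h) + (act C D h - h) = act A B (act C D h) - h"
    using vserD(1)[OF v] vserD(1)[OF h] vserD(1)[OF act_vser[OF K c(1,2) v]] by (intro eq_vecI) auto
  ultimately show ?thesis by (simp add: act_act[OF K c h])
qed

lemma mat_list_prod_ten:
  assumes "{a, b, c, d, x1, x2, x3, x4, y} \<subseteq> carrier_mat n n" "y * y = 1\<^sub>m n"
  shows "mat_list_prod n [a, b, c, d, x1, x2, x3, x4, y, y] = (a * b) * (c * d) * ((x1 * x2) * (x3 * x4))"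
proof -
  have "y \<in> carrier_mat n n" using assms(1) by simp
  then have "y * (y * 1\<^sub>m n) = 1\<^sub>m n" using assms(2) by (simp only: right_mult_one_mat)
  then show ?thesis using assms(1) by (simp add: right_mult_one_mat[of _ n n] square_mat_simps[where n = n])
qed

text \<open>Four involutions produce the generic diagonal matrix \<delta>, four the quotient
  \<delta>^-1 L of determinant 1, and the pair of equal ones only enlarges the set of twists. If the
  quotient is scalar, L is a multiple of \<delta>; then \<delta>^-1 is produced instead, and
  \<delta> L, a multiple of \<delta>^2, is nonscalar.\<close>

lemma det_pm1_ten_involutions:
  fixes L :: "complex mat"
  assumes n: "2 \<le> n" and L: "L \<in> carrier_mat n n" and det: "det L * det L = 1"
  obtains Ds where "length Ds = 10" "set Ds \<subseteq> {D \<in> carrier_mat n n. D * D = 1\<^sub>m n}" "mat_list_prod n Ds = L"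
    "\<And>K. 2 \<le> K \<Longrightarrow> vser n K \<subseteq> reach n K Ds"
proof -
  obtain p :: "nat \<Rightarrow> nat" where p: "inj p" "\<And>i. prime (p i)" using infinitely_many_primes_inj by metis
  define s where "s = det L"
  have s: "s * s = 1" using det by (simp add: s_def)
  note ctx = p n s
  define d where "d = chain_diag p n s"
  define e where "e i = 1 / d i" for i
  have de: "d i * e i = 1" "e i * d i = 1" for i using chain_diag_nonzero[OF ctx] by (simp_all add: d_def e_def)
  define P where "P b = (mat_monomial n (pair_swap n b) (\<lambda>_. 1) :: complex mat)" for b
  define Q where "Q b = mat_monomial n (pair_swap n b) (pair_diag p n s b)" for b
  define A where "A = (mix_mat n :: complex mat)"
  define \<delta> where "\<delta> = mat_diag n d"
  define \<epsilon> where "\<epsilon> = mat_diag n e"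
  have c: "P b \<in> carrier_mat n n" "Q b \<in> carrier_mat n n" "A \<in> carrier_mat n n" "\<delta> \<in> carrier_mat n n" "\<epsilon> \<in> carrier_mat n n" for b
    by (simp_all add: P_def Q_def A_def \<delta>_def \<epsilon>_def)
  have A: "A * A = 1\<^sub>m n" unfolding A_def by (rule mix_mat_involution[OF n])
  have PQ: "P b * P b = 1\<^sub>m n" "Q b * Q b = 1\<^sub>m n" "P b * Q b = mat_diag n (pair_diag p n s b)" for b
    using chain_diag_involutions[OF ctx, of b] by (simp_all add: P_def Q_def)
  have \<delta>: "\<delta> = (P True * Q True) * (P False * Q False)"
    by (simp add: PQ \<delta>_def d_def pair_diag_mult[OF ctx])
  have \<delta>\<epsilon>: "\<delta> * \<epsilon> = 1\<^sub>m n" "\<epsilon> * \<delta> = 1\<^sub>m n" by (simp_all add: \<delta>_def \<epsilon>_def de)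
  \<comment> \<open>The inverse of \<delta> is needed as a product of the same involutions, in
    reverse order: as second argument of the action, and as the leading block in the scalar
    case.\<close>
  have \<epsilon>: "\<epsilon> = (Q False * P False) * (Q True * P True)" (is "_ = ?E")
  proof -
    have QP: "Q b * P b * (P b * Q b) = 1\<^sub>m n" for b
    proof -
      have "Q b * P b * (P b * Q b) = Q b * (P b * P b) * Q b"
        using c by (simp add: square_mat_simps[where n = n])
      also have "\<dots> = 1\<^sub>m n" by (simp only: PQ(1,2) right_mult_one_mat[OF c(2)])
      finally show ?thesis .
    qed
    have E: "?E \<in> carrier_mat n n" by (intro mult_carrier_mat[of _ n n _ n] c)
    have "?E * \<delta> = (Q False * P False) * ((Q True * P True * (P True * Q True)) * (P False * Q False))"
      unfolding \<delta> using c by (simp add: square_mat_simps[where n = n])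
    also have "\<dots> = 1\<^sub>m n" unfolding QP using c QP[of False]
      by (simp add: left_mult_one_mat[of _ n n] mult_carrier_mat[of _ n n _ n])
    finally have "?E * \<delta> * \<epsilon> = \<epsilon>" using c by simp
    moreover have "?E * \<delta> * \<epsilon> = ?E" unfolding assoc_mult_mat[OF E c(4,5)] \<delta>\<epsilon>(1) by (rule right_mult_one_mat[OF E])
    ultimately show ?thesis by simp
  qed
  have det\<delta>: "det \<delta> = s" unfolding \<delta>_def det_mat_diag d_def by (rule prod_chain_diag[OF ctx])
  have det\<epsilon>: "det \<epsilon> * s = 1" using det_mult[OF c(5,4)] \<delta>\<epsilon>(2) det\<delta> by simp
  \<comment> \<open>Stated for any list containing the five involutions, so that it covers both
    orders in which they are used below.\<close>
  have reach: "vser n K \<subseteq> reach n K Ds"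
    if K: "2 \<le> K" and Ds: "set Ds \<subseteq> carrier_mat n n" and mem: "{P True, Q True, P False, Q False, A} \<subseteq> set Ds" for K Ds
  proof (rule reach_all[OF n K Ds de(1)])
    have K1: "1 \<le> K" using K by simp
    note diff = act_diff_reach[OF K1 Ds]
    have PQr: "act (P b * Q b) (Q b * P b) h - h \<in> reach n K Ds" if "h \<in> vser n K" for b h
      by (rule reach_act_mult[OF K1 Ds c(1,1,2,2) diff diff that]; use mem in \<open>cases b; simp\<close>)
    show "act (mat_diag n d) (mat_diag n e) h - h \<in> reach n K Ds" if "h \<in> vser n K" for h
      unfolding \<delta>_def[symmetric] \<epsilon>_def[symmetric] unfolding \<delta> \<epsilon>
      by (rule reach_act_mult[OF K1 Ds _ _ _ _ PQr PQr that]) (intro mult_carrier_mat[of _ n n _ n] c)+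
    show "\<exists>m. \<forall>i<n. \<alpha> i = m + (if i = j then 1 else 0 :: nat)" if "j < n" "(\<Prod>i<n. d i ^ \<alpha> i) = d j" for \<alpha> j
      using chain_diag_generic[OF ctx that(1)] that(2) by (simp add: d_def)
    show "\<exists>\<pi>. (\<forall>k<n. \<pi> k < n \<and> \<pi> (\<pi> k) = k) \<and> \<pi> i = Suc i \<and> mat_monomial n \<pi> (\<lambda>_. 1) \<in> set Ds" if "Suc i < n" for i
    proof (intro exI conjI)
      show "\<forall>k<n. pair_swap n (even i) k < n \<and> pair_swap n (even i) (pair_swap n (even i) k) = k"
        using pair_swap[OF ctx] by blast
      show "pair_swap n (even i) i = Suc i" by (rule pair_swap_Suc[OF ctx that])
      show "mat_monomial n (pair_swap n (even i)) (\<lambda>_. 1) \<in> set Ds"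
        using mem unfolding P_def by (cases "even i") simp_all
    qed
    show "mix_mat n \<in> set Ds" using mem by (simp add: A_def)
  qed
  have s0: "s \<noteq> 0" using s by auto
  show thesis
  proof (cases "\<exists>k. \<epsilon> * L = k \<cdot>\<^sub>m 1\<^sub>m n")
    case False
    have B: "\<epsilon> * L \<in> carrier_mat n n" using c L by simp
    have "det (\<epsilon> * L) = 1" using det_mult[OF c(5) L] det\<epsilon> by (simp add: s_def)
    from False have "\<epsilon> * L \<noteq> k \<cdot>\<^sub>m 1\<^sub>m n" for k by blast
    from nonscalar_four_involutions[OF B \<open>det (\<epsilon> * L) = 1\<close> this] obtain D1 D2 D3 D4
      where D: "{D1, D2, D3, D4} \<subseteq> {D \<in> carrier_mat n n. D * D = 1\<^sub>m n}" and e: "\<epsilon> * L = D1 * D2 * (D3 * D4)" by blast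
    let ?Ds = "[P True, Q True, P False, Q False, D1, D2, D3, D4, A, A]"
    have "mat_list_prod n ?Ds = \<delta> * (\<epsilon> * L)"
      unfolding e \<delta> using D c A by (intro mat_list_prod_ten) auto
    also have "\<dots> = L" using assoc_mult_mat[OF c(4,5) L] \<delta>\<epsilon>(1) L by simp
    finally have prod: "mat_list_prod n ?Ds = L" .
    have sub: "set ?Ds \<subseteq> {D \<in> carrier_mat n n. D * D = 1\<^sub>m n}" using D c A PQ by simp
    have "vser n K \<subseteq> reach n K ?Ds" if "2 \<le> K" for K
    proof (rule reach[OF that])
      show "set ?Ds \<subseteq> carrier_mat n n" using sub by blast
      show "{P True, Q True, P False, Q False, A} \<subseteq> set ?Ds" by simp
    qed
    from that[OF _ sub prod this] show thesis by simp
  next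
    \<comment> \<open>Here L = k \<delta>, and the reversed block with product \<epsilon> comes
      first, followed by four involutions for \<delta> L = k \<delta>^2. Its determinant is s s =
      1.\<close>
    case True
    then obtain k where k: "\<epsilon> * L = k \<cdot>\<^sub>m 1\<^sub>m n" ..
    have "L = \<delta> * (\<epsilon> * L)" using assoc_mult_mat[OF c(4,5) L] \<delta>\<epsilon>(1) L by simp
    then have Lk: "L = k \<cdot>\<^sub>m \<delta>" unfolding k using mult_smult_distrib[OF c(4), of "1\<^sub>m n" n k] c(4) by simp
    have k0: "k \<noteq> 0"
    proof
      assume "k = 0"
      with Lk have "det L = 0" using n c(4) by (simp add: power_0_left)
      with s0 show False by (simp add: s_def)
    qed
    have B: "\<delta> * L \<in> carrier_mat n n" using c L by simp
    have dd: "\<delta> * L = mat_diag n (\<lambda>i. k * (d i * d i))"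
      unfolding Lk mult_smult_distrib[OF c(4,4)] by (auto simp: \<delta>_def intro!: eq_matI simp: mat_diag_def[of n "\<lambda>i. d i * d i"] mat_diag_def[of n "\<lambda>i. k * (d i * d i)"])
    have ns: "\<delta> * L \<noteq> k' \<cdot>\<^sub>m 1\<^sub>m n" for k'
    proof
      assume "\<delta> * L = k' \<cdot>\<^sub>m 1\<^sub>m n"
      then have "mat_diag n (\<lambda>i. k * (d i * d i)) $$ (i, i) = k'" if "i < n" for i
        using that unfolding dd by simp
      then have "k * (d i * d i) = k'" if "i < n" for i using that by (simp add: mat_diag_def)
      from this[of 0] this[of 1] n k0 have "d 0 * d 0 = d 1 * d 1" by (auto simp: One_nat_def)
      then show False using chain_diag_square_neq[OF ctx] by (simp add: d_def)
    qed
    have "det (\<delta> * L) = 1" using det_mult[OF c(4) L] det\<delta> s by (simp add: s_def)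
    from nonscalar_four_involutions[OF B this ns] obtain D1 D2 D3 D4
      where D: "{D1, D2, D3, D4} \<subseteq> {D \<in> carrier_mat n n. D * D = 1\<^sub>m n}" and e: "\<delta> * L = D1 * D2 * (D3 * D4)" by blast
    let ?Ds = "[Q False, P False, Q True, P True, D1, D2, D3, D4, A, A]"
    have "mat_list_prod n ?Ds = \<epsilon> * (\<delta> * L)"
      unfolding e \<epsilon> using D c A by (intro mat_list_prod_ten) auto
    also have "\<dots> = L" using assoc_mult_mat[OF c(5,4) L] \<delta>\<epsilon>(2) L by simp
    finally have prod: "mat_list_prod n ?Ds = L" .
    have sub: "set ?Ds \<subseteq> {D \<in> carrier_mat n n. D * D = 1\<^sub>m n}" using D c A PQ by simp
    have "vser n K \<subseteq> reach n K ?Ds" if "2 \<le> K" for K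
    proof (rule reach[OF that])
      show "set ?Ds \<subseteq> carrier_mat n n" using sub by blast
      show "{P True, Q True, P False, Q False, A} \<subseteq> set ?Ds" by simp
    qed
    from that[OF _ sub prod this] show thesis by simp
  qed
qed

section \<open>Padding and pairing of products in a group\<close>

lemma (in monoid) list_product_append:
  "set xs \<subseteq> carrier G \<Longrightarrow> set ys \<subseteq> carrier G \<Longrightarrow> list_product G (xs @ ys) = list_product G xs \<otimes> list_product G ys"
  by (induction xs) (auto simp: list_product_closed m_assoc)

lemma (in monoid) list_product_pad:
  assumes "set xs \<subseteq> S" "\<one> \<in> S" "S \<subseteq> carrier G" "length xs \<le> k"
  shows "\<exists>ys. length ys = k \<and> set ys \<subseteq> S \<and> list_product G ys = list_product G xs"
proof (intro exI conjI)
  let ?ys = "xs @ replicate (k - length xs) \<one>"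
  show "length ?ys = k" "set ?ys \<subseteq> S" using assms by auto
  have "list_product G (replicate j \<one>) = \<one>" for j by (induction j) auto
  then show "list_product G ?ys = list_product G xs"
    using assms by (subst list_product_append) (auto simp: list_product_closed)
qed

lemma (in group) one_involution: "\<one> \<in> involutions G"
  by (simp add: involutions_def)

lemma (in group) involution_reversible: "involutions G \<subseteq> reversible_elements G"
  by (auto simp: involutions_def reversible_elements_def intro!: bexI[of _ \<one>])

text \<open>Conjugation by a turns a b into b a, which is its inverse.\<close>

lemma (in group) involution_mult_reversible:
  assumes "a \<in> involutions G" "b \<in> involutions G"
  shows "a \<otimes> b \<in> reversible_elements G"
proof -
  have ab: "a \<in> carrier G" "b \<in> carrier G" "inv a = a" "inv b = b" using assms by (auto simp: involutions_def)
  have "inv a \<otimes> (a \<otimes> b) \<otimes> a = inv (a \<otimes> b)"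
    using ab by (simp add: inv_mult_group m_assoc[symmetric] l_inv[of a, unfolded ab(3)])
  then show ?thesis using ab(1,2) unfolding reversible_elements_def by blast
qed

lemma (in group) involution_ord_dvd:
  assumes "a \<in> involutions G" shows "ord a dvd 4"
proof -
  have a: "a \<in> carrier G" "a \<otimes> a = \<one>" using assms r_inv[of a] by (auto simp: involutions_def)
  have "a [^] (4::nat) = a \<otimes> a \<otimes> (a \<otimes> a)" using a(1) by (simp add: numeral_eq_Suc One_nat_def m_assoc)
  then show ?thesis using a pow_eq_id by simp
qed

lemma (in group) pair_involutions:
  assumes "length xs = 2 * k" "set xs \<subseteq> involutions G"
  shows "\<exists>ys. length ys = k \<and> set ys \<subseteq> reversible_elements G \<and> list_product G ys = list_product G xs"
  using assms
proof (induction k arbitrary: xs)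
  case (Suc k)
  then obtain a b zs where xs: "xs = a # b # zs" by (metis Suc_length_conv mult_Suc_right numeral_2_eq_2 add_Suc)
  with Suc obtain ys where ys: "length ys = k" "set ys \<subseteq> reversible_elements G" "list_product G ys = list_product G zs"
    by force
  have "list_product G zs \<in> carrier G" using Suc.prems xs by (intro list_product_closed) (auto simp: involutions_def)
  then have "list_product G ((a \<otimes> b) # ys) = list_product G xs"
    using ys Suc.prems xs by (auto simp: involutions_def m_assoc)
  then show ?case using ys Suc.prems xs involution_mult_reversible[of a b]
    by (intro exI[of _ "(a \<otimes> b) # ys"]) auto
qed simp

lemma formal_ten_involutions:
  assumes n: "2 \<le> n" and F: "F \<in> carrier (formal_maps n)"
    and det: "det (linear_part n F) = 1 \<or> det (linear_part n F) = - 1"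
  obtains Ss where "length Ss = 10" "set Ss \<subseteq> involutions (formal_maps n)" "F = list_product (formal_maps n) Ss"
proof -
  have "det (linear_part n F) * det (linear_part n F) = 1" using det by auto
  from det_pm1_ten_involutions[OF n linear_part_carrier this] obtain Ds where Ds: "length Ds = 10"
    "set Ds \<subseteq> {D \<in> carrier_mat n n. D * D = 1\<^sub>m n}" "mat_list_prod n Ds = linear_part n F"
    "\<And>K. 2 \<le> K \<Longrightarrow> vser n K \<subseteq> reach n K Ds" by blast
  from formal_map_product_of_involutions[OF F Ds(2) Ds(3)[symmetric] Ds(4)] obtain Ss
    where "length Ss = length Ds" "set Ss \<subseteq> involutions (formal_maps n)" "F = list_product (formal_maps n) Ss" by blast
  with Ds(1) show thesis by (intro that) simp_all
qed

text \<open>A reversible element is conjugate to its inverse, so the determinant of its linear part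
  equals its own reciprocal.\<close>

lemma det_reversible_product:
  assumes "set gs \<subseteq> reversible_elements (formal_maps n)"
  shows "det (linear_part n (list_product (formal_maps n) gs)) = 1 \<or> det (linear_part n (list_product (formal_maps n) gs)) = - 1"
proof -
  let ?G = "formal_maps n"
  let ?d = "\<lambda>F. det (linear_part n F) :: complex"
  interpret group ?G by (rule group_formal_maps)
  have mult: "?d (a \<otimes>\<^bsub>?G\<^esub> b) = ?d a * ?d b" if "a \<in> carrier ?G" "b \<in> carrier ?G" for a b
    using that by (simp add: carrier_formal_maps det_linear_part_comp)
  have inv: "?d (inv\<^bsub>?G\<^esub> a) * ?d a = 1" if "a \<in> carrier ?G" for a
    using mult[of "inv\<^bsub>?G\<^esub> a" a] that l_inv[OF that] by (simp add: linear_part_X)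
  have rev: "?d g * ?d g = 1" if "g \<in> reversible_elements ?G" for g
  proof -
    from that obtain h where g: "g \<in> carrier ?G" and h: "h \<in> carrier ?G"
      and e: "inv\<^bsub>?G\<^esub> h \<otimes>\<^bsub>?G\<^esub> g \<otimes>\<^bsub>?G\<^esub> h = inv\<^bsub>?G\<^esub> g" by (auto simp: reversible_elements_def)
    have "?d (inv\<^bsub>?G\<^esub> g) = ?d (inv\<^bsub>?G\<^esub> h) * ?d g * ?d h"
      unfolding e[symmetric] using g h by (simp only: mult m_closed inv_closed)
    also have "\<dots> = ?d g" using inv[OF h] by (simp add: mult_ac)
    finally show ?thesis using inv[OF g] by simp
  qed
  have "?d (list_product ?G gs) * ?d (list_product ?G gs) = 1"
    using assms
  proof (induction gs)
    case Nil
    then show ?case by (simp add: linear_part_X)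
  next
    case (Cons g gs)
    have "set (g # gs) \<subseteq> carrier ?G" using Cons.prems by (auto simp: reversible_elements_def)
    then have "?d (list_product ?G (g # gs)) = ?d g * ?d (list_product ?G gs)"
      using mult[of g "list_product ?G gs"] list_product_closed[of gs] by simp
    moreover have "?d g * ?d g = 1" "?d (list_product ?G gs) * ?d (list_product ?G gs) = 1"
      using Cons rev by auto
    ultimately show ?case by (simp add: mult_ac)
  qed
  then show ?thesis by (simp add: square_eq_1_iff)
qed

theorem corollary1p5:
  fixes n c :: nat and F :: "complex mfps vec"
  assumes "n \<ge> 2"
    and "F \<in> carrier (formal_maps n)"
    and "c = nat \<lceil>log 2 (real n)\<rceil>"
  shows
    "let P1 = (\<exists>gs. set gs \<subseteq> reversible_elements (formal_maps n) \<and>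
                 F = list_product (formal_maps n) gs);
         P2 = (det (linear_part n F) = 1 \<or> det (linear_part n F) = - 1);
         P3 = (\<exists>gs. length gs = 2 + 3 * c \<and> set gs \<subseteq> reversible_elements (formal_maps n) \<and>
                 F = list_product (formal_maps n) gs);
         P4 = (\<exists>gs. length gs = 9 + 6 * c \<and> set gs \<subseteq> involutions (formal_maps n) \<and>
                 F = list_product (formal_maps n) gs);
         P5 = (\<exists>xs ys gs. length xs = 3 + 6 * c \<and> set xs \<subseteq> involutions (formal_maps n) \<and>
                 length ys = 2 \<and>
                 set ys \<subseteq> {g \<in> reversible_elements (formal_maps n).
                              group.ord (formal_maps n) g dvd 4} \<and>
                 gs \<in> shuffles xs ys \<and> F = list_product (formal_maps n) gs)
     in (P1 \<longleftrightarrow> P2) \<and> (P2 \<longleftrightarrow> P3) \<and> (P3 \<longleftrightarrow> P4) \<and> (P4 \<longleftrightarrow> P5)"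
proof -
  let ?G = "formal_maps n"
  interpret group ?G by (rule group_formal_maps)
  have "1 \<le> log 2 (real n)" using assms(1) by (simp add: le_log_iff)
  then have "1 \<le> \<lceil>log 2 (real n)\<rceil>" by linarith
  then have c: "1 \<le> c" unfolding assms(3) by linarith
  let ?P1 = "\<exists>gs. set gs \<subseteq> reversible_elements ?G \<and> F = list_product ?G gs"
  let ?P2 = "det (linear_part n F) = 1 \<or> det (linear_part n F) = - 1"
  let ?P3 = "\<exists>gs. length gs = 2 + 3 * c \<and> set gs \<subseteq> reversible_elements ?G \<and> F = list_product ?G gs"
  let ?P4 = "\<exists>gs. length gs = 9 + 6 * c \<and> set gs \<subseteq> involutions ?G \<and> F = list_product ?G gs"
  let ?P5 = "\<exists>xs ys gs. length xs = 3 + 6 * c \<and> set xs \<subseteq> involutions ?G \<and> length ys = 2 \<and>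
    set ys \<subseteq> {g \<in> reversible_elements ?G. ord g dvd 4} \<and> gs \<in> shuffles xs ys \<and> F = list_product ?G gs"
  have rc: "reversible_elements ?G \<subseteq> carrier ?G" by (auto simp: reversible_elements_def)
  have one_rev: "\<one>\<^bsub>?G\<^esub> \<in> reversible_elements ?G" using one_involution involution_reversible by blast
  have 12: "?P2" if "?P1" using that det_reversible_product by blast
  have 31: "?P1" if "?P3" using that by blast
  have 41: "?P1" if "?P4" using that involution_reversible by blast
  have 51: "?P1" if "?P5"
  proof -
    from that obtain xs ys gs where "set xs \<subseteq> involutions ?G" "set ys \<subseteq> reversible_elements ?G"
      "gs \<in> shuffles xs ys" "F = list_product ?G gs" by blast
    moreover from this have "set gs = set xs \<union> set ys" by (simp add: set_shuffles)
    ultimately show ?thesis using involution_reversible by blast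
  qed
  have 2: "?P3 \<and> ?P4 \<and> ?P5" if det: "?P2"
  proof -
    from formal_ten_involutions[OF assms(1,2) det] obtain Ss where Ss: "length Ss = 10" "set Ss \<subseteq> involutions ?G" "F = list_product ?G Ss" .
    have pad: "\<exists>gs. length gs = k \<and> set gs \<subseteq> involutions ?G \<and> F = list_product ?G gs" if "10 \<le> k" for k
      using list_product_pad[OF Ss(2) one_involution involutions_carrier, of k] Ss(1,3) that by metis
    \<comment> \<open>Five reversible elements suffice, and 5 \<le> 2 + 3 c. Likewise 10 \<le> 9 + 6
      c, and 10 \<le> (3 + 6 c) + 2 for the last condition.\<close>
    from pair_involutions[of Ss 5] Ss obtain Rs where Rs: "length Rs = 5" "set Rs \<subseteq> reversible_elements ?G" "F = list_product ?G Rs" by auto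
    have "?P3"
      using list_product_pad[OF Rs(2) one_rev rc, of "2 + 3 * c"] Rs(1,3) c by auto
    moreover have "?P4" using pad[of "9 + 6 * c"] c by simp
    moreover have "?P5"
    proof -
      \<comment> \<open>All factors are taken to be involutions; the last two play the reversible
        elements of order dividing 4, and concatenation is the trivial shuffle.\<close>
      from pad[of "(3 + 6 * c) + 2"] c obtain gs where gs: "length gs = (3 + 6 * c) + 2"
        "set gs \<subseteq> involutions ?G" "F = list_product ?G gs" by auto
      let ?xs = "take (3 + 6 * c) gs" and ?ys = "drop (3 + 6 * c) gs"
      have "set ?xs \<subseteq> involutions ?G" "set ?ys \<subseteq> involutions ?G"
        using gs(2) set_take_subset set_drop_subset by fast+
      moreover from this(2) have "set ?ys \<subseteq> {g \<in> reversible_elements ?G. ord g dvd 4}"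
        using involution_reversible involution_ord_dvd by blast
      moreover have "xs @ ys \<in> shuffles xs ys" for xs ys :: "complex mfps vec list"
        by (induction xs) (auto intro: Cons_in_shuffles_leftI)
      then have "gs \<in> shuffles ?xs ?ys" by (metis append_take_drop_id)
      ultimately show ?thesis using gs(1,3)
        by (intro exI[of _ ?xs] exI[of _ ?ys] exI[of _ gs]) auto
    qed
    ultimately show ?thesis by blast
  qed
  show ?thesis unfolding Let_def using 12 31 41 51 2 by argo
qed

end
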